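(* Let $(M,g,J)$ be a weakly Einstein Kähler surface and let $\tau:M\to\mathbb{R}$ be a transnormal function whose gradient $v=\nabla\tau$ is holomorphic. Then $\tau$ is isoparametric.
   Context: Manifolds are connected and all objects are smooth. A Kähler surface is a Kähler manifold of complex dimension $2$ (real dimension $4$). A Riemannian four-manifold $(M,g)$ with curvature tensor $R$ is called weakly Einstein if the three-index contraction of $R$ against itself is a functional multiple of the metric, i.e. $R_{ikpq}R_j{}^{kpq}=\phi\, g_{ij}$ for some function $\phi:M\to\mathbb{R}$. A function $\tau$ on a Riemannian manifold, with gradient $v=\nabla\tau$, is called transnormal if the integral curves of $v$ are reparametrized geodesics; equivalently, locally, at points where $v\neq 0$, the function $Q=g(v,v)$ is a function of $\tau$. It is called isoparametric if, locally, at points where $v\neq0$, both $Q=g(v,v)$ and the Laplacian $\Delta\tau$ are functions of $\tau$. The gradient being holomorphic means that $v$ is a real-holomorphic vector field, i.e. its local flow preserves $J$ ($\mathcal{L}_vJ=0$). *)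

theory Defs
  imports "HOL-Analysis.Analysis"
begin

text \<open>
  Differential geometry on a manifold \<open>M\<close> with smooth atlas \<open>A\<close>, in classical index notation.
  A tensor field is the family of its component functions, one for each chart of the atlas,
  subject to the tensor transformation law. Components in a chart \<open>c\<close> are functions on the
  manifold (not on the image of the chart), meaningful at the points of the domain \<open>fst c\<close>.
\<close>


subsection \<open>Smooth manifolds\<close>

text \<open>All iterated directional derivatives exist and are continuous; intended for open \<open>S\<close>.\<close>

fun times_differentiable_on ::
  "nat \<Rightarrow> 'a::real_normed_vector set \<Rightarrow> ('a \<Rightarrow> 'b::real_normed_vector) \<Rightarrow> bool" where
  "times_differentiable_on 0 S f \<longleftrightarrow> continuous_on S f"
| "times_differentiable_on (Suc k) S f \<longleftrightarrow>
     (\<forall>x\<in>S. f differentiable (at x)) \<and>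
     (\<forall>v. times_differentiable_on k S (\<lambda>x. frechet_derivative f (at x) v))"

definition smooth_on ::
  "'a::real_normed_vector set \<Rightarrow> ('a \<Rightarrow> 'b::real_normed_vector) \<Rightarrow> bool" where
  "smooth_on S f \<longleftrightarrow> (\<forall>k. times_differentiable_on k S f)"

type_synonym ('a, 'n) chart = "'a set \<times> ('a \<Rightarrow> real ^ 'n)"

definition chart_inv :: "('a, 'n::finite) chart \<Rightarrow> real ^ 'n \<Rightarrow> 'a" where
  "chart_inv c = inv_into (fst c) (snd c)"

definition smooth_in_chart ::
  "('a, 'n::finite) chart \<Rightarrow> ('a \<Rightarrow> 'b::real_normed_vector) \<Rightarrow> bool" where
  "smooth_in_chart c f \<longleftrightarrow> smooth_on (snd c ` fst c) (f \<circ> chart_inv c)"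

definition smooth_function ::
  "('a, 'n::finite) chart set \<Rightarrow> ('a \<Rightarrow> 'b::real_normed_vector) \<Rightarrow> bool" where
  "smooth_function A f \<longleftrightarrow> (\<forall>c\<in>A. smooth_in_chart c f)"

text \<open>The \<open>i\<close>-th coordinate derivative \<open>\<partial>\<^sub>i f\<close> in the chart \<open>c\<close>.\<close>

definition pd :: "('a, 'n::finite) chart \<Rightarrow> 'n \<Rightarrow> ('a \<Rightarrow> real) \<Rightarrow> 'a \<Rightarrow> real" where
  "pd c i f p = frechet_derivative (f \<circ> chart_inv c) (at (snd c p)) (axis i 1)"

text \<open>The matrix \<open>\<partial>y\<^sup>k/\<partial>x\<^sup>i\<close>, where \<open>x\<close> and \<open>y\<close> are the coordinates of \<open>c\<close> and \<open>d\<close>; row index \<open>k\<close>.\<close>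

definition jacobian ::
  "('a, 'n::finite) chart \<Rightarrow> ('a, 'n) chart \<Rightarrow> 'a \<Rightarrow> real ^ 'n ^ 'n" where
  "jacobian c d p = (\<chi> k i. pd c i (\<lambda>q. snd d q $ k) p)"

locale smooth_manifold =
  fixes M :: "'a topology" and A :: "('a, 'n::finite) chart set"
  assumes Hausdorff: "Hausdorff_space M"
    and second_countable:
      "\<exists>B. countable B \<and> openin M = arbitrary union_of (\<lambda>U. U \<in> B)"
    and connected: "connected_space M"
    and charts_cover: "(\<Union>c\<in>A. fst c) = topspace M"
    and chart_domain: "c \<in> A \<Longrightarrow> openin M (fst c)"
    and chart_image: "c \<in> A \<Longrightarrow> open (snd c ` fst c)"
    and chart_homeomorphic: "c \<in> A \<Longrightarrow>
      homeomorphic_map (subtopology M (fst c)) (top_of_set (snd c ` fst c)) (snd c)"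
    and charts_compatible: "c \<in> A \<Longrightarrow> d \<in> A \<Longrightarrow>
      smooth_on (snd c ` (fst c \<inter> fst d)) (snd d \<circ> chart_inv c)"


subsection \<open>Riemannian and Kaehler metrics\<close>

type_synonym ('a, 'n) tensor2 = "('a, 'n) chart \<Rightarrow> 'a \<Rightarrow> real ^ 'n ^ 'n"
type_synonym ('a, 'n) vector_field = "('a, 'n) chart \<Rightarrow> 'a \<Rightarrow> real ^ 'n"

locale riemannian_manifold = smooth_manifold M A
  for M :: "'a topology" and A :: "('a, 'n::finite) chart set" +
  fixes g :: "('a, 'n) tensor2"
  assumes metric_smooth: "c \<in> A \<Longrightarrow> smooth_in_chart c (g c)"
    and metric_symmetric: "c \<in> A \<Longrightarrow> p \<in> fst c \<Longrightarrow> transpose (g c p) = g c p"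
    and metric_positive:
      "c \<in> A \<Longrightarrow> p \<in> fst c \<Longrightarrow> x \<noteq> 0 \<Longrightarrow> x \<bullet> (g c p *v x) > 0"
    and metric_tensor: "c \<in> A \<Longrightarrow> d \<in> A \<Longrightarrow> p \<in> fst c \<inter> fst d \<Longrightarrow>
      g c p = transpose (jacobian c d p) ** g d p ** jacobian c d p"

definition ginv :: "('a, 'n::finite) tensor2 \<Rightarrow> ('a, 'n) tensor2" where
  "ginv g c p = matrix_inv (g c p)"

text \<open>Christoffel symbols \<open>\<Gamma>\<^sup>k\<^sub>i\<^sub>j\<close> of the Levi-Civita connection.\<close>

definition christoffel ::
  "('a, 'n::finite) tensor2 \<Rightarrow> ('a, 'n) chart \<Rightarrow> 'n \<Rightarrow> 'n \<Rightarrow> 'n \<Rightarrow> 'a \<Rightarrow> real" where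
  "christoffel g c k i j p =
     (\<Sum>l\<in>UNIV. ginv g c p $ k $ l *
        (pd c i (\<lambda>q. g c q $ j $ l) p + pd c j (\<lambda>q. g c q $ i $ l) p
         - pd c l (\<lambda>q. g c q $ i $ j) p)) / 2"

text \<open>In an almost complex structure \<open>J\<close>, the entry \<open>J c p $ i $ j\<close> is \<open>J\<^sup>i\<^sub>j\<close>, so that \<open>J c p *v x\<close> is
  the image of the vector \<open>x\<close>.\<close>

definition nabla_J ::
  "('a, 'n::finite) tensor2 \<Rightarrow> ('a, 'n) tensor2 \<Rightarrow> ('a, 'n) chart
     \<Rightarrow> 'n \<Rightarrow> 'n \<Rightarrow> 'n \<Rightarrow> 'a \<Rightarrow> real" where
  "nabla_J g J c k i j p =
     pd c k (\<lambda>q. J c q $ i $ j) p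
     + (\<Sum>m\<in>UNIV. christoffel g c i k m p * J c p $ m $ j)
     - (\<Sum>m\<in>UNIV. christoffel g c m k j p * J c p $ i $ m)"

locale kaehler_manifold = riemannian_manifold M A g
  for M :: "'a topology" and A :: "('a, 'n::finite) chart set" and g :: "('a, 'n) tensor2" +
  fixes J :: "('a, 'n) tensor2"
  assumes J_smooth: "c \<in> A \<Longrightarrow> smooth_in_chart c (J c)"
    and J_tensor: "c \<in> A \<Longrightarrow> d \<in> A \<Longrightarrow> p \<in> fst c \<inter> fst d \<Longrightarrow>
      jacobian c d p ** J c p = J d p ** jacobian c d p"
    and J_squared: "c \<in> A \<Longrightarrow> p \<in> fst c \<Longrightarrow> J c p ** J c p = - mat 1"
    and J_isometric:
      "c \<in> A \<Longrightarrow> p \<in> fst c \<Longrightarrow> transpose (J c p) ** g c p ** J c p = g c p"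
    and J_parallel: "c \<in> A \<Longrightarrow> p \<in> fst c \<Longrightarrow> nabla_J g J c k i j p = 0"


subsection \<open>Curvature and the weakly Einstein condition\<close>

text \<open>The components \<open>R\<^sub>i\<^sub>j\<^sub>k\<^sup>l\<close> with \<open>R(\<partial>\<^sub>i,\<partial>\<^sub>j)\<partial>\<^sub>k = R\<^sub>i\<^sub>j\<^sub>k\<^sup>l \<partial>\<^sub>l\<close>, where
  \<open>R(X,Y)Z = \<nabla>\<^sub>X\<nabla>\<^sub>YZ - \<nabla>\<^sub>Y\<nabla>\<^sub>XZ - \<nabla>\<^sub>[\<^sub>X\<^sub>,\<^sub>Y\<^sub>]Z\<close>. The opposite sign convention gives
  the same contraction of \<open>R\<close> against itself.\<close>

definition riemann_up ::
  "('a, 'n::finite) tensor2 \<Rightarrow> ('a, 'n) chart \<Rightarrow> 'n \<Rightarrow> 'n \<Rightarrow> 'n \<Rightarrow> 'n \<Rightarrow> 'a \<Rightarrow> real" where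
  "riemann_up g c i j k l p =
     pd c i (christoffel g c l j k) p - pd c j (christoffel g c l i k) p
     + (\<Sum>m\<in>UNIV. christoffel g c l i m p * christoffel g c m j k p
                - christoffel g c l j m p * christoffel g c m i k p)"

definition riemann ::
  "('a, 'n::finite) tensor2 \<Rightarrow> ('a, 'n) chart \<Rightarrow> 'n \<Rightarrow> 'n \<Rightarrow> 'n \<Rightarrow> 'n \<Rightarrow> 'a \<Rightarrow> real" where
  "riemann g c i j k l p = (\<Sum>m\<in>UNIV. riemann_up g c i j k m p * g c p $ m $ l)"

text \<open>\<open>R\<^sub>i\<^sub>k\<^sub>p\<^sub>q R\<^sub>j\<^sup>k\<^sup>p\<^sup>q\<close>\<close>

definition curvature_contraction ::
  "('a, 'n::finite) tensor2 \<Rightarrow> ('a, 'n) chart \<Rightarrow> 'n \<Rightarrow> 'n \<Rightarrow> 'a \<Rightarrow> real" where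
  "curvature_contraction g c i j x =
     (\<Sum>k\<in>UNIV. \<Sum>p\<in>UNIV. \<Sum>q\<in>UNIV. riemann g c i k p q x *
        (\<Sum>k'\<in>UNIV. \<Sum>p'\<in>UNIV. \<Sum>q'\<in>UNIV.
           ginv g c x $ k $ k' * ginv g c x $ p $ p' * ginv g c x $ q $ q' *
           riemann g c j k' p' q' x))"

definition weakly_einstein ::
  "('a, 'n::finite) chart set \<Rightarrow> ('a, 'n) tensor2 \<Rightarrow> bool" where
  "weakly_einstein A g \<longleftrightarrow>
     (\<exists>\<phi> :: 'a \<Rightarrow> real. \<forall>c\<in>A. \<forall>x\<in>fst c. \<forall>i j.
        curvature_contraction g c i j x = \<phi> x * g c x $ i $ j)"


subsection \<open>Functions and their gradients\<close>

definition gradient ::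
  "('a, 'n::finite) tensor2 \<Rightarrow> ('a \<Rightarrow> real) \<Rightarrow> ('a, 'n) vector_field" where
  "gradient g \<tau> c p = (\<chi> i. \<Sum>j\<in>UNIV. ginv g c p $ i $ j * pd c j \<tau> p)"

definition gradient_square ::
  "('a, 'n::finite) tensor2 \<Rightarrow> ('a \<Rightarrow> real) \<Rightarrow> ('a, 'n) chart \<Rightarrow> 'a \<Rightarrow> real" where
  "gradient_square g \<tau> c p = gradient g \<tau> c p \<bullet> (g c p *v gradient g \<tau> c p)"

definition laplacian ::
  "('a, 'n::finite) tensor2 \<Rightarrow> ('a \<Rightarrow> real) \<Rightarrow> ('a, 'n) chart \<Rightarrow> 'a \<Rightarrow> real" where
  "laplacian g \<tau> c p =
     (\<Sum>i\<in>UNIV. \<Sum>j\<in>UNIV. ginv g c p $ i $ j *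
        (pd c i (pd c j \<tau>) p - (\<Sum>k\<in>UNIV. christoffel g c k i j p * pd c k \<tau> p)))"

text \<open>The components of the Lie derivative \<open>L\<^sub>X J\<close>.\<close>

definition lie_J ::
  "('a, 'n::finite) tensor2 \<Rightarrow> ('a, 'n) vector_field \<Rightarrow> ('a, 'n) chart
     \<Rightarrow> 'n \<Rightarrow> 'n \<Rightarrow> 'a \<Rightarrow> real" where
  "lie_J J X c i j p =
     (\<Sum>k\<in>UNIV. X c p $ k * pd c k (\<lambda>q. J c q $ i $ j) p
             - J c p $ k $ j * pd c k (\<lambda>q. X c q $ i) p
             + J c p $ i $ k * pd c j (\<lambda>q. X c q $ k) p)"

definition holomorphic_vector_field ::
  "('a, 'n::finite) chart set \<Rightarrow> ('a, 'n) tensor2 \<Rightarrow> ('a, 'n) vector_field \<Rightarrow> bool" where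
  "holomorphic_vector_field A J X \<longleftrightarrow> (\<forall>c\<in>A. \<forall>p\<in>fst c. \<forall>i j. lie_J J X c i j p = 0)"


subsection \<open>Transnormal and isoparametric functions\<close>

text \<open>In the following, \<open>I\<close> is an open interval, possibly unbounded.\<close>

definition integral_curve ::
  "'a topology \<Rightarrow> ('a, 'n::finite) chart set \<Rightarrow> ('a, 'n) vector_field \<Rightarrow> real set
     \<Rightarrow> (real \<Rightarrow> 'a) \<Rightarrow> bool" where
  "integral_curve M A X I \<gamma> \<longleftrightarrow>
     continuous_map (top_of_set I) M \<gamma> \<and>
     (\<forall>t\<in>I. \<forall>c\<in>A. \<gamma> t \<in> fst c \<longrightarrow>
        ((snd c \<circ> \<gamma>) has_vector_derivative X c (\<gamma> t)) (at t))"

definition velocity ::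
  "('a, 'n::finite) chart \<Rightarrow> (real \<Rightarrow> 'a) \<Rightarrow> real \<Rightarrow> real ^ 'n" where
  "velocity c \<gamma> t = vector_derivative (snd c \<circ> \<gamma>) (at t)"

definition geodesic ::
  "'a topology \<Rightarrow> ('a, 'n::finite) chart set \<Rightarrow> ('a, 'n) tensor2 \<Rightarrow> real set
     \<Rightarrow> (real \<Rightarrow> 'a) \<Rightarrow> bool" where
  "geodesic M A g I \<gamma> \<longleftrightarrow>
     continuous_map (top_of_set I) M \<gamma> \<and>
     (\<forall>t\<in>I. \<forall>c\<in>A. \<gamma> t \<in> fst c \<longrightarrow>
        (snd c \<circ> \<gamma>) differentiable (at t) \<and>
        (velocity c \<gamma> has_vector_derivative
           (\<chi> k. - (\<Sum>i\<in>UNIV. \<Sum>j\<in>UNIV.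
              christoffel g c k i j (\<gamma> t) * velocity c \<gamma> t $ i * velocity c \<gamma> t $ j))) (at t))"

text \<open>Constant curves count as geodesics, so the integral curves at the zeros of a vector field
  satisfy this trivially.\<close>

definition reparametrized_geodesic ::
  "'a topology \<Rightarrow> ('a, 'n::finite) chart set \<Rightarrow> ('a, 'n) tensor2 \<Rightarrow> real set
     \<Rightarrow> (real \<Rightarrow> 'a) \<Rightarrow> bool" where
  "reparametrized_geodesic M A g I \<gamma> \<longleftrightarrow>
     (\<exists>I' \<sigma>. open I' \<and> is_interval I' \<and> bij_betw \<sigma> I' I \<and>
        smooth_on I' \<sigma> \<and> (\<forall>s\<in>I'. deriv \<sigma> s \<noteq> 0) \<and> geodesic M A g I' (\<gamma> \<circ> \<sigma>))"

definition transnormal ::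
  "'a topology \<Rightarrow> ('a, 'n::finite) chart set \<Rightarrow> ('a, 'n) tensor2 \<Rightarrow> ('a \<Rightarrow> real) \<Rightarrow> bool" where
  "transnormal M A g \<tau> \<longleftrightarrow>
     (\<forall>I \<gamma>. open I \<and> is_interval I \<and> integral_curve M A (gradient g \<tau>) I \<gamma> \<longrightarrow>
        reparametrized_geodesic M A g I \<gamma>)"

text \<open>Near every point where the gradient is nonzero, both functions factor through \<open>\<tau>\<close>. Since
  \<open>\<tau>\<close> is a submersion there, the factors are smooth on the range of \<open>\<tau>\<close> near that point.\<close>

definition isoparametric ::
  "'a topology \<Rightarrow> ('a, 'n::finite) chart set \<Rightarrow> ('a, 'n) tensor2 \<Rightarrow> ('a \<Rightarrow> real) \<Rightarrow> bool" where
  "isoparametric M A g \<tau> \<longleftrightarrow>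
     (\<forall>c\<in>A. \<forall>p\<in>fst c. gradient g \<tau> c p \<noteq> 0 \<longrightarrow>
        (\<exists>W a b. openin M W \<and> p \<in> W \<and> W \<subseteq> fst c \<and>
           (\<forall>q\<in>W. gradient_square g \<tau> c q = a (\<tau> q) \<and> laplacian g \<tau> c q = b (\<tau> q))))"

end

theory Submission
  imports Defs
begin

text \<open>
  Let \<open>v = \<nabla>\<tau>\<close>, \<open>u = Jv\<close>, \<open>Q = g(v,v)\<close> and \<open>S = \<nabla>v\<close>, and work where \<open>v \<noteq> 0\<close>. The Hessian \<open>S\<close> is
  symmetric, it commutes with \<open>J\<close> because \<open>v\<close> is holomorphic, and \<open>v\<close> is an eigenvector because
  \<open>\<tau>\<close> is transnormal. In complex dimension two \<open>S\<close> is therefore \<open>\<psi>\<close> times the identity on the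
  complex line of \<open>v\<close> and \<open>\<phi>\<close> times the identity on its orthogonal complement \<open>H\<close>, and
  \<open>\<Delta>\<tau> = 2\<psi> + 2\<phi>\<close>. From \<open>dQ = 2\<psi> d\<tau>\<close> and \<open>d(dQ) = 0\<close> one sees that \<open>Q\<close>, \<open>\<psi>\<close> and the
  successive derivatives \<open>\<psi>1\<close>, \<open>\<psi>2\<close> of \<open>\<psi>\<close> with respect to \<open>\<tau>\<close> have differentials proportional
  to \<open>d\<tau>\<close>. What has to be shown is that \<open>d\<phi>\<close> is proportional to \<open>d\<tau>\<close> as well.

  The Ricci identity turns this explicit form of \<open>S\<close> into a formula for \<open>R(a,b)v\<close> (\<open>curv_v\<close>),
  hence, by the symmetries of a Kaehler curvature tensor, into a formula for the whole curvature up
  to its component \<open>C\<close> on \<open>H\<close>. Consistency with these symmetries gives \<open>d\<phi>(u) = 0\<close> and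
  \<open>d\<phi>(v) = 2\<beta>\<close> with \<open>\<beta> = \<phi>(\<psi> - \<phi>)\<close> (\<open>D_\<phi>_V\<close>). If the \<open>H\<close>-part \<open>h\<close> of \<open>\<nabla>\<phi>\<close> is nonzero, the
  off-diagonal part of the weakly Einstein condition determines \<open>C\<close>, and the diagonal part then
  expresses \<open>K = Q g(h,h)\<close> by \<open>Q\<close>, \<open>\<psi>\<close>, \<open>\<psi>1\<close> and \<open>\<phi>\<close> (\<open>K_algebraic\<close>). On the other hand the
  equation \<open>d\<phi>(v) = 2\<beta>\<close> alone implies \<open>dK(v) = (6\<psi> - 10\<phi>) K\<close> (\<open>D_K_v\<close>). Differentiating the
  first expression along \<open>v\<close> and comparing yields a polynomial equation of degree five for \<open>\<phi>\<close>,
  whose coefficients are annihilated by \<open>h\<close> and whose leading coefficient is \<open>-16\<close>. But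
  \<open>d\<phi>(h) \<noteq> 0\<close>, so differentiating five times along \<open>h\<close> shows that the leading coefficient
  vanishes (\<open>leading_coefficient_zero\<close>), a contradiction. Hence \<open>h = 0\<close>, and \<open>d\<phi>\<close> is proportional
  to \<open>d\<tau>\<close>.

  Two analytic facts link this computation to the definitions. Integral curves of \<open>v\<close> exist
  (\<open>integral_curve_exists\<close>), so that the geodesic condition says that \<open>\<nabla>\<^sub>v v\<close> is tangent to \<open>v\<close>
  (\<open>transnormal_gradient_direction\<close>); and a function whose differential is proportional to \<open>d\<tau>\<close>
  is locally a function of \<open>\<tau>\<close> (\<open>factors_through_near\<close>).
\<close>

section \<open>Calculus of smooth maps\<close>

text \<open>The definition quantifies over derivatives at the points of \<open>S\<close>, which see a full
  neighbourhood; for open \<open>S\<close> only the values on \<open>S\<close> matter.\<close>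

lemma times_differentiable_on_cong:
  assumes "open S" and "\<And>x. x \<in> S \<Longrightarrow> f x = g x"
  shows "times_differentiable_on k S f \<longleftrightarrow> times_differentiable_on k S g"
  using assms(2)
proof (induction k arbitrary: f g)
  case 0
  then show ?case by (auto cong: continuous_on_cong)
next
  case (Suc k)
  have ev: "f differentiable (at x) \<longleftrightarrow> g differentiable (at x)"
           "frechet_derivative f (at x) = frechet_derivative g (at x)" if x: "x \<in> S" for x
  proof -
    have iff: "(f has_derivative D) (at x) \<longleftrightarrow> (g has_derivative D) (at x)" for D
      using has_derivative_transform_within_open[OF _ \<open>open S\<close> x] Suc.prems by metis
    then show "f differentiable (at x) \<longleftrightarrow> g differentiable (at x)"
      by (simp add: differentiable_def)
    show "frechet_derivative f (at x) = frechet_derivative g (at x)"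
      by (simp add: frechet_derivative_def iff)
  qed
  have "times_differentiable_on k S (\<lambda>x. frechet_derivative f (at x) v)
      \<longleftrightarrow> times_differentiable_on k S (\<lambda>x. frechet_derivative g (at x) v)" for v
    by (rule Suc.IH) (simp add: ev)
  then show ?case by (simp add: ev)
qed

lemma times_differentiable_on_SucD:
  "times_differentiable_on (Suc k) S f \<Longrightarrow> times_differentiable_on k S f"
proof (induction k arbitrary: f)
  case 0
  then show ?case
    by (auto intro!: continuous_at_imp_continuous_on differentiable_imp_continuous_within)
next
  case (Suc k)
  show ?case
    unfolding times_differentiable_on.simps(2)
    using Suc.prems Suc.IH unfolding times_differentiable_on.simps(2)[of "Suc k"] by blast
qed

lemma times_differentiable_on_add:
  assumes "open S"
  shows "times_differentiable_on k S f \<Longrightarrow> times_differentiable_on k S g \<Longrightarrow>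
    times_differentiable_on k S (\<lambda>x. f x + g x)"
proof (induction k arbitrary: f g)
  case 0
  then show ?case by (auto intro: continuous_intros)
next
  case (Suc k)
  have "times_differentiable_on k S (\<lambda>x. frechet_derivative (\<lambda>x. f x + g x) (at x) v)" for v
  proof -
    have "frechet_derivative (\<lambda>x. f x + g x) (at x) v
        = frechet_derivative f (at x) v + frechet_derivative g (at x) v" if "x \<in> S" for x
    proof -
      have "((\<lambda>x. f x + g x) has_derivative
          (\<lambda>v. frechet_derivative f (at x) v + frechet_derivative g (at x) v)) (at x)"
        using Suc.prems that by (intro has_derivative_add) (auto simp: frechet_derivative_works)
      then show ?thesis using frechet_derivative_at by metis
    qed
    then show ?thesis
      using Suc by (subst times_differentiable_on_cong[OF assms]) auto
  qed
  then show ?case using Suc.prems by auto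
qed

lemma frechet_derivative_bilinear:
  assumes "bounded_bilinear b" "f differentiable (at x)" "g differentiable (at x)"
  shows "frechet_derivative (\<lambda>x. b (f x) (g x)) (at x) v
      = b (f x) (frechet_derivative g (at x) v) + b (frechet_derivative f (at x) v) (g x)"
proof -
  have "((\<lambda>x. b (f x) (g x)) has_derivative
      (\<lambda>v. b (f x) (frechet_derivative g (at x) v) + b (frechet_derivative f (at x) v) (g x)))
      (at x)"
    using assms by (intro bounded_bilinear.FDERIV) (auto simp: frechet_derivative_works)
  then show ?thesis using frechet_derivative_at by metis
qed

lemma times_differentiable_on_bilinear:
  assumes "open S" and b: "bounded_bilinear b"
  shows "times_differentiable_on k S f \<Longrightarrow> times_differentiable_on k S g \<Longrightarrow>
    times_differentiable_on k S (\<lambda>x. b (f x) (g x))"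
proof (induction k arbitrary: f g)
  case 0
  then show ?case by (auto intro: bounded_bilinear.continuous_on[OF b])
next
  case (Suc k)
  have "times_differentiable_on k S (\<lambda>x. frechet_derivative (\<lambda>x. b (f x) (g x)) (at x) v)" for v
  proof -
    have "frechet_derivative (\<lambda>x. b (f x) (g x)) (at x) v
      = b (f x) (frechet_derivative g (at x) v) + b (frechet_derivative f (at x) v) (g x)"
      if "x \<in> S" for x
      using Suc.prems that by (intro frechet_derivative_bilinear[OF b]) auto
    moreover have "times_differentiable_on k S f" "times_differentiable_on k S g"
      using Suc.prems times_differentiable_on_SucD by blast+
    ultimately show ?thesis
      using Suc by (subst times_differentiable_on_cong[OF assms(1)])
        (auto intro!: times_differentiable_on_add[OF assms(1)])
  qed
  moreover have "(\<lambda>x. b (f x) (g x)) differentiable at x" if "x \<in> S" for x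
  proof -
    have "f differentiable at x" "g differentiable at x" using Suc.prems that by auto
    then show ?thesis
      using bounded_bilinear.FDERIV[OF b] unfolding differentiable_def by blast
  qed
  ultimately show ?case by auto
qed

lemma times_differentiable_on_const [simp]: "times_differentiable_on k S (\<lambda>_. c)"
  by (induction k arbitrary: c) auto

lemma frechet_derivative_inverse_real:
  fixes f :: "'a::real_normed_vector \<Rightarrow> real"
  assumes "f differentiable (at x)" "f x \<noteq> 0"
  shows "frechet_derivative (\<lambda>x. inverse (f x)) (at x) v
      = - (frechet_derivative f (at x) v * (inverse (f x) * inverse (f x)))"
proof -
  have "((\<lambda>x. inverse (f x)) has_derivative
      (\<lambda>v. - (inverse (f x) * frechet_derivative f (at x) v * inverse (f x)))) (at x)"
    using assms by (intro Deriv.has_derivative_inverse) (auto simp: frechet_derivative_works)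
  then show ?thesis using frechet_derivative_at by (metis mult.assoc mult.commute)
qed

lemma times_differentiable_on_inverse:
  fixes f :: "'a::real_normed_vector \<Rightarrow> real"
  assumes "open S" "\<And>x. x \<in> S \<Longrightarrow> f x \<noteq> 0"
  shows "times_differentiable_on k S f \<Longrightarrow> times_differentiable_on k S (\<lambda>x. inverse (f x))"
proof (induction k)
  case 0
  then show ?case using assms by (auto intro!: continuous_intros)
next
  case (Suc k)
  have inv: "times_differentiable_on k S (\<lambda>x. inverse (f x))"
    using Suc times_differentiable_on_SucD by blast
  have "times_differentiable_on k S (\<lambda>x. frechet_derivative (\<lambda>x. inverse (f x)) (at x) v)" for v
  proof -
    have "frechet_derivative (\<lambda>x. inverse (f x)) (at x) v
      = (-1) * (frechet_derivative f (at x) v * (inverse (f x) * inverse (f x)))" if "x \<in> S" for x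
      using Suc.prems that assms(2) by (subst frechet_derivative_inverse_real) auto
    moreover have "times_differentiable_on k S
      (\<lambda>x. (-1) * (frechet_derivative f (at x) v * (inverse (f x) * inverse (f x))))"
      using Suc.prems inv
      by (intro times_differentiable_on_bilinear[OF assms(1) bounded_bilinear_mult]
          times_differentiable_on_const) auto
    ultimately show ?thesis
      by (subst times_differentiable_on_cong[OF assms(1)]) auto
  qed
  moreover have "(\<lambda>x. inverse (f x)) differentiable at x" if "x \<in> S" for x
    using Suc.prems that assms(2) by (intro differentiable_inverse) auto
  ultimately show ?case by auto
qed

lemma smooth_on_cong:
  "open S \<Longrightarrow> (\<And>x. x \<in> S \<Longrightarrow> f x = g x) \<Longrightarrow> smooth_on S f \<longleftrightarrow> smooth_on S g"
  unfolding smooth_on_def using times_differentiable_on_cong by blast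

lemma smooth_on_const [intro, simp]: "smooth_on S (\<lambda>_. c)"
  by (simp add: smooth_on_def)

lemma smooth_on_add [intro]:
  "open S \<Longrightarrow> smooth_on S f \<Longrightarrow> smooth_on S g \<Longrightarrow> smooth_on S (\<lambda>x. f x + g x)"
  by (simp add: smooth_on_def times_differentiable_on_add)

lemma smooth_on_bilinear:
  "bounded_bilinear b \<Longrightarrow> open S \<Longrightarrow> smooth_on S f \<Longrightarrow> smooth_on S g \<Longrightarrow>
    smooth_on S (\<lambda>x. b (f x) (g x))"
  by (simp add: smooth_on_def times_differentiable_on_bilinear)

lemmas smooth_on_mult [intro] =
  smooth_on_bilinear[OF bounded_bilinear_mult, where ?'a1 = "'b::real_normed_algebra"]
lemmas smooth_on_scaleR [intro] = smooth_on_bilinear[OF bounded_bilinear_scaleR]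
lemmas smooth_on_inner [intro] = smooth_on_bilinear[OF bounded_bilinear_inner]

lemma smooth_on_linear:
  assumes "bounded_linear L" "open S" "smooth_on S f"
  shows "smooth_on S (\<lambda>x. L (f x))"
proof -
  have "bounded_bilinear (\<lambda>(c::real) y. c *\<^sub>R L y)"
    using bounded_bilinear.comp[OF bounded_bilinear_scaleR bounded_linear_ident assms(1)] .
  from smooth_on_bilinear[OF this assms(2) smooth_on_const[of _ 1] assms(3)] show ?thesis by simp
qed

lemma smooth_on_uminus [intro]: "open S \<Longrightarrow> smooth_on S f \<Longrightarrow> smooth_on S (\<lambda>x. - f x)"
  using smooth_on_linear[OF bounded_linear_minus[OF bounded_linear_ident]] .

lemma smooth_on_diff [intro]:
  "open S \<Longrightarrow> smooth_on S f \<Longrightarrow> smooth_on S g \<Longrightarrow> smooth_on S (\<lambda>x. f x - g x)"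
  using smooth_on_add[OF _ _ smooth_on_uminus, of S f g] by simp

lemma smooth_on_sum [intro]:
  assumes "open S"
  shows "(\<And>i. i \<in> I \<Longrightarrow> smooth_on S (f i)) \<Longrightarrow> smooth_on S (\<lambda>x. \<Sum>i\<in>I. f i x)"
  by (induction I rule: infinite_finite_induct) (auto intro!: smooth_on_add assms)

lemma smooth_on_prod [intro]:
  fixes f :: "'i \<Rightarrow> 'a::real_normed_vector \<Rightarrow> real"
  assumes "open S"
  shows "(\<And>i. i \<in> I \<Longrightarrow> smooth_on S (f i)) \<Longrightarrow> smooth_on S (\<lambda>x. \<Prod>i\<in>I. f i x)"
  by (induction I rule: infinite_finite_induct) (auto intro!: smooth_on_mult assms)

lemma smooth_on_divide [intro]:
  fixes f g :: "'a::real_normed_vector \<Rightarrow> real"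
  assumes "open S" "smooth_on S f" "smooth_on S g" "\<And>x. x \<in> S \<Longrightarrow> g x \<noteq> 0"
  shows "smooth_on S (\<lambda>x. f x / g x)"
proof -
  have "smooth_on S (\<lambda>x. inverse (g x))"
    using assms by (simp add: smooth_on_def times_differentiable_on_inverse)
  then show ?thesis using assms by (auto simp: divide_inverse intro!: smooth_on_mult)
qed

lemma smooth_on_nth [intro]: "open S \<Longrightarrow> smooth_on S f \<Longrightarrow> smooth_on S (\<lambda>x. f x $ i)"
  by (rule smooth_on_linear[OF bounded_linear_vec_nth])

lemma smooth_on_vec_lambda [intro]:
  fixes f :: "'i::finite \<Rightarrow> 'a::real_normed_vector \<Rightarrow> 'b::real_normed_vector"
  assumes "open S" "\<And>i. smooth_on S (f i)"
  shows "smooth_on S (\<lambda>x. \<chi> i. f i x)"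
proof -
  have lin: "bounded_linear (axis i :: 'b \<Rightarrow> 'b ^ 'i)" for i
  proof (rule bounded_linear_intro[where K = 1])
    fix x y :: 'b and r :: real
    show "axis i (x + y) = axis i x + axis i y" "axis i (r *\<^sub>R x) = r *\<^sub>R axis i x"
      by (auto simp: vec_eq_iff axis_def)
    have "norm (axis i x) = norm x"
      unfolding norm_vec_def L2_set_def axis_def
      by (simp add: if_distrib[of norm] if_distrib[of "\<lambda>r. r\<^sup>2"] cong: if_cong)
    then show "norm (axis i x) \<le> norm x * 1" by simp
  qed
  have "smooth_on S (\<lambda>x. \<Sum>i\<in>UNIV. axis i (f i x))"
    using assms by (intro smooth_on_sum smooth_on_linear[OF lin]) auto
  moreover have "(\<Sum>i\<in>UNIV. axis i (f i x)) = (\<chi> i. f i x)" for x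
    by (simp add: vec_eq_iff axis_def if_distrib cong: if_cong)
  ultimately show ?thesis by simp
qed

lemma smooth_on_frechet_derivative [intro]:
  "smooth_on S f \<Longrightarrow> smooth_on S (\<lambda>x. frechet_derivative f (at x) v)"
  unfolding smooth_on_def by (metis times_differentiable_on.simps(2))

lemma smooth_on_imp_differentiable: "smooth_on S f \<Longrightarrow> x \<in> S \<Longrightarrow> f differentiable (at x)"
  unfolding smooth_on_def by (metis times_differentiable_on.simps(2))

lemma smooth_on_has_derivative:
  "smooth_on S f \<Longrightarrow> x \<in> S \<Longrightarrow> (f has_derivative frechet_derivative f (at x)) (at x)"
  using smooth_on_imp_differentiable frechet_derivative_works by blast

lemma smooth_on_continuous: "smooth_on S f \<Longrightarrow> continuous_on S f"
  unfolding smooth_on_def by (metis times_differentiable_on.simps(1))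

lemma smooth_on_subset: 
  assumes "smooth_on S f" "T \<subseteq> S" shows "smooth_on T f"
proof -
  have "times_differentiable_on k S f \<Longrightarrow> times_differentiable_on k T f" for k and f :: "'a \<Rightarrow> 'b"
    by (induction k arbitrary: f) (use assms(2) in \<open>auto intro: continuous_on_subset\<close>)
  then show ?thesis using assms(1) unfolding smooth_on_def by blast
qed

lemma bounded_bilinear_matrix_vector_mult:
  "bounded_bilinear ((*v) :: real ^ 'n ^ 'm \<Rightarrow> real ^ 'n \<Rightarrow> real ^ 'm)"
  unfolding bilinear_conv_bounded_bilinear[symmetric] bilinear_def
  by (auto intro!: linearI simp: algebra_simps scaleR_matrix_vector_assoc
      matrix_vector_mult_add_rdistrib)

lemma bounded_bilinear_matrix_matrix_mult:
  "bounded_bilinear ((**) :: real ^ 'n ^ 'm \<Rightarrow> real ^ 'k ^ 'n \<Rightarrow> real ^ 'k ^ 'm)"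
  unfolding bilinear_conv_bounded_bilinear[symmetric] bilinear_def
  by (auto intro!: linearI simp: matrix_matrix_mult_def vec_eq_iff algebra_simps sum.distrib
      sum_distrib_left)

lemmas smooth_on_matrix_vector_mult [intro] = smooth_on_bilinear[OF bounded_bilinear_matrix_vector_mult]

lemma smooth_on_det:
  fixes B :: "'a::real_normed_vector \<Rightarrow> real ^ 'n ^ 'n"
  assumes "open S" "smooth_on S B"
  shows "smooth_on S (\<lambda>x. det (B x))"
  unfolding det_def using assms by (intro smooth_on_sum smooth_on_mult smooth_on_prod) auto

lemma matrix_inv_inverts:
  fixes B :: "real ^ 'n ^ 'n"
  assumes "invertible B"
  shows "B ** matrix_inv B = mat 1" "matrix_inv B ** B = mat 1"
proof -
  have "B ** matrix_inv B = mat 1 \<and> matrix_inv B ** B = mat 1"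
    using assms unfolding invertible_def matrix_inv_def by (rule someI_ex)
  then show "B ** matrix_inv B = mat 1" "matrix_inv B ** B = mat 1" by auto
qed

text \<open>By Cramer's rule the entries of the inverse are quotients of determinants.\<close>

lemma smooth_on_matrix_inv:
  fixes B :: "'a::real_normed_vector \<Rightarrow> real ^ 'n ^ 'n"
  assumes "open S" "smooth_on S B" "\<And>x. x \<in> S \<Longrightarrow> invertible (B x)"
  shows "smooth_on S (\<lambda>x. matrix_inv (B x))"
proof -
  let ?C = "\<lambda>x k l. (\<chi> i j. if j = k then axis l 1 $ i else B x $ i $ j) :: real^'n^'n"
  have C: "matrix_inv (B x) = (\<chi> k l. det (?C x k l) / det (B x))" if "x \<in> S" for x
  proof -
    have d: "det (B x) \<noteq> 0" using assms(3) that invertible_det_nz by blast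
    have "column l (matrix_inv (B x)) = (\<chi> k. det (?C x k l) / det (B x))" for l
    proof -
      have "B x *v column l (matrix_inv (B x)) = axis l 1"
        using matrix_inv_inverts(1)[OF assms(3)[OF that]]
        by (metis matrix_vector_mul_assoc matrix_vector_mul_lid matrix_vector_mult_basis)
      then show ?thesis using cramer[OF d] by blast
    qed
    then show ?thesis by (simp add: vec_eq_iff column_def)
  qed
  have "smooth_on S (\<lambda>x. ?C x k l)" for k l
  proof (intro smooth_on_vec_lambda assms(1))
    show "smooth_on S (\<lambda>x. if j = k then axis l 1 $ i else B x $ i $ j)" for i j
      using assms(1,2) by (cases "j = k") auto
  qed
  then have dC: "smooth_on S (\<lambda>x. det (?C x k l))" for k l
    by (rule smooth_on_det[OF assms(1)])
  have "smooth_on S (\<lambda>x. det (?C x k l) / det (B x))" for k l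
    using assms invertible_det_nz
    by (intro smooth_on_divide[OF assms(1) dC smooth_on_det]) auto
  then have "smooth_on S (\<lambda>x. \<chi> k l. det (?C x k l) / det (B x))"
    by (intro smooth_on_vec_lambda[OF assms(1)])
  then show ?thesis using C smooth_on_cong[OF assms(1)] by (metis (no_types, lifting))
qed

lemma has_vector_derivative_chain:
  assumes "(y has_vector_derivative w) (at t)" "(f has_derivative f') (at (y t))"
  shows "((\<lambda>t. f (y t)) has_vector_derivative f' w) (at t)"
  using vector_derivative_diff_chain_within[of y w t UNIV f f'] assms
  by (simp add: o_def has_derivative_at_withinI)

lemma has_derivative_along_line:
  assumes "f differentiable (at (p + t *\<^sub>R v))"
  shows "((\<lambda>t. f (p + t *\<^sub>R v)) has_vector_derivative
    frechet_derivative f (at (p + t *\<^sub>R v)) v) (at t)"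
proof -
  have line: "((\<lambda>t. p + t *\<^sub>R v) has_vector_derivative v) (at t)"
    by (auto intro!: derivative_eq_intros)
  show ?thesis
    by (rule has_vector_derivative_chain[OF line]) (use assms frechet_derivative_works in blast)
qed

text \<open>Two applications of the mean value theorem. The left-hand side is symmetric in \<open>v\<close> and
  \<open>w\<close>, so it represents either mixed derivative at some point of the parallelogram.\<close>

lemma second_difference:
  fixes f :: "'a::real_normed_vector \<Rightarrow> real"
  assumes f: "smooth_on S f" and h: "h > 0"
    and S: "\<And>s t. 0 \<le> s \<Longrightarrow> s \<le> h \<Longrightarrow> 0 \<le> t \<Longrightarrow> t \<le> h \<Longrightarrow> x + s *\<^sub>R v + t *\<^sub>R w \<in> S"
  obtains s t where "0 < s" "s < h" "0 < t" "t < h"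
    "f (x + h *\<^sub>R v + h *\<^sub>R w) - f (x + h *\<^sub>R v) - f (x + h *\<^sub>R w) + f x
      = h * h * frechet_derivative (\<lambda>y. frechet_derivative f (at y) v) (at (x + s *\<^sub>R v + t *\<^sub>R w)) w"
proof -
  let ?f = "\<lambda>y. frechet_derivative f (at y) v"
  define F where "F s = f (x + s *\<^sub>R v + h *\<^sub>R w) - f (x + s *\<^sub>R v)" for s
  have F': "(F has_real_derivative ?f (x + s *\<^sub>R v + h *\<^sub>R w) - ?f (x + s *\<^sub>R v)) (at s)"
    if "0 \<le> s" "s \<le> h" for s
  proof -
    have mem: "x + h *\<^sub>R w + s *\<^sub>R v \<in> S" "x + s *\<^sub>R v \<in> S"
      using S[of s h] S[of s 0] that h by (auto simp: algebra_simps)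
    show ?thesis
      unfolding F_def has_real_derivative_iff_has_vector_derivative
      using has_vector_derivative_diff[OF
          has_derivative_along_line[OF smooth_on_imp_differentiable[OF f mem(1)]]
          has_derivative_along_line[OF smooth_on_imp_differentiable[OF f mem(2)]]]
      by (simp add: algebra_simps)
  qed
  obtain s where s: "0 < s" "s < h"
      "F h - F 0 = (h - 0) * (?f (x + s *\<^sub>R v + h *\<^sub>R w) - ?f (x + s *\<^sub>R v))"
    using MVT2[OF h F'] by auto
  define K where "K t = ?f (x + s *\<^sub>R v + t *\<^sub>R w)" for t
  have K': "(K has_real_derivative frechet_derivative ?f (at (x + s *\<^sub>R v + t *\<^sub>R w)) w) (at t)"
    if "0 \<le> t" "t \<le> h" for t
    unfolding K_def has_real_derivative_iff_has_vector_derivative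
    using S[of s t] that s f
    by (intro has_derivative_along_line smooth_on_imp_differentiable[of S]) auto
  obtain t where t: "0 < t" "t < h"
      "K h - K 0 = (h - 0) * frechet_derivative ?f (at (x + s *\<^sub>R v + t *\<^sub>R w)) w"
    using MVT2[OF h K'] by auto
  show thesis
    using that[OF s(1,2) t(1,2)] s(3) t(3) by (simp add: F_def K_def algebra_simps)
qed

text \<open>Both mixed derivatives are limits of the same second difference quotients.\<close>

lemma mixed_derivatives_commute:
  fixes f :: "'a::real_normed_vector \<Rightarrow> real"
  assumes "open S" "smooth_on S f" "x \<in> S"
  shows "frechet_derivative (\<lambda>y. frechet_derivative f (at y) v) (at x) w
       = frechet_derivative (\<lambda>y. frechet_derivative f (at y) w) (at x) v"
    (is "?A v w x = ?A w v x")
proof (rule ccontr)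
  define e where "e = \<bar>?A v w x - ?A w v x\<bar> / 2"
  assume "?A v w x \<noteq> ?A w v x"
  then have e: "e > 0" by (simp add: e_def)
  have cont: "\<exists>d>0. \<forall>y. dist y x < d \<longrightarrow> y \<in> S \<and> \<bar>?A a b y - ?A a b x\<bar> < e" for a b
  proof -
    have "continuous_on S (?A a b)"
      using assms by (intro smooth_on_continuous smooth_on_frechet_derivative)
    then have "?A a b \<midarrow>x\<rightarrow> ?A a b x"
      using assms continuous_on_eq_continuous_at isCont_def by blast
    then have "\<forall>\<^sub>F y in nhds x. dist (?A a b y) (?A a b x) < e"
      using e tendstoD tendsto_at_iff_tendsto_nhds by blast
    moreover have "\<forall>\<^sub>F y in nhds x. y \<in> S" using assms eventually_nhds by blast
    ultimately have "\<forall>\<^sub>F y in nhds x. y \<in> S \<and> \<bar>?A a b y - ?A a b x\<bar> < e"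
      by eventually_elim (auto simp: dist_real_def)
    then show ?thesis by (simp add: eventually_nhds_metric)
  qed
  obtain d1 where d1: "d1 > 0" "\<And>y. dist y x < d1 \<Longrightarrow> y \<in> S \<and> \<bar>?A v w y - ?A v w x\<bar> < e"
    using cont[of v w] by blast
  obtain d2 where d2: "d2 > 0" "\<And>y. dist y x < d2 \<Longrightarrow> y \<in> S \<and> \<bar>?A w v y - ?A w v x\<bar> < e"
    using cont[of w v] by blast
  \<comment> \<open>The parallelogram with sides \<open>h v\<close> and \<open>h w\<close> then lies in both neighbourhoods of \<open>x\<close>.\<close>
  define h where "h = min d1 d2 / (2 * (norm v + norm w + 1))"
  have h: "h > 0"
    using d1(1) d2(1) by (auto simp: h_def intro!: divide_pos_pos add_nonneg_pos)
  have near: "dist (x + s *\<^sub>R v + t *\<^sub>R w) x < min d1 d2" if "0 \<le> s" "s \<le> h" "0 \<le> t" "t \<le> h" for s t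
  proof -
    have "norm (s *\<^sub>R v + t *\<^sub>R w) \<le> s * norm v + t * norm w"
      using norm_triangle_ineq[of "s *\<^sub>R v" "t *\<^sub>R w"] that by simp
    also have "\<dots> \<le> h * norm v + h * norm w"
      using that by (intro add_mono mult_right_mono) auto
    also have "\<dots> \<le> h * (norm v + norm w + 1)" using h by (simp add: algebra_simps)
    also have "\<dots> = min d1 d2 / 2"
    proof -
      have "norm v + norm w + 1 \<noteq> 0" using norm_ge_zero[of v] norm_ge_zero[of w] by linarith
      moreover have "m / (2 * c) * c = m / 2" if "c \<noteq> 0" for m c :: real using that by simp
      ultimately show ?thesis unfolding h_def by blast
    qed
    also have "\<dots> < min d1 d2" using d1(1) d2(1) by (auto simp: min_def)
    finally show ?thesis by (simp add: dist_norm add.assoc)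
  qed
  obtain s t where st: "0 < s" "s < h" "0 < t" "t < h"
    "f (x + h *\<^sub>R v + h *\<^sub>R w) - f (x + h *\<^sub>R v) - f (x + h *\<^sub>R w) + f x
      = h * h * ?A v w (x + s *\<^sub>R v + t *\<^sub>R w)"
  proof (rule second_difference[OF assms(2) h, of x v w])
    show "x + s *\<^sub>R v + t *\<^sub>R w \<in> S" if "0 \<le> s" "s \<le> h" "0 \<le> t" "t \<le> h" for s t
      using near[OF that] d1(2) by simp
  qed
  have swap: "x + t *\<^sub>R w + s *\<^sub>R v = x + s *\<^sub>R v + t *\<^sub>R w" for s t
    by (simp add: algebra_simps)
  obtain s' t' where st': "0 < s'" "s' < h" "0 < t'" "t' < h"
    "f (x + h *\<^sub>R w + h *\<^sub>R v) - f (x + h *\<^sub>R w) - f (x + h *\<^sub>R v) + f x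
      = h * h * ?A w v (x + s' *\<^sub>R w + t' *\<^sub>R v)"
  proof (rule second_difference[OF assms(2) h, of x w v])
    show "x + s *\<^sub>R w + t *\<^sub>R v \<in> S" if "0 \<le> s" "s \<le> h" "0 \<le> t" "t \<le> h" for s t
      using near[OF that(3,4,1,2)] d1(2) by (simp add: swap)
  qed
  have "?A v w (x + s *\<^sub>R v + t *\<^sub>R w) = ?A w v (x + t' *\<^sub>R v + s' *\<^sub>R w)"
  proof -
    have "h * h * ?A v w (x + s *\<^sub>R v + t *\<^sub>R w) = h * h * ?A w v (x + s' *\<^sub>R w + t' *\<^sub>R v)"
      using st(5) st'(5) unfolding swap by linarith
    then show ?thesis using h by (simp add: swap)
  qed
  moreover have "\<bar>?A v w (x + s *\<^sub>R v + t *\<^sub>R w) - ?A v w x\<bar> < e"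
    using d1(2) near[of s t] st by auto
  moreover have "\<bar>?A w v (x + t' *\<^sub>R v + s' *\<^sub>R w) - ?A w v x\<bar> < e"
    using d2(2) near[of t' s'] st' by auto
  ultimately show False unfolding e_def by argo
qed

section \<open>Riemannian geometry in a coordinate domain\<close>

abbreviation D :: "('a::real_normed_vector \<Rightarrow> 'b::real_normed_vector) \<Rightarrow> 'a \<Rightarrow> 'a \<Rightarrow> 'b" where
  "D f a \<equiv> \<lambda>x. frechet_derivative f (at x) a"

lemma D_eqI: "(f has_derivative f') (at x) \<Longrightarrow> D f a x = f' a"
  using frechet_derivative_at by metis

lemma D_linear: "smooth_on S f \<Longrightarrow> x \<in> S \<Longrightarrow> linear (\<lambda>a. D f a x)"
  using smooth_on_has_derivative has_derivative_linear by blast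

lemma D_add: "smooth_on S f \<Longrightarrow> smooth_on S g \<Longrightarrow> x \<in> S \<Longrightarrow>
    D (\<lambda>x. f x + g x) a x = D f a x + D g a x"
  by (rule D_eqI) (auto intro!: has_derivative_add smooth_on_has_derivative)

lemma D_diff: "smooth_on S f \<Longrightarrow> smooth_on S g \<Longrightarrow> x \<in> S \<Longrightarrow>
    D (\<lambda>x. f x - g x) a x = D f a x - D g a x"
  by (rule D_eqI) (auto intro!: has_derivative_diff smooth_on_has_derivative)

lemma D_bilinear: "bounded_bilinear b \<Longrightarrow> smooth_on S f \<Longrightarrow> smooth_on S g \<Longrightarrow> x \<in> S \<Longrightarrow>
    D (\<lambda>x. b (f x) (g x)) a x = b (f x) (D g a x) + b (D f a x) (g x)"
  by (simp add: frechet_derivative_bilinear smooth_on_imp_differentiable)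

lemmas D_mult = D_bilinear[OF bounded_bilinear_mult]
lemmas D_scaleR = D_bilinear[OF bounded_bilinear_scaleR]
lemmas D_inner = D_bilinear[OF bounded_bilinear_inner]
lemmas D_matrix_vector = D_bilinear[OF bounded_bilinear_matrix_vector_mult]

lemma D_const [simp]: "D (\<lambda>_. c) a x = 0"
  by (rule D_eqI) auto

lemma D_linear_comp: "bounded_linear L \<Longrightarrow> smooth_on S f \<Longrightarrow> x \<in> S \<Longrightarrow>
    D (\<lambda>x. L (f x)) a x = L (D f a x)"
  by (rule D_eqI, rule bounded_linear.has_derivative) (auto intro: smooth_on_has_derivative)

lemmas D_nth = D_linear_comp[OF bounded_linear_vec_nth]

lemma D_cong:
  assumes "open S" "x \<in> S" "\<And>x. x \<in> S \<Longrightarrow> f x = g x"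
  shows "D f a x = D g a x"
proof -
  have "(f has_derivative F) (at x) \<longleftrightarrow> (g has_derivative F) (at x)" for F
    using has_derivative_transform_within_open[OF _ assms(1,2)] assms(3) by metis
  then show ?thesis by (simp add: frechet_derivative_def)
qed

lemma linear_eq_sum_axis:
  fixes f :: "real ^ 'n \<Rightarrow> 'b::real_vector"
  assumes "linear f" shows "f a = (\<Sum>i\<in>UNIV. a $ i *\<^sub>R f (axis i 1))"
proof -
  have "a = (\<Sum>i\<in>UNIV. a $ i *\<^sub>R axis i 1)"
    by (simp add: vec_eq_iff axis_def if_distrib cong: if_cong)
  then have "f a = f (\<Sum>i\<in>UNIV. a $ i *\<^sub>R axis i 1)" by metis
  then show ?thesis by (simp add: linear_sum[OF assms] linear_cmul[OF assms])
qed

lemma D_eq_sum_axis: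
  fixes f :: "real ^ 'n \<Rightarrow> real"
  assumes "smooth_on S f" "x \<in> S"
  shows "D f a x = (\<Sum>i\<in>UNIV. a $ i * D f (axis i 1) x)"
  using linear_eq_sum_axis[OF D_linear[OF assms], of a] unfolding real_scaleR_def .

locale metric_chart =
  fixes U :: "(real ^ 'n) set" and G :: "real ^ 'n \<Rightarrow> real ^ 'n ^ 'n"
  assumes open_U: "open U" and G_smooth: "smooth_on U G"
    and G_symmetric: "x \<in> U \<Longrightarrow> transpose (G x) = G x"
    and G_positive: "x \<in> U \<Longrightarrow> a \<noteq> 0 \<Longrightarrow> a \<bullet> (G x *v a) > 0"
begin

definition ip :: "real ^ 'n \<Rightarrow> real ^ 'n \<Rightarrow> real ^ 'n \<Rightarrow> real" where
  "ip x a b = a \<bullet> (G x *v b)"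

definition chr :: "'n \<Rightarrow> 'n \<Rightarrow> 'n \<Rightarrow> real ^ 'n \<Rightarrow> real" where
  "chr k i j x = (\<Sum>l\<in>UNIV. matrix_inv (G x) $ k $ l *
     (D (\<lambda>x. G x $ j $ l) (axis i 1) x + D (\<lambda>x. G x $ i $ l) (axis j 1) x
      - D (\<lambda>x. G x $ i $ j) (axis l 1) x)) / 2"

text \<open>The connection form of the Levi-Civita connection in the coordinate frame: the matrix
  \<open>Gam a x\<close> is the endomorphism \<open>\<nabla>\<^sub>a - \<partial>\<^sub>a\<close> at \<open>x\<close>.\<close>

definition Gam :: "real ^ 'n \<Rightarrow> real ^ 'n \<Rightarrow> real ^ 'n ^ 'n" where
  "Gam a x = (\<chi> k j. \<Sum>i\<in>UNIV. a $ i * chr k i j x)"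

definition cov :: "(real ^ 'n \<Rightarrow> real ^ 'n) \<Rightarrow> real ^ 'n \<Rightarrow> real ^ 'n \<Rightarrow> real ^ 'n" where
  "cov Z a x = D Z a x + Gam a x *v Z x"

definition curv :: "real ^ 'n \<Rightarrow> real ^ 'n \<Rightarrow> real ^ 'n \<Rightarrow> real ^ 'n ^ 'n" where
  "curv a b x = D (Gam b) a x - D (Gam a) b x + Gam a x ** Gam b x - Gam b x ** Gam a x"

lemma G_nth_sym: "x \<in> U \<Longrightarrow> G x $ i $ j = G x $ j $ i"
  using arg_cong[OF G_symmetric, of x "\<lambda>M. M $ i $ j"] by (simp add: transpose_def)

lemma ip_sym: "x \<in> U \<Longrightarrow> ip x a b = ip x b a"
  unfolding ip_def using G_symmetric[of x]
  by (metis dot_lmul_matrix inner_commute transpose_matrix_vector)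

lemma ip_linear:
  "ip x (a + b) c = ip x a c + ip x b c" "ip x a (b + c) = ip x a b + ip x a c"
  "ip x (r *\<^sub>R a) c = r * ip x a c" "ip x a (r *\<^sub>R c) = r * ip x a c"
  "ip x (a - b) c = ip x a c - ip x b c" "ip x a (b - c) = ip x a b - ip x a c"
  "ip x (- a) c = - ip x a c" "ip x a (- c) = - ip x a c"
  "ip x 0 c = 0" "ip x a 0 = 0"
  by (auto simp: ip_def algebra_simps inner_add inner_diff matrix_vector_mult_scaleR
      linear_neg[OF matrix_vector_mul_linear])

lemma ip_pos: "x \<in> U \<Longrightarrow> a \<noteq> 0 \<Longrightarrow> ip x a a > 0"
  by (simp add: ip_def G_positive)

lemma ip_nondegenerate:
  assumes "x \<in> U" "\<And>c. ip x a c = ip x b c" shows "a = b"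
proof (rule ccontr)
  assume "a \<noteq> b"
  then have "ip x (a - b) (a - b) > 0" using ip_pos[OF assms(1)] by simp
  then show False using assms(2) by (simp add: ip_linear)
qed

lemma G_invertible: "x \<in> U \<Longrightarrow> invertible (G x)"
  by (metis G_positive inner_zero_right invertible_left_inverse less_irrefl
      matrix_left_invertible_ker)

lemma smooth_Ginv: "smooth_on U (\<lambda>x. matrix_inv (G x))"
  by (intro smooth_on_matrix_inv open_U G_smooth G_invertible)

lemma smooth_ip: "smooth_on U Y \<Longrightarrow> smooth_on U Z \<Longrightarrow> smooth_on U (\<lambda>x. ip x (Y x) (Z x))"
  unfolding ip_def by (intro smooth_on_inner smooth_on_matrix_vector_mult open_U G_smooth)

lemma smooth_G_nth: "smooth_on U (\<lambda>x. G x $ i $ j)"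
  by (intro smooth_on_nth open_U G_smooth)

lemma smooth_chr: "smooth_on U (chr k i j)"
proof -
  have "smooth_on U (\<lambda>x. (\<Sum>l\<in>UNIV. matrix_inv (G x) $ k $ l *
     (D (\<lambda>x. G x $ j $ l) (axis i 1) x + D (\<lambda>x. G x $ i $ l) (axis j 1) x
      - D (\<lambda>x. G x $ i $ j) (axis l 1) x)) / 2)"
    by (intro smooth_on_divide smooth_on_sum smooth_on_mult smooth_on_diff smooth_on_add
        smooth_on_frechet_derivative smooth_G_nth smooth_on_nth smooth_Ginv smooth_on_const open_U)
      auto
  then show ?thesis unfolding chr_def[abs_def] .
qed

lemma smooth_Gam: "smooth_on U (Gam a)"
  unfolding Gam_def
  by (intro smooth_on_vec_lambda smooth_on_sum smooth_on_mult smooth_on_const smooth_chr open_U)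

lemma smooth_cov: "smooth_on U Z \<Longrightarrow> smooth_on U (cov Z a)"
  unfolding cov_def[abs_def]
  by (intro smooth_on_add smooth_on_matrix_vector_mult smooth_on_frechet_derivative smooth_Gam open_U)

lemma Gam_linear:
  "Gam (a + b) x = Gam a x + Gam b x" "Gam (r *\<^sub>R a) x = r *\<^sub>R Gam a x"
  by (auto simp: Gam_def vec_eq_iff algebra_simps sum.distrib sum_distrib_left)

lemma chr_sym: 
  assumes "x \<in> U" shows "chr k i j x = chr k j i x"
proof -
  have "D (\<lambda>x. G x $ i $ j) (axis l 1) x = D (\<lambda>x. G x $ j $ i) (axis l 1) x" for l
    by (rule D_cong[OF open_U assms]) (rule G_nth_sym)
  then show ?thesis by (simp add: chr_def add.commute)
qed

lemma Gam_sym: "x \<in> U \<Longrightarrow> Gam a x *v b = Gam b x *v a"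
proof -
  assume x: "x \<in> U"
  have "(\<Sum>j\<in>UNIV. (\<Sum>i\<in>UNIV. a $ i * chr k i j x) * b $ j)
      = (\<Sum>j\<in>UNIV. (\<Sum>i\<in>UNIV. b $ i * chr k i j x) * a $ j)" for k
    unfolding sum_distrib_right
    by (subst sum.swap) (simp add: chr_sym[OF x, of k] ac_simps)
  then show ?thesis by (simp add: Gam_def matrix_vector_mult_def)
qed

text \<open>Lowering the upper index removes the inverse metric from the Christoffel symbols; the
  Christoffel symbols of the first kind remain.\<close>

lemma lowered_chr:
  assumes x: "x \<in> U"
  shows "(\<Sum>m\<in>UNIV. G x $ p $ m * chr m k i x) =
    (D (\<lambda>x. G x $ i $ p) (axis k 1) x + D (\<lambda>x. G x $ k $ p) (axis i 1) x
      - D (\<lambda>x. G x $ k $ i) (axis p 1) x) / 2"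
proof -
  let ?w = "\<chi> l. (D (\<lambda>x. G x $ i $ l) (axis k 1) x + D (\<lambda>x. G x $ k $ l) (axis i 1) x
      - D (\<lambda>x. G x $ k $ i) (axis l 1) x) / 2"
  have "(\<chi> m. chr m k i x) = matrix_inv (G x) *v ?w"
    by (simp add: chr_def matrix_vector_mult_def vec_eq_iff sum_divide_distrib)
  then have "G x *v (\<chi> m. chr m k i x) = ?w"
    using matrix_inv_inverts[OF G_invertible[OF x]] by (simp add: matrix_vector_mul_assoc)
  then have "(G x *v (\<chi> m. chr m k i x)) $ p = ?w $ p" by simp
  then show ?thesis by (simp add: matrix_vector_mult_def)
qed

text \<open>The equation \<open>\<nabla>g = 0\<close> in matrix form.\<close>

lemma metric_parallel:
  assumes x: "x \<in> U"
  shows "D G a x = transpose (Gam a x) ** G x + G x ** Gam a x"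
proof -
  have sym: "D (\<lambda>x. G x $ i $ j) b x = D (\<lambda>x. G x $ j $ i) b x" for i j b
    by (rule D_cong[OF open_U x]) (rule G_nth_sym)
  have "D G a x $ i $ j = (transpose (Gam a x) ** G x + G x ** Gam a x) $ i $ j" for i j
  proof -
    have ax: "D (\<lambda>x. G x $ i $ j) (axis k 1) x
        = (\<Sum>m\<in>UNIV. chr m k i x * G x $ m $ j) + (\<Sum>m\<in>UNIV. G x $ i $ m * chr m k j x)" for k
    proof -
      have "(\<Sum>m\<in>UNIV. chr m k i x * G x $ m $ j) = (\<Sum>m\<in>UNIV. G x $ j $ m * chr m k i x)"
        by (simp add: mult.commute G_nth_sym[OF x, of j])
      then show ?thesis
        using sym[of i j "axis k 1"] sym[of k i "axis j 1"] sym[of k j "axis i 1"]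
        unfolding lowered_chr[OF x] by argo
    qed
    have "D G a x $ i $ j = D (\<lambda>x. G x $ i $ j) a x"
      by (simp add: D_nth[OF smooth_on_nth[OF open_U G_smooth] x] D_nth[OF G_smooth x])
    also have "\<dots> = (\<Sum>k\<in>UNIV. a $ k * D (\<lambda>x. G x $ i $ j) (axis k 1) x)"
      by (rule D_eq_sum_axis[OF smooth_G_nth x])
    also have "\<dots> = (\<Sum>k\<in>UNIV. \<Sum>m\<in>UNIV. a $ k * chr m k i x * G x $ m $ j)
        + (\<Sum>k\<in>UNIV. \<Sum>m\<in>UNIV. G x $ i $ m * (a $ k * chr m k j x))"
      by (simp add: ax algebra_simps sum.distrib sum_distrib_left)
    also have "\<dots> = (\<Sum>m\<in>UNIV. \<Sum>k\<in>UNIV. a $ k * chr m k i x * G x $ m $ j)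
        + (\<Sum>m\<in>UNIV. \<Sum>k\<in>UNIV. G x $ i $ m * (a $ k * chr m k j x))"
      by (intro arg_cong2[of _ _ _ _ "(+)"] sum.swap)
    finally show ?thesis
      by (simp add: transpose_def Gam_def matrix_matrix_mult_def sum_distrib_left sum_distrib_right)
  qed
  then show ?thesis by (simp add: vec_eq_iff)
qed

lemma D_ip:
  assumes x: "x \<in> U" and Y: "smooth_on U Y" and Z: "smooth_on U Z"
  shows "D (\<lambda>x. ip x (Y x) (Z x)) a x = ip x (cov Y a x) (Z x) + ip x (Y x) (cov Z a x)"
proof -
  have "D (\<lambda>x. ip x (Y x) (Z x)) a x
      = Y x \<bullet> (G x *v D Z a x + D G a x *v Z x) + D Y a x \<bullet> (G x *v Z x)"
    unfolding ip_def
    by (simp add: D_inner[OF Y smooth_on_matrix_vector_mult[OF open_U G_smooth Z] x]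
        D_matrix_vector[OF G_smooth Z x])
  moreover have "Y x \<bullet> (transpose (Gam a x) ** G x *v Z x) = (Gam a x *v Y x) \<bullet> (G x *v Z x)"
  proof -
    have "Y x \<bullet> (transpose (Gam a x) *v w) = (Gam a x *v Y x) \<bullet> w" for w
      by (metis dot_lmul_matrix inner_commute transpose_matrix_vector)
    then show ?thesis by (simp add: matrix_vector_mul_assoc[symmetric])
  qed
  ultimately show ?thesis
    by (simp add: metric_parallel[OF x] cov_def ip_def algebra_simps inner_add
        matrix_vector_mul_assoc)
qed

lemma cov_scaleR:
  "smooth_on U f \<Longrightarrow> smooth_on U Z \<Longrightarrow> x \<in> U \<Longrightarrow>
    cov (\<lambda>x. f x *\<^sub>R Z x) a x = D f a x *\<^sub>R Z x + f x *\<^sub>R cov Z a x"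
  by (simp add: cov_def D_scaleR matrix_vector_mult_scaleR algebra_simps)

lemma cov_add:
  "smooth_on U Y \<Longrightarrow> smooth_on U Z \<Longrightarrow> x \<in> U \<Longrightarrow>
    cov (\<lambda>x. Y x + Z x) a x = cov Y a x + cov Z a x"
  by (simp add: cov_def D_add algebra_simps)

lemma cov_const: "cov (\<lambda>_. b) a x = Gam a x *v b"
  by (simp add: cov_def)

lemma linear_cov: "smooth_on U Z \<Longrightarrow> x \<in> U \<Longrightarrow> linear (\<lambda>a. cov Z a x)"
  unfolding cov_def
  by (auto intro!: linearI simp: Gam_linear algebra_simps scaleR_matrix_vector_assoc
      linear_add[OF D_linear] linear_cmul[OF D_linear])

lemma smooth_cov_field:
  assumes Z: "smooth_on U Z" and Y: "smooth_on U Y"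
  shows "smooth_on U (\<lambda>x. cov Z (Y x) x)"
proof -
  have "smooth_on U (\<lambda>x. \<Sum>i\<in>UNIV. Y x $ i *\<^sub>R cov Z (axis i 1) x)"
    by (intro smooth_on_sum smooth_on_scaleR smooth_on_nth smooth_cov Z Y open_U)
  then show ?thesis
    by (subst smooth_on_cong[OF open_U linear_eq_sum_axis[OF linear_cov[OF Z]]])
qed

lemma curv_linear:
  assumes x: "x \<in> U"
  shows "linear (\<lambda>a. curv a b x)" "linear (\<lambda>b. curv a b x)"
proof -
  have 1: "D (Gam (a + b)) c x = D (Gam a) c x + D (Gam b) c x" for a b c
    unfolding Gam_linear by (rule D_add[OF smooth_Gam smooth_Gam x])
  have 2: "D (Gam (r *\<^sub>R a)) c x = r *\<^sub>R D (Gam a) c x" for r a c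
    unfolding Gam_linear using D_scaleR[OF smooth_on_const smooth_Gam x] by simp
  note mm = bounded_bilinear.add_left[OF bounded_bilinear_matrix_matrix_mult]
    bounded_bilinear.add_right[OF bounded_bilinear_matrix_matrix_mult]
    bounded_bilinear.scaleR_left[OF bounded_bilinear_matrix_matrix_mult]
    bounded_bilinear.scaleR_right[OF bounded_bilinear_matrix_matrix_mult]
  show "linear (\<lambda>a. curv a b x)" "linear (\<lambda>b. curv a b x)"
    unfolding curv_def
    by (auto intro!: linearI simp: 1 2 Gam_linear mm algebra_simps
        linear_add[OF D_linear[OF smooth_Gam x]] linear_cmul[OF D_linear[OF smooth_Gam x]])
qed

lemma mixed_derivatives_commute_vec:
  fixes Z :: "real ^ 'n \<Rightarrow> real ^ 'm"
  assumes "smooth_on U Z" "x \<in> U"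
  shows "D (D Z b) a x = D (D Z a) b x"
proof -
  have "D (D Z b) a x $ i = D (D (\<lambda>x. Z x $ i) b) a x" for a b i
  proof -
    have "D (D Z b) a x $ i = D (\<lambda>x. D Z b x $ i) a x"
      using assms by (intro D_nth[symmetric] smooth_on_frechet_derivative)
    also have "\<dots> = D (D (\<lambda>x. Z x $ i) b) a x"
      by (rule D_cong[OF open_U assms(2)]) (rule D_nth[OF assms(1), symmetric])
    finally show ?thesis .
  qed
  then show ?thesis
    using mixed_derivatives_commute[OF open_U smooth_on_nth[OF open_U assms(1)] assms(2)]
    by (simp add: vec_eq_iff)
qed

text \<open>For constant \<open>a\<close> and \<open>b\<close>, viewed as commuting coordinate fields, the left-hand side is
  \<open>[\<nabla>\<^sub>a, \<nabla>\<^sub>b] Z\<close>: the second derivatives of \<open>Z\<close> cancel, and so do the first.\<close>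

lemma ricci_identity:
  assumes Z: "smooth_on U Z" and x: "x \<in> U"
  shows "cov (cov Z b) a x - cov (cov Z a) b x = curv a b x *v Z x"
proof -
  have "cov (cov Z b) a x = D (D Z b) a x + Gam b x *v D Z a x + D (Gam b) a x *v Z x
      + Gam a x *v D Z b x + Gam a x *v (Gam b x *v Z x)" for a b
  proof -
    have "D (cov Z b) a x = D (D Z b) a x + (Gam b x *v D Z a x + D (Gam b) a x *v Z x)"
      unfolding cov_def[abs_def]
      by (subst D_add[OF smooth_on_frechet_derivative[OF Z]
            smooth_on_matrix_vector_mult[OF open_U smooth_Gam Z] x])
        (simp add: D_matrix_vector[OF smooth_Gam Z x])
    then show ?thesis by (simp add: cov_def[of "cov Z b"] cov_def[of Z] algebra_simps)
  qed
  then show ?thesis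
    using mixed_derivatives_commute_vec[OF Z x, of a b]
    by (simp add: curv_def algebra_simps matrix_vector_mul_assoc)
qed

lemma curv_antisym: "curv a b x = - curv b a x"
  by (simp add: curv_def)

text \<open>The second derivatives of the function \<open>g(c,d)\<close>, expressed by covariant derivatives of
  \<open>c\<close> and \<open>d\<close>, commute.\<close>

lemma curv_skew:
  assumes x: "x \<in> U"
  shows "ip x (curv a b x *v c) d = - ip x c (curv a b x *v d)"
proof -
  have c: "smooth_on U (\<lambda>_. c)" for c :: "real ^ 'n" by auto
  have "D (D (\<lambda>x. ip x c d) b) a x
    = ip x (cov (cov (\<lambda>_. c) b) a x) d + ip x (cov (\<lambda>_. c) b x) (cov (\<lambda>_. d) a x)
      + (ip x (cov (\<lambda>_. c) a x) (cov (\<lambda>_. d) b x) + ip x c (cov (cov (\<lambda>_. d) b) a x))" for a b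
  proof -
    have "D (D (\<lambda>x. ip x c d) b) a x
       = D (\<lambda>x. ip x (cov (\<lambda>_. c) b x) d + ip x c (cov (\<lambda>_. d) b x)) a x"
      by (rule D_cong[OF open_U x]) (rule D_ip[OF _ c c])
    also have "\<dots> = D (\<lambda>x. ip x (cov (\<lambda>_. c) b x) d) a x + D (\<lambda>x. ip x c (cov (\<lambda>_. d) b x)) a x"
      by (intro D_add[OF _ _ x] smooth_ip smooth_cov c)
    finally show ?thesis by (simp add: D_ip[OF x] c smooth_cov)
  qed
  moreover have "D (D (\<lambda>x. ip x c d) b) a x = D (D (\<lambda>x. ip x c d) a) b x"
    by (rule mixed_derivatives_commute[OF open_U smooth_ip[OF c c] x])
  ultimately have "ip x (cov (cov (\<lambda>_. c) b) a x - cov (cov (\<lambda>_. c) a) b x) d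
      + ip x c (cov (cov (\<lambda>_. d) b) a x - cov (cov (\<lambda>_. d) a) b x) = 0"
    by (simp add: ip_linear)
  then show ?thesis using ricci_identity[OF c x] by simp
qed

text \<open>The torsion-freeness \<open>Gam_sym\<close> makes the terms of the cyclic sum cancel in pairs.\<close>

lemma first_bianchi:
  assumes x: "x \<in> U"
  shows "curv a b x *v c + curv b c x *v a + curv c a x *v b = 0"
proof -
  have s: "D (Gam b) a x *v c = D (Gam c) a x *v b" for a b c
  proof -
    have "D (\<lambda>x. Gam b x *v c) a x = D (\<lambda>x. Gam c x *v b) a x"
      by (rule D_cong[OF open_U x]) (rule Gam_sym)
    then show ?thesis by (simp add: D_matrix_vector[OF smooth_Gam smooth_on_const x])
  qed
  have t: "Gam a x ** Gam b x *v c = Gam a x ** Gam c x *v b" for a b c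
    using Gam_sym[OF x, of b c] by (simp add: matrix_vector_mul_assoc[symmetric])
  show ?thesis
    using s[of b a c] s[of c b a] s[of a c b] t[of a b c] t[of b c a] t[of c a b]
    by (simp add: curv_def algebra_simps)
qed

text \<open>A formal consequence of the two skew symmetries and of four instances of the first Bianchi
  identity.\<close>

lemma curv_pair_sym:
  assumes x: "x \<in> U"
  shows "ip x (curv a b x *v c) d = ip x (curv c d x *v a) b"
proof -
  have b: "ip x (curv a b x *v c) d + ip x (curv b c x *v a) d + ip x (curv c a x *v b) d = 0"
    for a b c d
    using first_bianchi[OF x, of a b c] by (metis ip_linear(1,9))
  have s: "ip x (curv a b x *v c) d = - ip x (curv a b x *v d) c" for a b c d
    using curv_skew[OF x] ip_sym[OF x] by metis
  have a: "ip x (curv a b x *v c) d = - ip x (curv b a x *v c) d" for a b c d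
    by (subst curv_antisym)
      (simp add: ip_linear bounded_bilinear.minus_left[OF bounded_bilinear_matrix_vector_mult])
  show ?thesis
    using b[of a b c d] b[of b c d a] b[of c d a b] b[of d a b c]
      s[of a b c d] s[of b c a d] s[of c a b d] s[of c d a b] s[of d b c a] s[of d a b c]
      s[of a c d b] s[of b d a c] s[of b c d a] s[of c d b a] s[of d a c b] s[of a b d c]
      a[of a b c d] a[of b c a d] a[of c a b d] a[of c d a b] a[of d b c a] a[of d a b c]
      a[of a c d b] a[of b d a c] a[of b c d a] a[of c a d b] a[of d b a c]
    by linarith
qed

definition grad :: "(real ^ 'n \<Rightarrow> real) \<Rightarrow> real ^ 'n \<Rightarrow> real ^ 'n" where
  "grad f x = matrix_inv (G x) *v (\<chi> i. D f (axis i 1) x)"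

lemma smooth_grad: "smooth_on U f \<Longrightarrow> smooth_on U (grad f)"
  unfolding grad_def[abs_def]
  by (intro smooth_on_matrix_vector_mult smooth_Ginv smooth_on_vec_lambda
      smooth_on_frechet_derivative open_U)

lemma ip_grad:
  assumes "smooth_on U f" "x \<in> U"
  shows "ip x (grad f x) a = D f a x" "ip x a (grad f x) = D f a x"
proof -
  have "G x *v grad f x = (\<chi> i. D f (axis i 1) x)"
    using matrix_inv_inverts[OF G_invertible[OF assms(2)]]
    by (simp add: grad_def matrix_vector_mul_assoc)
  then have "ip x a (grad f x) = (\<Sum>i\<in>UNIV. a $ i * D f (axis i 1) x)"
    by (simp add: ip_def inner_vec_def)
  also have "\<dots> = D f a x"
    by (rule D_eq_sum_axis[OF assms, symmetric])
  finally show "ip x a (grad f x) = D f a x" .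
  then show "ip x (grad f x) a = D f a x" using ip_sym assms by metis
qed

lemma D_D_eq_hessian:
  assumes "smooth_on U f" "x \<in> U"
  shows "D (D f b) a x = ip x (cov (grad f) a x) b + D f (Gam a x *v b) x"
proof -
  have "D (D f b) a x = D (\<lambda>x. ip x (grad f x) b) a x"
    by (rule D_cong[OF open_U assms(2)]) (simp add: ip_grad[OF assms(1)])
  also have "\<dots> = ip x (cov (grad f) a x) b + ip x (grad f x) (cov (\<lambda>_. b) a x)"
    by (rule D_ip) (auto intro: smooth_grad assms)
  finally show ?thesis by (simp add: cov_const ip_grad[OF assms])
qed

text \<open>The second covariant derivative of a function differs from the matrix of second partial
  derivatives by a symmetric Christoffel term.\<close>

lemma hessian_sym:
  assumes "smooth_on U f" "x \<in> U"
  shows "ip x (cov (grad f) a x) b = ip x a (cov (grad f) b x)"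
  using D_D_eq_hessian[OF assms, of b a] D_D_eq_hessian[OF assms, of a b]
    mixed_derivatives_commute[OF open_U assms, of b a] Gam_sym[OF assms(2), of a b]
    ip_sym[OF assms(2), of a]
  by simp

end

section \<open>Integral curves, level sets and polynomials with coefficients constant along a field\<close>

lemma open_nonzero_subset:
  fixes f :: "'a::topological_space \<Rightarrow> 'b::{t1_space, zero}"
  assumes "open U" "continuous_on U f"
  shows "open {x \<in> U. f x \<noteq> 0}"
proof -
  have "{x \<in> U. f x \<noteq> 0} = U \<inter> f -` (- {0})" by auto
  then show ?thesis
    using continuous_open_preimage[OF assms(2,1), of "- {0}"] by (simp add: open_Compl)
qed

text \<open>The derivative is bounded on a compact ball, because it is continuous in each of the finitely
  many basis directions.\<close>

lemma smooth_on_lipschitz_cball: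
  fixes X :: "'a::euclidean_space \<Rightarrow> 'b::real_normed_vector"
  assumes X: "smooth_on U X" and r: "cball p r \<subseteq> U"
  obtains L where "L \<ge> 0" "\<And>x y. x \<in> cball p r \<Longrightarrow> y \<in> cball p r \<Longrightarrow> norm (X x - X y) \<le> L * norm (x - y)"
proof -
  let ?s = "\<lambda>x. \<Sum>b\<in>Basis. norm (D X b x)"
  have "continuous_on (cball p r) (D X b)" for b
    using smooth_on_continuous[OF smooth_on_frechet_derivative[OF X]] r
    by (rule continuous_on_subset)
  then have "continuous_on (cball p r) ?s"
    by (intro continuous_on_sum continuous_on_norm)
  then have "bounded (?s ` cball p r)"
    by (intro compact_imp_bounded compact_continuous_image) auto
  then obtain L where L: "L > 0" "\<And>x. x \<in> cball p r \<Longrightarrow> norm (?s x) \<le> L"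
    unfolding bounded_pos by auto
  have on: "onorm (\<lambda>a. D X a x) \<le> L" if x: "x \<in> cball p r" for x
  proof -
    have lin: "linear (\<lambda>a. D X a x)" using D_linear X r x by blast
    have "norm (D X a x) \<le> L * norm a" for a
    proof -
      have "D X a x = D X (\<Sum>b\<in>Basis. (a \<bullet> b) *\<^sub>R b) x" by (simp add: euclidean_representation)
      also have "\<dots> = (\<Sum>b\<in>Basis. (a \<bullet> b) *\<^sub>R D X b x)"
        by (simp add: linear_sum[OF lin] linear_cmul[OF lin])
      also have "norm \<dots> \<le> (\<Sum>b\<in>Basis. norm a * norm (D X b x))"
        by (rule order_trans[OF norm_sum]) (auto intro!: sum_mono mult_right_mono Basis_le_norm)
      also have "\<dots> = norm a * ?s x" by (simp add: sum_distrib_left)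
      also have "\<dots> \<le> norm a * L" using L(2)[OF x] by (intro mult_left_mono) auto
      finally show ?thesis by (simp add: mult.commute)
    qed
    then show ?thesis using L(1) by (intro onorm_bound) auto
  qed
  have "norm (X x - X y) \<le> L * norm (x - y)" if "x \<in> cball p r" "y \<in> cball p r" for x y
  proof (rule differentiable_bound[OF convex_cball _ on that])
    show "(X has_derivative (\<lambda>a. D X a z)) (at z within cball p r)" if "z \<in> cball p r" for z
      using smooth_on_has_derivative[OF X subsetD[OF r that]] by (rule has_derivative_at_withinI)
  qed
  then show thesis using that L(1) less_imp_le by blast
qed

text \<open>Picard iteration on a forward time interval. One-sided existence is enough because the
  conclusion to be drawn from it is a closed condition on the initial point.\<close>

lemma integral_curve_exists:
  fixes X :: "'a::euclidean_space \<Rightarrow> 'a"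
  assumes U: "open U" and X: "smooth_on U X" and p: "p \<in> U"
  obtains e y where "e > 0" "continuous_on {0..e} y" "y 0 = p" "\<And>t. t \<in> {0..e} \<Longrightarrow> y t \<in> U"
    "\<And>t. 0 < t \<Longrightarrow> t < e \<Longrightarrow> (y has_vector_derivative X (y t)) (at t)"
proof -
  obtain r where r: "r > 0" "cball p r \<subseteq> U" using U p open_contains_cball by blast
  obtain L where L: "L \<ge> 0"
    "\<And>x y. x \<in> cball p r \<Longrightarrow> y \<in> cball p r \<Longrightarrow> norm (X x - X y) \<le> L * norm (x - y)"
    using smooth_on_lipschitz_cball[OF X r(2)] by blast
  have contX: "continuous_on (cball p r) X"
    using smooth_on_continuous[OF X] r(2) continuous_on_subset by blast
  then have "bounded (X ` cball p r)" by (intro compact_imp_bounded compact_continuous_image) auto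
  then obtain B where B: "B > 0" "\<And>x. x \<in> cball p r \<Longrightarrow> norm (X x) \<le> B"
    unfolding bounded_pos by auto
  \<comment> \<open>The first bound keeps the iterates in the ball, the second makes the iteration a contraction.\<close>
  define e where "e = min (r / B) (1 / (2 * (L + 1)))"
  have e: "e > 0" "B * e \<le> r" "L * e \<le> 1/2"
  proof -
    show "e > 0" using r B L by (auto simp: e_def)
    have "B * e \<le> B * (r / B)" using B by (intro mult_left_mono) (auto simp: e_def)
    then show "B * e \<le> r" using B by simp
    have "L * e \<le> (L + 1) * (1 / (2 * (L + 1)))"
      using L \<open>e > 0\<close> by (intro mult_mono) (auto simp: e_def)
    also have "\<dots> = 1/2" using L by (simp add: field_simps)
    finally show "L * e \<le> 1/2" .
  qed
  \<comment> \<open>Clamping the time turns curves on \<open>{0..e}\<close> into bounded continuous functions on the line.\<close>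
  define cl where "cl t = max 0 (min e t)" for t
  have cl: "cl t \<in> {0..e}" "t \<in> {0..e} \<Longrightarrow> cl t = t" for t using e by (auto simp: cl_def)
  define T where
    "T f = (\<lambda>t. p + integral {0..cl t} (\<lambda>s. X (apply_bcontfun f s)))" for f :: "real \<Rightarrow>\<^sub>C 'a"
  define S where "S = PiC UNIV (\<lambda>_::real. cball p r)"
  have S: "apply_bcontfun f t \<in> cball p r" if "f \<in> S" for f t
    using that by (auto simp: S_def mem_PiC_iff)
  have contXf: "continuous_on A (\<lambda>s. X (apply_bcontfun f s))" if "f \<in> S" for f A
    using S[OF that] by (intro continuous_on_compose2[OF contX]) (auto simp: image_subset_iff)
  have T_cball: "T f t \<in> cball p r" if "f \<in> S" for f t
  proof -
    have "norm (integral {0..cl t} (\<lambda>s. X (apply_bcontfun f s))) \<le> B * (cl t - 0)"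
      using cl(1)[of t] B(2) S[OF that] by (intro integral_bound contXf that) auto
    also have "\<dots> \<le> B * e" using cl(1)[of t] B by simp
    also have "\<dots> \<le> r" by (rule e(2))
    finally show ?thesis by (simp add: T_def dist_norm)
  qed
  have T_cont: "continuous_on UNIV (T f)" if "f \<in> S" for f
  proof -
    have int: "continuous_on {0..e} (\<lambda>t. integral {0..t} (\<lambda>s. X (apply_bcontfun f s)))"
      by (intro indefinite_integral_continuous_1 integrable_continuous_real contXf that)
    have "continuous_on UNIV cl" unfolding cl_def by (intro continuous_intros)
    then have "continuous_on UNIV (\<lambda>t. integral {0..cl t} (\<lambda>s. X (apply_bcontfun f s)))"
      by (rule continuous_on_compose2[OF int]) (use cl(1) in blast)
    then show ?thesis unfolding T_def by (intro continuous_on_add continuous_on_const)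
  qed
  have T_bcont: "T f \<in> bcontfun" if "f \<in> S" for f
    unfolding bcontfun_def using T_cont[OF that] T_cball[OF that]
    by (auto intro!: bounded_subset[OF bounded_cball[of p r]])
  have "\<exists>!f\<in>S. Bcontfun (T f) = f"
  proof (rule Banach_fix[where c = "1/2"])
    show "complete S" unfolding S_def complete_eq_closed by (intro closed_PiC) auto
    have "const_bcontfun p \<in> S" using r by (auto simp: S_def mem_PiC_iff const_bcontfun.rep_eq)
    then show "S \<noteq> {}" by blast
    show "(\<lambda>f. Bcontfun (T f)) ` S \<subseteq> S"
      using T_cball T_bcont by (auto simp: S_def mem_PiC_iff Bcontfun_inverse)
    fix f g assume fg: "f \<in> S" "g \<in> S"
    have "dist (T f t) (T g t) \<le> 1/2 * dist f g" for t
    proof -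
      have "T f t - T g t
          = integral {0..cl t} (\<lambda>s. X (apply_bcontfun f s) - X (apply_bcontfun g s))"
        unfolding T_def by (subst Henstock_Kurzweil_Integration.integral_diff)
          (auto intro!: integrable_continuous_real contXf fg)
      also have "norm \<dots> \<le> (L * dist f g) * (cl t - 0)"
      proof (rule integral_bound)
        show "0 \<le> cl t" using cl by simp
        show "continuous_on {0..cl t} (\<lambda>s. X (apply_bcontfun f s) - X (apply_bcontfun g s))"
          by (intro continuous_intros contXf fg)
        show "norm (X (apply_bcontfun f s) - X (apply_bcontfun g s)) \<le> L * dist f g" for s
          using L(2)[OF S[OF fg(1)] S[OF fg(2)], of s s]
            mult_left_mono[OF dist_bounded[of f s g] L(1)] by (simp add: dist_norm)
      qed
      also have "\<dots> \<le> (L * dist f g) * e"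
        using cl(1)[of t] L by (intro mult_left_mono) auto
      also have "\<dots> \<le> 1/2 * dist f g"
        using mult_right_mono[OF e(3), of "dist f g"] by (simp add: ac_simps)
      finally show ?thesis by (simp add: dist_norm)
    qed
    then show "dist (Bcontfun (T f)) (Bcontfun (T g)) \<le> 1/2 * dist f g"
      using T_bcont fg by (intro dist_bound) (simp add: Bcontfun_inverse)
  qed auto
  then obtain f where f: "f \<in> S" "Bcontfun (T f) = f" by blast
  let ?y = "apply_bcontfun f"
  have y: "?y t = p + integral {0..t} (\<lambda>s. X (?y s))" if "t \<in> {0..e}" for t
    using f T_bcont[OF f(1)] cl(2)[OF that] by (metis Bcontfun_inverse T_def)
  show thesis
  proof (rule that[of e ?y])
    show "e > 0" by fact
    show "continuous_on {0..e} ?y" by (metis continuous_on_apply_bcontfun)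
    show "?y 0 = p" using y[of 0] e by simp
    show "?y t \<in> U" if "t \<in> {0..e}" for t using S[OF f(1)] r by blast
    show "(?y has_vector_derivative X (?y t)) (at t)" if t: "0 < t" "t < e" for t
    proof -
      have "((\<lambda>u. p + integral {0..u} (\<lambda>s. X (?y s))) has_vector_derivative 0 + X (?y t))
          (at t within {0..e})"
        using t by (intro has_vector_derivative_add has_vector_derivative_const
            integral_has_vector_derivative contXf f) auto
      then have "(?y has_vector_derivative X (?y t)) (at t within {0..e})"
        using t y by (intro has_vector_derivative_transform[of t "{0..e}" ?y]) auto
      then show ?thesis
        using t at_within_interior[of t "{0..e}"] by (simp add: interior_atLeastAtMost_real)
    qed
  qed
qed

text \<open>The map \<open>\<Phi>\<close> replaces the coordinate in a direction \<open>a\<close> transversal to the level sets by \<open>\<tau>\<close>.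
  In the new coordinates the level sets are hyperplanes, and a function whose differential is
  proportional to \<open>d\<tau>\<close> has vanishing derivative along them.\<close>

lemma constant_on_level_sets:
  fixes \<tau> f :: "'a::euclidean_space \<Rightarrow> real"
  assumes U: "open U" and p: "p \<in> U" and \<tau>: "smooth_on U \<tau>" and nz: "D \<tau> b p \<noteq> 0"
    and f: "\<And>x. x \<in> U \<Longrightarrow> f differentiable (at x)"
    and dep: "\<And>x y. x \<in> U \<Longrightarrow> D \<tau> y x = 0 \<Longrightarrow> D f y x = 0"
  obtains W where "open W" "p \<in> W" "W \<subseteq> U" "\<And>x y. x \<in> W \<Longrightarrow> y \<in> W \<Longrightarrow> \<tau> x = \<tau> y \<Longrightarrow> f x = f y"
proof -
  \<comment> \<open>A unit vector transversal to the level set through \<open>p\<close>, hence to all level sets near \<open>p\<close>.\<close>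
  define a where "a = sgn b"
  have lin: "linear (\<lambda>z. D \<tau> z x)" if "x \<in> U" for x using D_linear \<tau> that by blast
  have "b \<noteq> 0" using nz linear_0[OF lin[OF p]] by auto
  then have a: "a \<bullet> a = 1" "D \<tau> a p \<noteq> 0"
    using nz linear_cmul[OF lin[OF p]] norm_sgn[of b]
    by (auto simp: a_def norm_eq_1) (simp add: sgn_div_norm)
  have "continuous_on U (D \<tau> a)" using \<tau> by (intro smooth_on_continuous smooth_on_frechet_derivative)
  then have "open {x \<in> U. D \<tau> a x \<noteq> 0}"
    by (rule open_nonzero_subset[OF U])
  then obtain r where r: "r > 0" "ball p r \<subseteq> {x \<in> U. D \<tau> a x \<noteq> 0}"
    using p a openE by (metis (mono_tags, lifting) mem_Collect_eq)
  define S where "S = ball p r"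
  have S: "x \<in> S \<Longrightarrow> x \<in> U" "x \<in> S \<Longrightarrow> D \<tau> a x \<noteq> 0" for x using r by (auto simp: S_def)
  define \<Phi> where "\<Phi> x = x - (x \<bullet> a) *\<^sub>R a + \<tau> x *\<^sub>R a" for x
  have \<Phi>a: "\<Phi> x \<bullet> a = \<tau> x" for x by (simp add: \<Phi>_def inner_add inner_diff a)
  have \<Phi>': "(\<Phi> has_derivative (\<lambda>z. z - (z \<bullet> a) *\<^sub>R a + D \<tau> z x *\<^sub>R a)) (at x)" if "x \<in> S" for x
    unfolding \<Phi>_def
    by (auto intro!: derivative_eq_intros smooth_on_has_derivative[OF \<tau>] S that)
  have inj: "inj_on \<Phi> S"
  proof (rule inj_onI)
    fix x y assume xy: "x \<in> S" "y \<in> S" "\<Phi> x = \<Phi> y"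
    then have eq\<tau>: "\<tau> x = \<tau> y" using \<Phi>a by metis
    define s where "s = (y - x) \<bullet> a"
    have yx: "y = x + s *\<^sub>R a"
      using xy(3) eq\<tau> by (simp add: \<Phi>_def s_def inner_diff algebra_simps)
    have on: "x + t *\<^sub>R (s *\<^sub>R a) \<in> S" if "0 \<le> t" "t \<le> 1" for t
    proof -
      have "(1 - t) *\<^sub>R x + t *\<^sub>R y \<in> S"
        using convexD[OF convex_ball[of p r], of x y "1 - t" t] xy that by (auto simp: S_def)
      then show ?thesis by (simp add: yx algebra_simps)
    qed
    have "((\<lambda>t. \<tau> (x + t *\<^sub>R (s *\<^sub>R a))) has_real_derivative D \<tau> (s *\<^sub>R a) (x + t *\<^sub>R (s *\<^sub>R a))) (at t)"
      if "0 \<le> t" "t \<le> 1" for t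
      unfolding has_real_derivative_iff_has_vector_derivative
      by (intro has_derivative_along_line smooth_on_imp_differentiable[OF \<tau>] S on that)
    from MVT2[OF _ this, of 0 1] obtain t where t: "0 < t" "t < 1"
      "\<tau> (x + 1 *\<^sub>R (s *\<^sub>R a)) - \<tau> (x + 0 *\<^sub>R (s *\<^sub>R a)) = (1 - 0) * D \<tau> (s *\<^sub>R a) (x + t *\<^sub>R (s *\<^sub>R a))"
      by auto
    then have "s * D \<tau> a (x + t *\<^sub>R (s *\<^sub>R a)) = 0"
      using eq\<tau> yx linear_cmul[OF lin[OF S(1)[OF on]], of t s a] by simp
    then have "s = 0" using S(2)[OF on, of t] t by simp
    then show "x = y" using yx by simp
  qed
  have cont: "continuous_on S \<Phi>"
    using \<Phi>' by (intro continuous_at_imp_continuous_on) (auto intro: has_derivative_continuous)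
  have "open (\<Phi> ` S)" by (rule invariance_of_domain[OF cont _ inj]) (simp add: S_def)
  moreover have "\<Phi> p \<in> \<Phi> ` S" using r by (simp add: S_def)
  ultimately obtain q where q: "q > 0" "ball (\<Phi> p) q \<subseteq> \<Phi> ` S" using openE by blast
  define \<Psi> where "\<Psi> = inv_into S \<Phi>"
  have \<Psi>: "\<Psi> (\<Phi> x) = x" if "x \<in> S" for x using inj that by (simp add: \<Psi>_def)
  define W where "W = S \<inter> \<Phi> -` ball (\<Phi> p) q"
  show thesis
  proof (rule that[of W])
    show "open W" unfolding W_def
      using continuous_open_preimage[OF cont] by (simp add: S_def)
    show "p \<in> W" using r q by (simp add: W_def S_def)
    show "W \<subseteq> U" using S by (auto simp: W_def)
    fix x y assume xy: "x \<in> W" "y \<in> W" "\<tau> x = \<tau> y"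
    define w where "w = \<Phi> y - \<Phi> x"
    have wa: "w \<bullet> a = 0" using xy by (simp add: w_def inner_diff \<Phi>a)
    have deriv0: "((\<lambda>t. f (\<Psi> (\<Phi> x + t *\<^sub>R w))) has_real_derivative 0) (at t)"
      if t: "0 \<le> t" "t \<le> 1" for t
    proof -
      have "(1 - t) *\<^sub>R \<Phi> x + t *\<^sub>R \<Phi> y \<in> ball (\<Phi> p) q"
        using convexD[OF convex_ball[of "\<Phi> p" q], of "\<Phi> x" "\<Phi> y" "1 - t" t] xy t
        by (auto simp: W_def)
      then have "\<Phi> x + t *\<^sub>R w \<in> \<Phi> ` S" using q by (auto simp: w_def algebra_simps)
      then obtain z where z: "z \<in> S" "\<Phi> x + t *\<^sub>R w = \<Phi> z" by blast
      \<comment> \<open>The inverse of the derivative of \<open>\<Phi>\<close> at \<open>z\<close>.\<close>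
      define g' where
        "g' c = c - (c \<bullet> a) *\<^sub>R a + ((c \<bullet> a - D \<tau> (c - (c \<bullet> a) *\<^sub>R a) z) / D \<tau> a z) *\<^sub>R a" for c
      note lz = lin[OF S(1)[OF z(1)]]
      have \<tau>g': "D \<tau> (g' c) z = c \<bullet> a" for c
        using S(2)[OF z(1)] by (simp add: g'_def linear_add[OF lz] linear_cmul[OF lz])
      have "(\<Psi> has_derivative g') (at (\<Phi> z))"
      proof (rule has_derivative_inverse_strong[OF _ z(1) cont \<Psi> \<Phi>'[OF z(1)]])
        show "(\<lambda>z'. z' - (z' \<bullet> a) *\<^sub>R a + D \<tau> z' z *\<^sub>R a) \<circ> g' = id"
          using \<tau>g' by (auto simp: fun_eq_iff) (simp add: g'_def inner_add inner_diff a algebra_simps)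
      qed (auto simp: S_def)
      moreover have "((\<lambda>t. \<Phi> x + t *\<^sub>R w) has_vector_derivative w) (at t)"
        by (auto intro!: derivative_eq_intros)
      ultimately have "((\<lambda>t. \<Psi> (\<Phi> x + t *\<^sub>R w)) has_vector_derivative g' w) (at t)"
        using has_vector_derivative_chain[of "\<lambda>t. \<Phi> x + t *\<^sub>R w" w t \<Psi> g'] z by simp
      moreover have "(f has_derivative (\<lambda>c. D f c z)) (at (\<Psi> (\<Phi> x + t *\<^sub>R w)))"
        using f[OF S(1)[OF z(1)]] frechet_derivative_works z \<Psi> by metis
      ultimately have "((\<lambda>t. f (\<Psi> (\<Phi> x + t *\<^sub>R w))) has_vector_derivative D f (g' w) z) (at t)"
        by (rule has_vector_derivative_chain)
      then show ?thesis
        using dep[OF S(1)[OF z(1)]] \<tau>g'[of w] wa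
        by (simp add: has_real_derivative_iff_has_vector_derivative)
    qed
    have "f (\<Psi> (\<Phi> x + 1 *\<^sub>R w)) = f (\<Psi> (\<Phi> x + 0 *\<^sub>R w))"
      using MVT2[OF _ deriv0, of 0 1] by auto
    then show "f x = f y" using \<Psi> xy by (simp add: w_def W_def)
  qed
qed

lemma factors_through_near:
  fixes \<tau> f :: "'a::euclidean_space \<Rightarrow> real"
  assumes "open U" "p \<in> U" "smooth_on U \<tau>" "D \<tau> b p \<noteq> 0"
    and "\<And>x. x \<in> U \<Longrightarrow> f differentiable (at x)"
    and "\<And>x y. x \<in> U \<Longrightarrow> D \<tau> y x = 0 \<Longrightarrow> D f y x = 0"
  obtains W h where "open W" "p \<in> W" "W \<subseteq> U" "\<And>x. x \<in> W \<Longrightarrow> f x = h (\<tau> x)"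
proof -
  obtain W where W: "open W" "p \<in> W" "W \<subseteq> U"
    "\<And>x y. x \<in> W \<Longrightarrow> y \<in> W \<Longrightarrow> \<tau> x = \<tau> y \<Longrightarrow> f x = f y"
    using constant_on_level_sets[OF assms] by blast
  have "f x = f (inv_into W \<tau> (\<tau> x))" if "x \<in> W" for x
    using that by (intro W(4)) (auto simp: inv_into_into f_inv_into_f)
  then show thesis using that[of W "\<lambda>t. f (inv_into W \<tau> t)"] W by blast
qed

text \<open>Differentiating a polynomial relation along a field that kills the coefficients but not the
  argument lowers its degree; after \<open>n\<close> steps only the leading coefficient is left.\<close>

lemma leading_coefficient_zero:
  fixes f :: "'a::real_normed_vector \<Rightarrow> real" and c :: "nat \<Rightarrow> 'a \<Rightarrow> real"
  assumes U: "open U" and f: "smooth_on U f" and "\<And>k. smooth_on U (c k)"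
    and X: "\<And>x. x \<in> U \<Longrightarrow> D f (X x) x \<noteq> 0" and "\<And>k x. x \<in> U \<Longrightarrow> D (c k) (X x) x = 0"
    and "\<And>x. x \<in> U \<Longrightarrow> (\<Sum>k\<le>n. c k x * f x ^ k) = 0" and "x \<in> U"
  shows "c n x = 0"
  using assms(3,5-7)
proof (induction n arbitrary: c x)
  case 0
  then show ?case by simp
next
  case (Suc n)
  note has = smooth_on_has_derivative
  have "real (Suc n) * c (Suc n) x = 0"
  proof (rule Suc.IH[where c = "\<lambda>k x. real (Suc k) * c (Suc k) x"])
    show "smooth_on U (\<lambda>x. real (Suc k) * c (Suc k) x)" for k
      by (intro smooth_on_mult U smooth_on_const Suc.prems)
    show "D (\<lambda>x. real (Suc k) * c (Suc k) x) (X x) x = 0" if "x \<in> U" for k x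
      using D_mult[OF smooth_on_const Suc.prems(1) that] Suc.prems(2)[OF that] by simp
    fix x assume x: "x \<in> U"
    let ?F = "\<lambda>x. \<Sum>k\<le>Suc n. c k x * f x ^ k"
    have "(?F has_derivative (\<lambda>a. \<Sum>k\<le>Suc n. c k x * (of_nat k * D f a x * f x ^ (k - 1))
        + D (c k) a x * f x ^ k)) (at x)"
      by (intro has_derivative_sum has_derivative_mult has_derivative_power has[OF _ x] f Suc.prems)
    then have "D ?F (X x) x = (\<Sum>k\<le>Suc n. c k x * (of_nat k * D f (X x) x * f x ^ (k - 1)))"
      using D_eqI Suc.prems(2)[OF x] by fastforce
    also have "\<dots> = D f (X x) x * (\<Sum>k\<le>n. real (Suc k) * c (Suc k) x * f x ^ k)"
      by (subst sum.atMost_Suc_shift) (simp add: sum_distrib_left ac_simps)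
    finally have "D f (X x) x * (\<Sum>k\<le>n. real (Suc k) * c (Suc k) x * f x ^ k) = 0"
      using D_cong[OF U x Suc.prems(3), where a = "X x"] by simp
    then show "(\<Sum>k\<le>n. real (Suc k) * c (Suc k) x * f x ^ k) = 0" using X[OF x] by simp
  qed fact
  then show ?case by simp
qed

section \<open>Orthonormal frames and contractions of the curvature\<close>

lemma sum_swap_triple:
  "(\<Sum>k\<in>K. \<Sum>p\<in>P. \<Sum>q\<in>Q. \<Sum>b\<in>B. f k p q b) = (\<Sum>b\<in>B. \<Sum>k\<in>K. \<Sum>p\<in>P. \<Sum>q\<in>Q. f k p q b)"
proof -
  have "(\<Sum>k\<in>K. \<Sum>p\<in>P. \<Sum>q\<in>Q. \<Sum>b\<in>B. f k p q b) = (\<Sum>k\<in>K. \<Sum>p\<in>P. \<Sum>b\<in>B. \<Sum>q\<in>Q. f k p q b)"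
    by (intro sum.cong refl sum.swap)
  also have "\<dots> = (\<Sum>k\<in>K. \<Sum>b\<in>B. \<Sum>p\<in>P. \<Sum>q\<in>Q. f k p q b)"
    by (intro sum.cong refl sum.swap)
  also have "\<dots> = (\<Sum>b\<in>B. \<Sum>k\<in>K. \<Sum>p\<in>P. \<Sum>q\<in>Q. f k p q b)"
    by (rule sum.swap)
  finally show ?thesis .
qed

lemma sum_swap_triples:
  "(\<Sum>k\<in>K. \<Sum>p\<in>P. \<Sum>q\<in>Q. \<Sum>b\<in>B. \<Sum>c\<in>C. \<Sum>d\<in>D'. f k p q b c d)
   = (\<Sum>b\<in>B. \<Sum>c\<in>C. \<Sum>d\<in>D'. \<Sum>k\<in>K. \<Sum>p\<in>P. \<Sum>q\<in>Q. f k p q b c d)"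
proof -
  have "(\<Sum>k\<in>K. \<Sum>p\<in>P. \<Sum>q\<in>Q. \<Sum>b\<in>B. \<Sum>c\<in>C. \<Sum>d\<in>D'. f k p q b c d)
      = (\<Sum>b\<in>B. \<Sum>k\<in>K. \<Sum>p\<in>P. \<Sum>q\<in>Q. \<Sum>c\<in>C. \<Sum>d\<in>D'. f k p q b c d)"
    by (rule sum_swap_triple)
  also have "\<dots> = (\<Sum>b\<in>B. \<Sum>c\<in>C. \<Sum>k\<in>K. \<Sum>p\<in>P. \<Sum>q\<in>Q. \<Sum>d\<in>D'. f k p q b c d)"
    by (intro sum.cong refl sum_swap_triple)
  also have "\<dots> = (\<Sum>b\<in>B. \<Sum>c\<in>C. \<Sum>d\<in>D'. \<Sum>k\<in>K. \<Sum>p\<in>P. \<Sum>q\<in>Q. f k p q b c d)"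
    by (intro sum.cong refl sum_swap_triple)
  finally show ?thesis .
qed

context metric_chart
begin

definition Rm :: "real ^ 'n \<Rightarrow> real ^ 'n \<Rightarrow> real ^ 'n \<Rightarrow> real ^ 'n \<Rightarrow> real ^ 'n \<Rightarrow> real" where
  "Rm x a b c d = ip x (curv a b x *v c) d"

lemma Rm_linear:
  assumes x: "x \<in> U"
  shows "linear (\<lambda>a. Rm x a b c d)" "linear (\<lambda>b. Rm x a b c d)"
    "linear (\<lambda>c. Rm x a b c d)" "linear (\<lambda>d. Rm x a b c d)"
  unfolding Rm_def
  by (auto intro!: linearI simp: linear_add[OF curv_linear(1)[OF x]] linear_cmul[OF curv_linear(1)[OF x]]
      linear_add[OF curv_linear(2)[OF x]] linear_cmul[OF curv_linear(2)[OF x]]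
      ip_linear matrix_vector_mult_add_rdistrib scaleR_matrix_vector_assoc[symmetric]
      matrix_vector_right_distrib matrix_vector_mult_scaleR)

lemma Rm_antisym: 
  assumes "x \<in> U"
  shows "Rm x a b c d = - Rm x b a c d" "Rm x a b c d = - Rm x a b d c"
proof -
  show "Rm x a b c d = - Rm x b a c d"
    unfolding Rm_def by (subst curv_antisym)
      (simp add: ip_linear bounded_bilinear.minus_left[OF bounded_bilinear_matrix_vector_mult])
  show "Rm x a b c d = - Rm x a b d c"
    unfolding Rm_def using curv_skew[OF assms] ip_sym[OF assms] by metis
qed

lemma Rm_pair_sym: "x \<in> U \<Longrightarrow> Rm x a b c d = Rm x c d a b"
  unfolding Rm_def by (rule curv_pair_sym)

definition orthonormal :: "real ^ 'n \<Rightarrow> ('n \<Rightarrow> real ^ 'n) \<Rightarrow> bool" where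
  "orthonormal x e \<longleftrightarrow> (\<forall>a b. ip x (e a) (e b) = (if a = b then 1 else 0))"

text \<open>If the columns of \<open>E\<close> form an orthonormal frame, then \<open>E\<^sup>T G E = 1\<close>, hence
  \<open>G\<^sup>-\<^sup>1 = E E\<^sup>T\<close>. The inverse metric thus contracts indices by summing over the frame.\<close>

lemma orthonormal_Ginv:
  assumes x: "x \<in> U" and e: "orthonormal x e"
  shows "matrix_inv (G x) $ i $ j = (\<Sum>a\<in>UNIV. e a $ i * e a $ j)"
    and "b = (\<Sum>a\<in>UNIV. ip x b (e a) *\<^sub>R e a)"
proof -
  define E where "E = (\<chi> i a. e a $ i)"
  have "transpose E ** G x ** E = mat 1"
  proof -
    have "(transpose E ** G x ** E) $ a $ b = ip x (e a) (e b)" for a b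
      unfolding matrix_mul_assoc[symmetric]
      by (simp add: ip_def E_def matrix_matrix_mult_def transpose_def inner_vec_def
          matrix_vector_mult_def)
    then show ?thesis using e by (simp add: vec_eq_iff mat_def orthonormal_def)
  qed
  then have 1: "E ** (transpose E ** G x) = mat 1"
    using matrix_left_right_inverse by blast
  have "matrix_inv (G x) = E ** (transpose E ** G x) ** matrix_inv (G x)" by (simp add: 1)
  also have "\<dots> = E ** transpose E"
    using matrix_inv_inverts[OF G_invertible[OF x]] by (simp add: matrix_mul_assoc[symmetric])
  finally show "matrix_inv (G x) $ i $ j = (\<Sum>a\<in>UNIV. e a $ i * e a $ j)"
    by (simp add: E_def matrix_matrix_mult_def transpose_def)
  have "b = E *v (transpose E *v (G x *v b))"
    using 1 by (metis matrix_mul_assoc matrix_vector_mul_assoc matrix_vector_mul_lid)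
  also have "transpose E *v (G x *v b) = (\<chi> a. ip x b (e a))"
    using ip_sym[OF x, of b] by (simp add: ip_def E_def transpose_def matrix_vector_mult_def inner_vec_def)
  finally show "b = (\<Sum>a\<in>UNIV. ip x b (e a) *\<^sub>R e a)"
    by (simp add: E_def matrix_vector_mult_def vec_eq_iff mult.commute)
qed

text \<open>The Laplacian.\<close>

definition trace_hessian :: "(real ^ 'n \<Rightarrow> real) \<Rightarrow> real ^ 'n \<Rightarrow> real" where
  "trace_hessian f x = (\<Sum>i\<in>UNIV. \<Sum>j\<in>UNIV. matrix_inv (G x) $ i $ j *
     ip x (cov (grad f) (axis i 1) x) (axis j 1))"

lemma smooth_trace_hessian: "smooth_on U f \<Longrightarrow> smooth_on U (trace_hessian f)"
  unfolding trace_hessian_def[abs_def]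
  by (intro smooth_on_sum smooth_on_mult smooth_on_nth smooth_Ginv smooth_ip smooth_cov
      smooth_grad smooth_on_const open_U)

lemma trace_hessian_frame:
  assumes f: "smooth_on U f" and x: "x \<in> U" and e: "orthonormal x e"
  shows "trace_hessian f x = (\<Sum>a\<in>UNIV. ip x (cov (grad f) (e a) x) (e a))"
proof -
  let ?S = "\<lambda>a. cov (grad f) a x"
  have lin: "linear ?S" by (rule linear_cov[OF smooth_grad[OF f] x])
  have "ip x (?S (e a)) (e a)
      = (\<Sum>i\<in>UNIV. \<Sum>j\<in>UNIV. e a $ i * e a $ j * ip x (?S (axis i 1)) (axis j 1))" for a
  proof -
    have l1: "linear (\<lambda>y. ip x (?S y) (e a))"
      by (intro linearI) (simp_all add: linear_add[OF lin] linear_cmul[OF lin] ip_linear)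
    have l2: "linear (\<lambda>y. ip x z y)" for z by (intro linearI) (simp_all add: ip_linear)
    have "ip x (?S (e a)) (e a) = (\<Sum>i\<in>UNIV. e a $ i * ip x (?S (axis i 1)) (e a))"
      using linear_eq_sum_axis[OF l1, of "e a"] by simp
    also have "\<dots> = (\<Sum>i\<in>UNIV. e a $ i * (\<Sum>j\<in>UNIV. e a $ j * ip x (?S (axis i 1)) (axis j 1)))"
      using linear_eq_sum_axis[OF l2, of _ "e a"] by simp
    finally show ?thesis by (simp add: sum_distrib_left mult.assoc)
  qed
  then have "(\<Sum>a\<in>UNIV. ip x (?S (e a)) (e a))
      = (\<Sum>a\<in>UNIV. \<Sum>i\<in>UNIV. \<Sum>j\<in>UNIV. e a $ i * e a $ j * ip x (?S (axis i 1)) (axis j 1))"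
    by simp
  also have "\<dots> = (\<Sum>i\<in>UNIV. \<Sum>a\<in>UNIV. \<Sum>j\<in>UNIV. e a $ i * e a $ j * ip x (?S (axis i 1)) (axis j 1))"
    by (rule sum.swap)
  also have "\<dots> = (\<Sum>i\<in>UNIV. \<Sum>j\<in>UNIV. \<Sum>a\<in>UNIV. e a $ i * e a $ j * ip x (?S (axis i 1)) (axis j 1))"
    by (intro sum.cong refl sum.swap)
  finally show ?thesis
    by (simp add: trace_hessian_def orthonormal_Ginv(1)[OF x e] sum_distrib_right)
qed

text \<open>The contraction \<open>R\<^sub>i\<^sub>k\<^sub>p\<^sub>q R\<^sub>j\<^sup>k\<^sup>p\<^sup>q\<close> that enters the weakly Einstein condition.\<close>

definition contraction :: "'n \<Rightarrow> 'n \<Rightarrow> real ^ 'n \<Rightarrow> real" where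
  "contraction i j x =
     (\<Sum>k\<in>UNIV. \<Sum>p\<in>UNIV. \<Sum>q\<in>UNIV. Rm x (axis i 1) (axis k 1) (axis p 1) (axis q 1) *
        (\<Sum>k'\<in>UNIV. \<Sum>p'\<in>UNIV. \<Sum>q'\<in>UNIV.
           matrix_inv (G x) $ k $ k' * matrix_inv (G x) $ p $ p' * matrix_inv (G x) $ q $ q' *
           Rm x (axis j 1) (axis k' 1) (axis p' 1) (axis q' 1)))"

lemma Rm_expand:
  assumes x: "x \<in> U"
  shows "Rm x a b c d = (\<Sum>k\<in>UNIV. \<Sum>p\<in>UNIV. \<Sum>q\<in>UNIV. b $ k * c $ p * d $ q *
      Rm x a (axis k 1) (axis p 1) (axis q 1))"
proof -
  have 1: "Rm x a b c d = (\<Sum>k\<in>UNIV. b $ k * Rm x a (axis k 1) c d)"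
    using linear_eq_sum_axis[OF Rm_linear(2)[OF x], where a = b] by simp
  have 2: "Rm x a b' c d = (\<Sum>k\<in>UNIV. c $ k * Rm x a b' (axis k 1) d)" for b'
    using linear_eq_sum_axis[OF Rm_linear(3)[OF x], where a = c] by simp
  have 3: "Rm x a b' c' d = (\<Sum>k\<in>UNIV. d $ k * Rm x a b' c' (axis k 1))" for b' c'
    using linear_eq_sum_axis[OF Rm_linear(4)[OF x], where a = d] by simp
  have "Rm x a b c d = (\<Sum>k\<in>UNIV. b $ k * (\<Sum>p\<in>UNIV. c $ p * (\<Sum>q\<in>UNIV. d $ q *
      Rm x a (axis k 1) (axis p 1) (axis q 1))))"
    unfolding 1 2[of "axis _ 1"] 3[of "axis _ 1" "axis _ 1"] ..
  then show ?thesis by (simp add: sum_distrib_left mult.assoc)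
qed

lemma contraction_frame_axis:
  assumes x: "x \<in> U" and e: "orthonormal x e"
  shows "contraction i j x = (\<Sum>b\<in>UNIV. \<Sum>c\<in>UNIV. \<Sum>d\<in>UNIV.
      Rm x (axis i 1) (e b) (e c) (e d) * Rm x (axis j 1) (e b) (e c) (e d))"
proof -
  let ?R = "\<lambda>i k p q. Rm x (axis i 1) (axis k 1) (axis p 1) (axis q 1)"
  have up: "(\<Sum>k'\<in>UNIV. \<Sum>p'\<in>UNIV. \<Sum>q'\<in>UNIV.
      matrix_inv (G x) $ k $ k' * matrix_inv (G x) $ p $ p' * matrix_inv (G x) $ q $ q' * ?R j k' p' q')
    = (\<Sum>b\<in>UNIV. \<Sum>c\<in>UNIV. \<Sum>d\<in>UNIV. e b $ k * e c $ p * e d $ q * Rm x (axis j 1) (e b) (e c) (e d))"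
    for k p q
  proof -
    have "matrix_inv (G x) $ k $ k' * matrix_inv (G x) $ p $ p' * matrix_inv (G x) $ q $ q'
      = (\<Sum>b\<in>UNIV. \<Sum>c\<in>UNIV. \<Sum>d\<in>UNIV.
          (e b $ k * e c $ p * e d $ q) * (e b $ k' * e c $ p' * e d $ q'))" for k' p' q'
    proof -
      have "(\<Sum>b\<in>UNIV. f b) * (\<Sum>c\<in>UNIV. g c) * (\<Sum>d\<in>UNIV. h d)
        = (\<Sum>b\<in>UNIV. \<Sum>c\<in>UNIV. \<Sum>d\<in>UNIV. f b * g c * h d)" for f g h :: "'n \<Rightarrow> real"
        by (simp flip: sum_distrib_left sum_distrib_right)
      then show ?thesis by (simp add: orthonormal_Ginv(1)[OF x e] ac_simps)
    qed
    then have "(\<Sum>k'\<in>UNIV. \<Sum>p'\<in>UNIV. \<Sum>q'\<in>UNIV.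
      matrix_inv (G x) $ k $ k' * matrix_inv (G x) $ p $ p' * matrix_inv (G x) $ q $ q' * ?R j k' p' q')
      = (\<Sum>k'\<in>UNIV. \<Sum>p'\<in>UNIV. \<Sum>q'\<in>UNIV. \<Sum>b\<in>UNIV. \<Sum>c\<in>UNIV. \<Sum>d\<in>UNIV.
          (e b $ k * e c $ p * e d $ q) * (e b $ k' * e c $ p' * e d $ q' * ?R j k' p' q'))"
      by (simp add: sum_distrib_right mult.assoc)
    also have "\<dots> = (\<Sum>b\<in>UNIV. \<Sum>c\<in>UNIV. \<Sum>d\<in>UNIV. \<Sum>k'\<in>UNIV. \<Sum>p'\<in>UNIV. \<Sum>q'\<in>UNIV.
          (e b $ k * e c $ p * e d $ q) * (e b $ k' * e c $ p' * e d $ q' * ?R j k' p' q'))"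
      by (rule sum_swap_triples)
    finally show ?thesis
      by (simp add: Rm_expand[OF x, of _ "e _"] sum_distrib_left)
  qed
  have "contraction i j x = (\<Sum>k\<in>UNIV. \<Sum>p\<in>UNIV. \<Sum>q\<in>UNIV. \<Sum>b\<in>UNIV. \<Sum>c\<in>UNIV. \<Sum>d\<in>UNIV.
      e b $ k * e c $ p * e d $ q * ?R i k p q * Rm x (axis j 1) (e b) (e c) (e d))"
    unfolding contraction_def up by (simp add: sum_distrib_left ac_simps)
  also have "\<dots> = (\<Sum>b\<in>UNIV. \<Sum>c\<in>UNIV. \<Sum>d\<in>UNIV. \<Sum>k\<in>UNIV. \<Sum>p\<in>UNIV. \<Sum>q\<in>UNIV.
      e b $ k * e c $ p * e d $ q * ?R i k p q * Rm x (axis j 1) (e b) (e c) (e d))"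
    by (rule sum_swap_triples)
  also have "\<dots> = (\<Sum>b\<in>UNIV. \<Sum>c\<in>UNIV. \<Sum>d\<in>UNIV.
      Rm x (axis i 1) (e b) (e c) (e d) * Rm x (axis j 1) (e b) (e c) (e d))"
    unfolding Rm_expand[OF x, of "axis i 1" "e _"] sum_distrib_right ..
  finally show ?thesis .
qed

lemma weakly_einstein_frame:
  assumes x: "x \<in> U" and e: "orthonormal x e"
    and we: "\<And>i j. contraction i j x = \<kappa> * G x $ i $ j"
  shows "(\<Sum>b\<in>UNIV. \<Sum>c\<in>UNIV. \<Sum>d\<in>UNIV. Rm x y (e b) (e c) (e d) * Rm x z (e b) (e c) (e d))
    = \<kappa> * ip x y z"
proof -
  let ?B = "\<lambda>y z. \<Sum>b\<in>UNIV. \<Sum>c\<in>UNIV. \<Sum>d\<in>UNIV. Rm x y (e b) (e c) (e d) * Rm x z (e b) (e c) (e d)"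
  have "bilinear ?B"
    unfolding bilinear_def
    by (auto intro!: linearI simp: linear_add[OF Rm_linear(1)[OF x]] linear_cmul[OF Rm_linear(1)[OF x]]
        algebra_simps sum.distrib sum_distrib_left)
  moreover have "bilinear (\<lambda>y z. \<kappa> * ip x y z)"
    unfolding bilinear_def by (auto intro!: linearI simp: ip_linear algebra_simps)
  moreover have "?B y z = \<kappa> * ip x y z" if yz: "y \<in> Basis" "z \<in> Basis" for y z
  proof -
    obtain i j where ij: "y = axis i 1" "z = axis j 1" using yz by (auto simp: Basis_vec_def)
    have "ip x y z = G x $ i $ j"
      by (simp add: ij ip_def inner_axis' matrix_vector_mult_basis column_def)
    then show ?thesis using contraction_frame_axis[OF x e, of i j] we ij by simp
  qed
  ultimately have "?B = (\<lambda>y z. \<kappa> * ip x y z)" by (intro bilinear_eq_stdbasis) auto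
  then show ?thesis by meson
qed

end

text \<open>The curvature components in a unitary frame whose first two vectors are \<open>v/|v|\<close> and
  \<open>Jv/|v|\<close>. The symmetries of a Kaehler curvature tensor reduce all of them to the listed ones and
  to the component \<open>C\<close> of the last plane. The entry \<open>(1,3)\<close> of the contraction is a multiple of
  \<open>z(4B + C)\<close>, which yields \<open>C = -4B\<close>, and the equality of the entries \<open>(1,1)\<close> and \<open>(3,3)\<close> says
  that \<open>A\<^sup>2 = C\<^sup>2 + 2z\<^sup>2\<close>.\<close>

lemma weakly_einstein_components:
  fixes r :: "4 \<Rightarrow> 4 \<Rightarrow> 4 \<Rightarrow> 4 \<Rightarrow> real"
  assumes anti: "\<And>a b c d. r a b c d = - r b a c d" "\<And>a b c d. r a b c d = - r a b d c"
    and pair: "\<And>a b c d. r a b c d = r c d a b"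
    and J: "\<And>a b. r a b 2 4 = r a b 1 3" "\<And>a b. r a b 2 3 = - r a b 1 4"
    and vals: "r 1 2 1 2 = A" "r 1 2 1 3 = 0" "r 1 2 1 4 = 0" "r 1 3 1 3 = B" "r 1 3 1 4 = 0"
      "r 1 4 1 4 = B" "r 3 4 1 2 = 2 * B" "r 3 4 1 3 = 0" "r 3 4 1 4 = z"
    and z: "z \<noteq> 0"
    and T: "\<And>a b. (\<Sum>k\<in>UNIV. \<Sum>p\<in>UNIV. \<Sum>q\<in>UNIV. r a k p q * r b k p q) = (if a = b then \<kappa> else 0)"
  shows "A\<^sup>2 = 16 * B\<^sup>2 + 2 * z\<^sup>2"
proof -
  define C where "C = r 3 4 3 4"
  have d1: "r a a c d = 0" for a c d using anti(1)[of a a c d] by simp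
  have d2: "r a b c c = 0" for a b c using anti(2)[of a b c c] by simp
  have J1: "r 2 4 c d = r 1 3 c d" "r 2 3 c d = - r 1 4 c d" for c d
    using pair[of _ _ c d] J[of c d] by metis+
  have c1: "r 2 1 c d = - r 1 2 c d" "r 3 1 c d = - r 1 3 c d" "r 4 1 c d = - r 1 4 c d"
    "r 3 2 c d = r 1 4 c d" "r 4 2 c d = - r 1 3 c d" "r 4 3 c d = - r 3 4 c d" for c d
    using anti(1)[of 2 1 c d] anti(1)[of 3 1 c d] anti(1)[of 4 1 c d] anti(1)[of 3 2 c d]
      anti(1)[of 4 2 c d] anti(1)[of 4 3 c d] J1[of c d] by simp_all
  have c2: "r a b 2 1 = - r a b 1 2" "r a b 3 1 = - r a b 1 3" "r a b 4 1 = - r a b 1 4"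
    "r a b 3 2 = r a b 1 4" "r a b 4 2 = - r a b 1 3" "r a b 4 3 = - r a b 3 4" for a b
    using anti(2)[of a b 2 1] anti(2)[of a b 3 1] anti(2)[of a b 4 1] anti(2)[of a b 3 2]
      anti(2)[of a b 4 2] anti(2)[of a b 4 3] J[of a b] by simp_all
  have v: "r 1 3 1 2 = 0" "r 1 4 1 2 = 0" "r 1 2 3 4 = 2 * B" "r 1 4 1 3 = 0" "r 1 3 3 4 = 0"
    "r 1 4 3 4 = z" "r 3 4 3 4 = C"
    using pair[of 1 3 1 2] pair[of 1 4 1 2] pair[of 1 2 3 4] pair[of 1 4 1 3] pair[of 1 3 3 4]
      pair[of 1 4 3 4] vals by (simp_all add: C_def)
  \<comment> \<open>Rewriting with these equations evaluates all 64 terms of each entry.\<close>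
  note all = sum_4 d1 d2 J1 J c1 c2 v vals
  have "\<kappa> = 2 * (A\<^sup>2 + 8 * B\<^sup>2 + z\<^sup>2)"
    using T[of 1 1] by (simp add: all power2_eq_square)
  moreover have "\<kappa> = 2 * (8 * B\<^sup>2 + C\<^sup>2 + 3 * z\<^sup>2)"
    using T[of 3 3] by (simp add: all power2_eq_square)
  moreover have "z * (4 * B + C) = 0"
    using T[of 1 3] by (simp add: all algebra_simps)
  then have "C = - 4 * B" using z by simp
  ultimately show ?thesis by (simp add: power_mult_distrib)
qed

section \<open>Kaehler metrics in a coordinate domain\<close>

locale kaehler_chart = metric_chart U G
  for U :: "(real ^ 'n) set" and G :: "real ^ 'n \<Rightarrow> real ^ 'n ^ 'n" +
  fixes J :: "real ^ 'n \<Rightarrow> real ^ 'n ^ 'n"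
  assumes J_smooth: "smooth_on U J"
    and J_J: "x \<in> U \<Longrightarrow> J x *v (J x *v a) = - a"
    and J_isometry: "x \<in> U \<Longrightarrow> ip x (J x *v a) (J x *v b) = ip x a b"
    and J_parallel: "x \<in> U \<Longrightarrow> D J a x *v b + Gam a x *v (J x *v b) = J x *v (Gam a x *v b)"
begin

lemma smooth_J: "smooth_on U Z \<Longrightarrow> smooth_on U (\<lambda>x. J x *v Z x)"
  by (intro smooth_on_matrix_vector_mult open_U J_smooth)

lemma cov_J:
  assumes "smooth_on U Z" "x \<in> U"
  shows "cov (\<lambda>x. J x *v Z x) a x = J x *v cov Z a x"
  using J_parallel[OF assms(2), of a "Z x"]
  by (simp add: cov_def D_matrix_vector[OF J_smooth assms] algebra_simps)

lemma cov_cong: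
  assumes "x \<in> U" "\<And>x. x \<in> U \<Longrightarrow> Y x = Z x"
  shows "cov Y a x = cov Z a x"
  using assms D_cong[OF open_U assms(1), of Y Z] by (simp add: cov_def)

text \<open>Apply the Ricci identity to the field \<open>Jc\<close>; covariant derivatives commute with \<open>J\<close>.\<close>

lemma curv_J:
  assumes x: "x \<in> U"
  shows "curv a b x *v (J x *v c) = J x *v (curv a b x *v c)"
proof -
  have c: "smooth_on U (\<lambda>_. c)" by auto
  have "cov (cov (\<lambda>x. J x *v c) b) a x = J x *v cov (cov (\<lambda>_. c) b) a x" for a b
  proof -
    have "cov (cov (\<lambda>x. J x *v c) b) a x = cov (\<lambda>x. J x *v cov (\<lambda>_. c) b x) a x"
      by (rule cov_cong[OF x], rule cov_J[OF c])
    then show ?thesis by (simp only: cov_J[OF smooth_cov[OF c] x])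
  qed
  then show ?thesis
    using ricci_identity[OF smooth_J[OF c] x, of b a] ricci_identity[OF c x, of b a]
    by (simp add: matrix_vector_mult_diff_distrib[symmetric])
qed

lemma J_skew: "x \<in> U \<Longrightarrow> ip x (J x *v a) b = - ip x a (J x *v b)"
  using J_isometry[of x a "J x *v b"] J_J[of x b] by (simp add: ip_linear)

lemma J_orthogonal [simp]: "x \<in> U \<Longrightarrow> ip x a (J x *v a) = 0" "x \<in> U \<Longrightarrow> ip x (J x *v a) a = 0"
  using J_skew[of x a a] ip_sym[of x a "J x *v a"] by auto

lemma Rm_J: 
  assumes x: "x \<in> U"
  shows "Rm x a b (J x *v c) (J x *v d) = Rm x a b c d"
  by (simp add: Rm_def curv_J[OF x] J_isometry[OF x])

text \<open>Pair symmetry carries the invariance under \<open>J\<close> from the second pair of arguments to the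
  first.\<close>

lemma curv_J_J:
  assumes x: "x \<in> U"
  shows "curv (J x *v a) (J x *v b) x *v c = curv a b x *v c"
proof (rule ip_nondegenerate[OF x])
  fix d
  show "ip x (curv (J x *v a) (J x *v b) x *v c) d = ip x (curv a b x *v c) d"
    using Rm_J[OF x, of c d a b] Rm_pair_sym[OF x] by (simp add: Rm_def)
qed

end

section \<open>Holomorphic transnormal gradients\<close>

text \<open>The domain is one on which the gradient has no zeros, and \<open>transnormal\<close> is the
  infinitesimal form of the condition: \<open>\<nabla>\<^sub>v v\<close> is tangent to \<open>v\<close>.\<close>

locale holomorphic_transnormal_chart = kaehler_chart U G J
  for U :: "(real ^ 4) set" and G J :: "real ^ 4 \<Rightarrow> real ^ 4 ^ 4" +
  fixes \<tau> :: "real ^ 4 \<Rightarrow> real"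
  assumes tau_smooth: "smooth_on U \<tau>"
    and grad_nonzero: "x \<in> U \<Longrightarrow> grad \<tau> x \<noteq> 0"
    and holomorphic: "x \<in> U \<Longrightarrow> cov (grad \<tau>) (J x *v b) x = J x *v cov (grad \<tau>) b x"
    and transnormal: "x \<in> U \<Longrightarrow> \<exists>c. cov (grad \<tau>) (grad \<tau> x) x = c *\<^sub>R grad \<tau> x"
begin

abbreviation v where "v \<equiv> grad \<tau>"
abbreviation S where "S x b \<equiv> cov v b x"
definition u where "u x = J x *v v x"
definition Q where "Q x = ip x (v x) (v x)"
text \<open>The eigenvalues of the Hessian on the complex line of \<open>v\<close> and on its orthogonal complement.
  The second one is read off from the trace \<open>\<Delta>\<tau> = 2\<psi> + 2\<phi>\<close>, which makes its smoothness
  immediate.\<close>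

definition \<psi> where "\<psi> x = ip x (S x (v x)) (v x) / Q x"
definition \<phi> where "\<phi> x = trace_hessian \<tau> x / 2 - \<psi> x"
definition \<mu> where "\<mu> x = (\<psi> x - \<phi> x) / Q x"
text \<open>The quotient \<open>\<beta> / Q\<close> is, up to sign, the sectional curvature of the planes spanned by
  \<open>v\<close> and a vector orthogonal to \<open>v\<close> and \<open>Jv\<close>.\<close>

definition \<beta> where "\<beta> x = \<phi> x * (\<psi> x - \<phi> x)"

lemma v_smooth: "smooth_on U v" by (rule smooth_grad[OF tau_smooth])

lemma u_smooth: "smooth_on U u" unfolding u_def[abs_def] by (rule smooth_J[OF v_smooth])

lemma Q_smooth: "smooth_on U Q" unfolding Q_def[abs_def] by (intro smooth_ip v_smooth)

lemma Q_pos: "x \<in> U \<Longrightarrow> Q x > 0" by (simp add: Q_def ip_pos grad_nonzero)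

lemma Q_nonzero: "x \<in> U \<Longrightarrow> Q x \<noteq> 0" using Q_pos by force

lemma D_along_smooth:
  fixes f :: "real ^ 4 \<Rightarrow> real"
  assumes "smooth_on U f" "smooth_on U Z" shows "smooth_on U (\<lambda>x. D f (Z x) x)"
proof -
  have "smooth_on U (\<lambda>x. ip x (grad f x) (Z x))" by (intro smooth_ip smooth_grad assms)
  then show ?thesis by (subst smooth_on_cong[OF open_U]) (auto simp: ip_grad(1)[OF assms(1)])
qed

lemma linear_S: "x \<in> U \<Longrightarrow> linear (S x)" by (rule linear_cov[OF v_smooth])

lemma S_sym: "x \<in> U \<Longrightarrow> ip x (S x a) b = ip x a (S x b)"
  by (rule hessian_sym[OF tau_smooth])

lemma D_tau: "x \<in> U \<Longrightarrow> D \<tau> a x = ip x a (v x)" by (simp add: ip_grad[OF tau_smooth])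

lemma S_v: assumes "x \<in> U" shows "S x (v x) = \<psi> x *\<^sub>R v x"
proof -
  obtain c where c: "S x (v x) = c *\<^sub>R v x" using transnormal[OF assms] by blast
  then have "\<psi> x = c" using Q_pos[OF assms] by (simp add: \<psi>_def ip_linear Q_def)
  then show ?thesis using c by simp
qed

lemma S_u: "x \<in> U \<Longrightarrow> S x (u x) = \<psi> x *\<^sub>R u x"
  by (simp add: u_def holomorphic S_v matrix_vector_mult_scaleR)

lemma u_ip: assumes "x \<in> U"
  shows "ip x (u x) (u x) = Q x" "ip x (u x) (v x) = 0" "ip x (v x) (u x) = 0" "ip x (v x) (v x) = Q x"
  using assms by (auto simp: u_def Q_def J_isometry)

lemma J_u: "x \<in> U \<Longrightarrow> J x *v u x = - v x" by (simp add: u_def J_J)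

lemma J_v: "J x *v v x = u x" by (simp add: u_def)

text \<open>The tangent vectors orthogonal to the complex line of \<open>v\<close>.\<close>

definition H where "H x = {X. ip x X (v x) = 0 \<and> ip x X (u x) = 0}"

lemma H_J: assumes "x \<in> U" "X \<in> H x" shows "J x *v X \<in> H x"
  using assms J_skew[of x X "v x"] J_skew[of x X "u x"] by (auto simp: H_def J_u J_v ip_linear)

lemma H_ip: assumes "x \<in> U" "X \<in> H x"
  shows "ip x X (v x) = 0" "ip x X (u x) = 0" "ip x (v x) X = 0" "ip x (u x) X = 0"
  using assms ip_sym[of x] by (auto simp: H_def)

lemma H_scale: "X \<in> H x \<Longrightarrow> c *\<^sub>R X \<in> H x" by (simp add: H_def ip_linear)

lemma H_unit_exists: assumes "x \<in> U" obtains X where "X \<in> H x" "ip x X X = 1"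
proof -
  have "dim {G x *v v x, G x *v u x} \<le> card {G x *v v x, G x *v u x}" by (intro dim_le_card') auto
  also have "\<dots> \<le> 2" by (simp add: card_insert_if)
  finally have "dim {G x *v v x, G x *v u x} < DIM(real ^ 4)" by simp
  from orthogonal_to_subspace_exists[OF this] obtain X where
    X: "X \<noteq> 0" "\<And>y. y \<in> span {G x *v v x, G x *v u x} \<Longrightarrow> orthogonal X y" by blast
  then have "X \<in> H x" by (auto simp: H_def ip_def orthogonal_def span_base)
  moreover have "ip x X X > 0" using ip_pos assms X by blast
  ultimately show thesis
    using that[of "(1 / sqrt (ip x X X)) *\<^sub>R X"] by (simp add: H_scale ip_linear)
qed

definition frame where
  "frame x X k = (if k = 1 then (1 / sqrt (Q x)) *\<^sub>R v x else if k = 2 then (1 / sqrt (Q x)) *\<^sub>R u x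
     else if k = 3 then X else J x *v X)" for k :: 4

lemma frame_simps [simp]:
  "frame x X 1 = (1 / sqrt (Q x)) *\<^sub>R v x" "frame x X 2 = (1 / sqrt (Q x)) *\<^sub>R u x"
  "frame x X 3 = X" "frame x X 4 = J x *v X"
  by (simp_all add: frame_def)

lemma frame_orthonormal:
  assumes x: "x \<in> U" and X: "X \<in> H x" "ip x X X = 1"
  shows "orthonormal x (frame x X)"
  unfolding orthonormal_def forall_4
  using Q_pos[OF x] H_ip[OF x X(1)] H_ip[OF x H_J[OF x X(1)]] X(2)
  by (simp add: ip_linear u_ip[OF x] x J_isometry[OF x])

text \<open>A symmetric endomorphism commuting with \<open>J\<close> preserves the complement \<open>H\<close> of its eigenspace
  and is a multiple of the identity there, since \<open>SX\<close> is orthogonal to \<open>JX\<close> and \<open>H\<close> is spanned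
  by \<open>X\<close> and \<open>JX\<close>.\<close>

lemma S_H: assumes x: "x \<in> U" and X: "X \<in> H x" "ip x X X = 1" shows "S x X = \<phi> x *\<^sub>R X"
proof -
  define c where "c = ip x (S x X) X"
  note lin = linear_S[OF x]
  have J: "S x (J x *v X) = J x *v S x X" by (rule holomorphic[OF x])
  have 0: "ip x (S x X) (v x) = 0" "ip x (S x X) (u x) = 0" 
    using S_sym[OF x, of X "v x"] S_sym[OF x, of X "u x"] H_ip[OF x X(1)]
    by (auto simp: S_v[OF x] S_u[OF x] ip_linear)
  have "ip x (S x X) (J x *v X) = - ip x (S x X) (J x *v X)"
    using S_sym[OF x, of X "J x *v X"] J J_skew[OF x, of X "S x X"] ip_sym[OF x] by metis
  then have 1: "ip x (S x X) (J x *v X) = 0" by simp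
  have "S x X = (\<Sum>a\<in>UNIV. ip x (S x X) (frame x X a) *\<^sub>R frame x X a)"
    by (rule orthonormal_Ginv(2)[OF x frame_orthonormal[OF x X]])
  also have "\<dots> = c *\<^sub>R X" by (simp add: sum_4 ip_linear 0 1 c_def)
  finally have SX: "S x X = c *\<^sub>R X" .
  have "trace_hessian \<tau> x = 2 * \<psi> x + 2 * c"
    unfolding trace_hessian_frame[OF tau_smooth x frame_orthonormal[OF x X]]
    using Q_pos[OF x] X(2)
    by (simp add: sum_4 linear_cmul[OF lin] S_v[OF x] S_u[OF x] ip_linear u_ip[OF x] J SX
        matrix_vector_mult_scaleR J_isometry[OF x])
  then have "\<phi> x = c" by (simp add: \<phi>_def add_divide_distrib)
  then show ?thesis using SX by simp
qed

text \<open>This form of \<open>S\<close> involves neither projections nor a local frame of \<open>H\<close>, so it can be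
  differentiated covariantly.\<close>

lemma S_eq:
  assumes x: "x \<in> U"
  shows "S x b = \<phi> x *\<^sub>R b + \<mu> x *\<^sub>R (ip x b (v x) *\<^sub>R v x + ip x b (u x) *\<^sub>R u x)"
proof -
  obtain X where X: "X \<in> H x" "ip x X X = 1" using H_unit_exists[OF x] by blast
  note lin = linear_S[OF x] and Q = Q_pos[OF x]
  have SJX: "S x (J x *v X) = \<phi> x *\<^sub>R (J x *v X)"
    by (simp add: holomorphic[OF x] S_H[OF x X] matrix_vector_mult_scaleR)
  define b3 b4 where "b3 = ip x b X" and "b4 = ip x b (J x *v X)"
  have "b = (\<Sum>a\<in>UNIV. ip x b (frame x X a) *\<^sub>R frame x X a)"
    by (rule orthonormal_Ginv(2)[OF x frame_orthonormal[OF x X]])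
  then have b: "b = (ip x b (v x) / Q x) *\<^sub>R v x + (ip x b (u x) / Q x) *\<^sub>R u x
      + b3 *\<^sub>R X + b4 *\<^sub>R (J x *v X)"
    using Q by (simp add: sum_4 ip_linear b3_def b4_def)
  have "S x b = (ip x b (v x) / Q x) *\<^sub>R S x (v x) + (ip x b (u x) / Q x) *\<^sub>R S x (u x)
      + b3 *\<^sub>R S x X + b4 *\<^sub>R S x (J x *v X)"
    by (subst b) (simp only: linear_add[OF lin] linear_cmul[OF lin])
  also have "\<dots> = \<phi> x *\<^sub>R ((ip x b (v x) / Q x) *\<^sub>R v x + (ip x b (u x) / Q x) *\<^sub>R u x
      + b3 *\<^sub>R X + b4 *\<^sub>R (J x *v X)) + \<mu> x *\<^sub>R (ip x b (v x) *\<^sub>R v x + ip x b (u x) *\<^sub>R u x)"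
    using Q by (simp add: S_v[OF x] S_u[OF x] S_H[OF x X] SJX \<mu>_def algebra_simps diff_divide_distrib)
  finally show ?thesis using b by simp
qed

lemma \<psi>_smooth: "smooth_on U \<psi>"
  unfolding \<psi>_def[abs_def]
proof (intro smooth_on_divide open_U Q_smooth)
  show "smooth_on U (\<lambda>x. ip x (S x (v x)) (v x))"
    by (intro smooth_ip smooth_cov_field v_smooth)
qed (rule Q_nonzero)

lemma \<phi>_smooth: "smooth_on U \<phi>"
  unfolding \<phi>_def[abs_def]
  by (intro smooth_on_diff smooth_on_divide open_U smooth_trace_hessian tau_smooth \<psi>_smooth
      smooth_on_const) auto

lemma \<mu>_smooth: "smooth_on U \<mu>"
  unfolding \<mu>_def[abs_def]
  by (intro smooth_on_diff smooth_on_divide open_U \<psi>_smooth \<phi>_smooth Q_smooth) (rule Q_nonzero)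

section \<open>Functions whose differential is proportional to that of the potential\<close>

text \<open>The functions that are locally functions of \<open>\<tau>\<close>, in infinitesimal form.\<close>

definition dep :: "(real ^ 4 \<Rightarrow> real) \<Rightarrow> bool" where
  "dep f \<longleftrightarrow> smooth_on U f \<and> (\<forall>x\<in>U. \<forall>a. D \<tau> a x = 0 \<longrightarrow> D f a x = 0)"

text \<open>The derivative with respect to \<open>\<tau>\<close>: if \<open>dep f\<close>, then \<open>df = f' d\<tau>\<close>.\<close>

definition prime where "prime f x = D f (v x) x / Q x"

lemma dep_D: assumes "dep f" "x \<in> U" shows "D f a x = prime f x * ip x a (v x)"
proof -
  have f: "smooth_on U f" using assms(1) by (simp add: dep_def)
  have lin: "linear (\<lambda>a. D f a x)" by (rule D_linear[OF f assms(2)])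
  let ?a = "a - (ip x a (v x) / Q x) *\<^sub>R v x"
  have "D \<tau> ?a x = 0"
    using Q_pos[OF assms(2)] by (simp add: D_tau[OF assms(2)] ip_linear Q_def)
  then have "D f ?a x = 0" using assms by (simp add: dep_def)
  then show ?thesis by (simp add: linear_diff[OF lin] linear_cmul[OF lin] prime_def)
qed

lemma depI: assumes "smooth_on U f" "\<And>x a. x \<in> U \<Longrightarrow> D f a x = c x * ip x a (v x)"
  shows "dep f" "x \<in> U \<Longrightarrow> prime f x = c x"
proof -
  show "dep f" using assms by (simp add: dep_def D_tau)
  assume x: "x \<in> U"
  then show "prime f x = c x" using Q_pos[OF x] assms(2)[OF x] by (simp add: prime_def Q_def)
qed

lemma prime_smooth: "smooth_on U f \<Longrightarrow> smooth_on U (prime f)"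
  unfolding prime_def[abs_def]
  by (intro smooth_on_divide open_U D_along_smooth v_smooth Q_smooth) (auto simp: Q_nonzero)

text \<open>This is \<open>0 = d(df) = df' \<and> d\<tau>\<close>.\<close>

lemma dep_prime: assumes "dep f" shows "dep (prime f)"
  unfolding dep_def
proof (intro conjI ballI allI impI)
  have f: "smooth_on U f" using assms by (simp add: dep_def)
  show sm: "smooth_on U (prime f)" by (rule prime_smooth[OF f])
  fix x a assume x: "x \<in> U" and a: "D \<tau> a x = 0"
  have "D (D f b) a x = D (prime f) a x * D \<tau> b x + prime f x * D (D \<tau> b) a x" for a b
  proof -
    have "D (D f b) a x = D (\<lambda>x. prime f x * D \<tau> b x) a x"
      by (rule D_cong[OF open_U x]) (simp add: dep_D[OF assms] D_tau)
    then show ?thesis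
      by (simp add: D_mult[OF sm smooth_on_frechet_derivative[OF tau_smooth] x])
  qed
  then have "D (prime f) a x * D \<tau> (v x) x = D (prime f) (v x) x * D \<tau> a x"
    using mixed_derivatives_commute[OF open_U f x, of "v x" a]
      mixed_derivatives_commute[OF open_U tau_smooth x, of "v x" a] by simp
  then have "D (prime f) a x * Q x = 0" using a by (simp add: D_tau[OF x] Q_def)
  then show "D (prime f) a x = 0" using Q_pos[OF x] by simp
qed

lemma dep_const: "dep (\<lambda>_. c)"
  by (simp add: dep_def)

lemma dep_add: "dep f \<Longrightarrow> dep g \<Longrightarrow> dep (\<lambda>x. f x + g x)"
  unfolding dep_def by (auto simp: D_add intro!: smooth_on_add open_U)

lemma dep_diff: "dep f \<Longrightarrow> dep g \<Longrightarrow> dep (\<lambda>x. f x - g x)"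
  unfolding dep_def by (auto simp: D_diff intro!: smooth_on_diff open_U)

lemma dep_mult: "dep f \<Longrightarrow> dep g \<Longrightarrow> dep (\<lambda>x. f x * g x)"
  unfolding dep_def by (auto simp: D_mult intro!: smooth_on_mult open_U)

lemma D_Q: assumes "x \<in> U" shows "D Q a x = 2 * \<psi> x * ip x a (v x)"
proof -
  have "D Q a x = ip x (S x a) (v x) + ip x (v x) (S x a)"
    unfolding Q_def[abs_def] by (rule D_ip[OF assms v_smooth v_smooth])
  also have "\<dots> = 2 * ip x a (S x (v x))" using S_sym[OF assms] ip_sym[OF assms] by simp
  finally show ?thesis by (simp add: S_v[OF assms] ip_linear)
qed

lemma dep_Q: "dep Q" and prime_Q: "x \<in> U \<Longrightarrow> prime Q x = 2 * \<psi> x"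
  using depI[of Q "\<lambda>x. 2 * \<psi> x"] D_Q Q_smooth by auto

text \<open>The function \<open>2\<psi>\<close> is the derivative of \<open>Q\<close> with respect to \<open>\<tau>\<close>.\<close>

lemma dep_\<psi>: "dep \<psi>"
  unfolding dep_def
proof (intro conjI ballI allI impI \<psi>_smooth)
  fix x a assume x: "x \<in> U" and a: "D \<tau> a x = 0"
  have "D (prime Q) a x = D (\<lambda>x. 2 * \<psi> x) a x"
    by (rule D_cong[OF open_U x]) (rule prime_Q)
  then have "D (\<lambda>x. 2 * \<psi> x) a x = 0" using dep_prime[OF dep_Q] x a by (simp add: dep_def)
  then show "D \<psi> a x = 0" by (simp add: D_mult[OF smooth_on_const \<psi>_smooth x])
qed

abbreviation \<psi>1 where "\<psi>1 \<equiv> prime \<psi>"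
abbreviation \<psi>2 where "\<psi>2 \<equiv> prime \<psi>1"

lemma D_\<psi>: "x \<in> U \<Longrightarrow> D \<psi> a x = \<psi>1 x * ip x a (v x)" by (rule dep_D[OF dep_\<psi>])

lemma D_\<mu>:
  assumes x: "x \<in> U"
  shows "Q x * D \<mu> a x = D \<psi> a x - D \<phi> a x - 2 * \<psi> x * \<mu> x * ip x a (v x)"
proof -
  have "D (\<lambda>x. Q x * \<mu> x) a x = D (\<lambda>x. \<psi> x - \<phi> x) a x"
    by (rule D_cong[OF open_U x]) (use Q_pos in \<open>force simp: \<mu>_def\<close>)
  then show ?thesis
    by (simp add: D_mult[OF Q_smooth \<mu>_smooth x] D_diff[OF \<psi>_smooth \<phi>_smooth x] D_Q[OF x] algebra_simps)
qed

section \<open>The curvature in the direction of the gradient\<close>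

text \<open>The Ricci identity for \<open>v\<close> with \<open>\<nabla>v = S\<close> in the form \<open>S_eq\<close>. The Christoffel terms and the
  terms \<open>g(b, Sa)\<close> are symmetric in \<open>a\<close> and \<open>b\<close> and drop out.\<close>

lemma curv_v:
  assumes x: "x \<in> U"
  shows "curv a b x *v v x = D \<phi> a x *\<^sub>R b - D \<phi> b x *\<^sub>R a
    + (D \<mu> a x * ip x b (v x) - D \<mu> b x * ip x a (v x)) *\<^sub>R v x
    + (D \<mu> a x * ip x b (u x) - D \<mu> b x * ip x a (u x)) *\<^sub>R u x
    + \<mu> x *\<^sub>R (ip x b (v x) *\<^sub>R S x a - ip x a (v x) *\<^sub>R S x b
      + (ip x b (J x *v S x a) - ip x a (J x *v S x b)) *\<^sub>R u x
      + ip x b (u x) *\<^sub>R (J x *v S x a) - ip x a (u x) *\<^sub>R (J x *v S x b))"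
proof -
  have c: "smooth_on U (\<lambda>_. b)" for b :: "real ^ 4" by auto
  have cu: "cov u a x = J x *v S x a" for a
    unfolding u_def[abs_def] by (rule cov_J[OF v_smooth x])
  have "cov (cov v b) a x = D \<phi> a x *\<^sub>R b + \<phi> x *\<^sub>R (Gam a x *v b)
     + D \<mu> a x *\<^sub>R (ip x b (v x) *\<^sub>R v x + ip x b (u x) *\<^sub>R u x)
     + \<mu> x *\<^sub>R ((ip x (Gam a x *v b) (v x) + ip x b (S x a)) *\<^sub>R v x + ip x b (v x) *\<^sub>R S x a
        + ((ip x (Gam a x *v b) (u x) + ip x b (J x *v S x a)) *\<^sub>R u x + ip x b (u x) *\<^sub>R (J x *v S x a)))"
    for a b
  proof -
    note sb = smooth_ip[OF c v_smooth, of b] smooth_ip[OF c u_smooth, of b]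
    note sm = smooth_on_scaleR[OF open_U sb(1) v_smooth] smooth_on_scaleR[OF open_U sb(2) u_smooth]
    note sm2 = smooth_on_add[OF open_U sm]
    have "cov (cov v b) a x = cov (\<lambda>x. \<phi> x *\<^sub>R b
       + \<mu> x *\<^sub>R (ip x b (v x) *\<^sub>R v x + ip x b (u x) *\<^sub>R u x)) a x"
      by (rule cov_cong[OF x]) (rule S_eq)
    also have "\<dots> = cov (\<lambda>x. \<phi> x *\<^sub>R b) a x
       + cov (\<lambda>x. \<mu> x *\<^sub>R (ip x b (v x) *\<^sub>R v x + ip x b (u x) *\<^sub>R u x)) a x"
      by (intro cov_add smooth_on_scaleR open_U \<phi>_smooth \<mu>_smooth c sm2 x)
    also have "cov (\<lambda>x. \<phi> x *\<^sub>R b) a x = D \<phi> a x *\<^sub>R b + \<phi> x *\<^sub>R (Gam a x *v b)"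
      by (simp add: cov_scaleR[OF \<phi>_smooth c x] cov_const)
    also have "cov (\<lambda>x. \<mu> x *\<^sub>R (ip x b (v x) *\<^sub>R v x + ip x b (u x) *\<^sub>R u x)) a x
      = D \<mu> a x *\<^sub>R (ip x b (v x) *\<^sub>R v x + ip x b (u x) *\<^sub>R u x)
       + \<mu> x *\<^sub>R (cov (\<lambda>x. ip x b (v x) *\<^sub>R v x) a x + cov (\<lambda>x. ip x b (u x) *\<^sub>R u x) a x)"
      by (simp add: cov_scaleR[OF \<mu>_smooth sm2 x] cov_add[OF sm x])
    also have "cov (\<lambda>x. ip x b (v x) *\<^sub>R v x) a x
       = (ip x (Gam a x *v b) (v x) + ip x b (S x a)) *\<^sub>R v x + ip x b (v x) *\<^sub>R S x a"
      by (simp add: cov_scaleR[OF sb(1) v_smooth x] D_ip[OF x c v_smooth] cov_const)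
    also have "cov (\<lambda>x. ip x b (u x) *\<^sub>R u x) a x
       = (ip x (Gam a x *v b) (u x) + ip x b (J x *v S x a)) *\<^sub>R u x + ip x b (u x) *\<^sub>R (J x *v S x a)"
      by (simp add: cov_scaleR[OF sb(2) u_smooth x] D_ip[OF x c u_smooth] cov_const cu)
    finally show ?thesis by (simp add: add.assoc)
  qed
  moreover have "ip x b (S x a) = ip x a (S x b)" using S_sym[OF x] ip_sym[OF x] by metis
  ultimately show ?thesis
    using ricci_identity[OF v_smooth x, of b a] Gam_sym[OF x, of a b]
    by (simp add: algebra_simps)
qed

end

context holomorphic_transnormal_chart
begin

lemma \<mu>_Q: "x \<in> U \<Longrightarrow> \<mu> x * Q x = \<psi> x - \<phi> x"
  using Q_nonzero by (simp add: \<mu>_def)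

lemma D_\<mu>_H: assumes "x \<in> U" "X \<in> H x" shows "D \<mu> X x * Q x = - D \<phi> X x"
  using D_\<mu>[OF assms(1), of X] by (simp add: D_\<psi>[OF assms(1)] H_ip[OF assms] mult.commute)

lemma curv_v_X_v:
  assumes x: "x \<in> U" and X: "X \<in> H x" "ip x X X = 1"
  shows "curv (v x) X x *v v x = (D \<phi> (v x) x - \<beta> x) *\<^sub>R X"
proof -
  have "curv (v x) X x *v v x = D \<phi> (v x) x *\<^sub>R X - (D \<phi> X x + D \<mu> X x * Q x) *\<^sub>R v x
      - (\<mu> x * Q x * \<phi> x) *\<^sub>R X"
    unfolding curv_v[OF x]
    by (simp add: S_v[OF x] S_H[OF x X] H_ip[OF x X(1)] H_ip[OF x H_J[OF x X(1)]] u_ip[OF x] J_v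
        matrix_vector_mult_scaleR ip_linear algebra_simps)
  moreover have "D \<phi> X x + D \<mu> X x * Q x = 0" "\<mu> x * Q x * \<phi> x = \<beta> x"
    by (simp_all add: D_\<mu>_H[OF x X(1)] \<mu>_Q[OF x] \<beta>_def)
  ultimately show ?thesis by (simp add: scaleR_diff_left)
qed

lemma curv_u_X_v:
  assumes x: "x \<in> U" and X: "X \<in> H x" "ip x X X = 1"
  shows "curv (u x) X x *v v x = D \<phi> (u x) x *\<^sub>R X - \<beta> x *\<^sub>R (J x *v X)"
proof -
  have "curv (u x) X x *v v x = D \<phi> (u x) x *\<^sub>R X - (D \<phi> X x + D \<mu> X x * Q x) *\<^sub>R u x
      - (\<mu> x * Q x * \<phi> x) *\<^sub>R (J x *v X)"
    unfolding curv_v[OF x]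
    by (simp add: S_u[OF x] S_H[OF x X] H_ip[OF x X(1)] H_ip[OF x H_J[OF x X(1)]] u_ip[OF x] J_u[OF x]
        matrix_vector_mult_scaleR ip_linear algebra_simps)
  moreover have "D \<phi> X x + D \<mu> X x * Q x = 0" "\<mu> x * Q x * \<phi> x = \<beta> x"
    by (simp_all add: D_\<mu>_H[OF x X(1)] \<mu>_Q[OF x] \<beta>_def)
  ultimately show ?thesis by (simp add: scaleR_diff_left)
qed

text \<open>Invariance of the curvature under \<open>J\<close> gives \<open>R(u,X)v = -R(v,JX)v\<close>. Comparison of the two
  expressions \<open>curv_u_X_v\<close> and \<open>curv_v_X_v\<close> for this vector yields both equations.\<close>

lemma D_\<phi>_V:
  assumes x: "x \<in> U"
  shows "D \<phi> (u x) x = 0" "D \<phi> (v x) x = 2 * \<beta> x"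
proof -
  obtain X where X: "X \<in> H x" "ip x X X = 1" using H_unit_exists[OF x] by blast
  let ?Y = "- (J x *v X)"
  have Y: "?Y \<in> H x" "ip x ?Y ?Y = 1" and JY: "J x *v ?Y = X"
    using H_scale[OF H_J[OF x X(1)], of "-1"] X(2) 
    by (simp_all add: ip_linear J_isometry[OF x] J_J[OF x] linear_neg[OF matrix_vector_mul_linear])
  have "curv (u x) X x *v v x = (D \<phi> (v x) x - \<beta> x) *\<^sub>R ?Y"
    using curv_J_J[OF x, of "v x" ?Y "v x"] curv_v_X_v[OF x Y] by (simp only: JY J_v)
  then have "D \<phi> (u x) x *\<^sub>R X - \<beta> x *\<^sub>R (J x *v X) = (D \<phi> (v x) x - \<beta> x) *\<^sub>R ?Y"
    unfolding curv_u_X_v[OF x X] .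
  then have eq: "ip x (D \<phi> (u x) x *\<^sub>R X - \<beta> x *\<^sub>R (J x *v X)) Z
      = ip x ((D \<phi> (v x) x - \<beta> x) *\<^sub>R ?Y) Z" for Z
    by simp
  show "D \<phi> (u x) x = 0" using eq[of X] X(2) x by (simp add: ip_linear)
  show "D \<phi> (v x) x = 2 * \<beta> x"
    using eq[of "J x *v X"] X(2) x by (simp add: ip_linear J_isometry)
qed

lemma curv_v_u_v:
  assumes x: "x \<in> U"
  shows "curv (v x) (u x) x *v v x = (\<psi>1 x * Q x) *\<^sub>R u x"
proof -
  have "Q x * D \<mu> (u x) x = 0"
    using D_\<mu>[OF x, of "u x"] by (simp add: D_\<psi>[OF x] u_ip[OF x] D_\<phi>_V[OF x])
  then have \<mu>u: "D \<mu> (u x) x = 0" using Q_nonzero[OF x] by simp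
  have "curv (v x) (u x) x *v v x
      = (D \<phi> (v x) x + Q x * D \<mu> (v x) x + 2 * \<psi> x * \<mu> x * Q x) *\<^sub>R u x"
    unfolding curv_v[OF x]
    by (simp add: S_v[OF x] S_u[OF x] u_ip[OF x] J_u[OF x] J_v \<mu>u D_\<phi>_V(1)[OF x]
        matrix_vector_mult_scaleR ip_linear algebra_simps)
  then show ?thesis
    using D_\<mu>[OF x, of "v x"] by (simp add: D_\<psi>[OF x] u_ip[OF x])
qed

lemma curv_X_JX_v:
  assumes x: "x \<in> U" and X: "X \<in> H x" "ip x X X = 1"
  shows "curv X (J x *v X) x *v v x = D \<phi> X x *\<^sub>R (J x *v X) - D \<phi> (J x *v X) x *\<^sub>R X
    + (2 * \<mu> x * \<phi> x) *\<^sub>R u x"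
proof -
  have SJX: "S x (J x *v X) = \<phi> x *\<^sub>R (J x *v X)"
    by (simp add: holomorphic[OF x] S_H[OF x X] matrix_vector_mult_scaleR)
  show ?thesis
    unfolding curv_v[OF x]
    by (simp add: SJX S_H[OF x X] H_ip[OF x X(1)] H_ip[OF x H_J[OF x X(1)]] J_J[OF x] J_isometry[OF x] X(2)
        matrix_vector_mult_scaleR ip_linear algebra_simps)
qed

section \<open>The weakly Einstein condition\<close>

text \<open>The defining expression is smooth and easy to differentiate; its geometric meaning is
  \<open>K = Q g(h,h)\<close>, where \<open>h\<close> is the component of \<open>\<nabla>\<phi>\<close> in \<open>H\<close> (lemma \<open>K_h\<close>).\<close>

definition K where "K x = Q x * ip x (grad \<phi> x) (grad \<phi> x) - 4 * (\<beta> x)\<^sup>2"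

definition h where "h x = grad \<phi> x - (2 * \<beta> x / Q x) *\<^sub>R v x"

lemma D_\<phi>: "x \<in> U \<Longrightarrow> D \<phi> a x = ip x (grad \<phi> x) a"
  by (simp add: ip_grad[OF \<phi>_smooth])

lemma h_H: assumes x: "x \<in> U" shows "h x \<in> H x"
  using D_\<phi>_V[OF x] Q_nonzero[OF x]
  by (simp add: h_def H_def ip_linear u_ip[OF x] D_\<phi>[OF x])

lemma D_\<phi>_h: assumes x: "x \<in> U" and X: "X \<in> H x" shows "D \<phi> X x = ip x (h x) X"
  by (simp add: h_def D_\<phi>[OF x] ip_linear H_ip[OF assms])

lemma K_h: assumes x: "x \<in> U" shows "K x = Q x * ip x (h x) (h x)"
proof -
  have "ip x (h x) (h x) = ip x (grad \<phi> x) (h x)"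
    using D_\<phi>_h[OF x h_H[OF x]] D_\<phi>[OF x] by simp
  also have "\<dots> = ip x (grad \<phi> x) (grad \<phi> x) - (2 * \<beta> x / Q x) * (2 * \<beta> x)"
    using D_\<phi>_V(2)[OF x] by (simp add: h_def ip_linear D_\<phi>[OF x])
  finally show ?thesis using Q_nonzero[OF x] by (simp add: K_def field_simps power2_eq_square)
qed

text \<open>The frame is adapted to \<open>h\<close>: with \<open>X = h/|h|\<close> one has \<open>d\<phi>(JX) = 0\<close>, so that only one
  component of type \<open>R(X,JX,v,\<cdot>)\<close> remains besides the one along \<open>u\<close>. It is a nonzero multiple
  of \<open>|h|\<close>.\<close>

lemma K_algebraic:
  assumes x: "x \<in> U" and we: "\<And>i j. contraction i j x = \<kappa> * G x $ i $ j" and K: "K x \<noteq> 0"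
  shows "K x = (Q x)\<^sup>2 * (\<psi>1 x)\<^sup>2 / 2 - 8 * (\<beta> x)\<^sup>2"
proof -
  note Q = Q_pos[OF x]
  have "h x \<noteq> 0" using K by (auto simp: K_h[OF x] ip_linear)
  then have hh: "ip x (h x) (h x) > 0" by (rule ip_pos[OF x])
  define X where "X = (1 / sqrt (ip x (h x) (h x))) *\<^sub>R h x"
  have X: "X \<in> H x" "ip x X X = 1" and \<phi>X: "D \<phi> X x = sqrt (ip x (h x) (h x))"
    and \<phi>JX: "D \<phi> (J x *v X) x = 0"
  proof -
    show X: "X \<in> H x" by (simp add: X_def H_scale h_H[OF x])
    show "ip x X X = 1" using hh by (simp add: X_def ip_linear)
    show "D \<phi> X x = sqrt (ip x (h x) (h x))"
      unfolding D_\<phi>_h[OF x X] using hh by (simp add: X_def ip_linear real_div_sqrt)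
    show "D \<phi> (J x *v X) x = 0"
      unfolding D_\<phi>_h[OF x H_J[OF x X]] using x
      by (simp add: X_def ip_linear matrix_vector_mult_scaleR)
  qed
  define e where "e = frame x X"
  have e: "orthonormal x e" unfolding e_def by (rule frame_orthonormal[OF x X])
  define s where "s = 1 / sqrt (Q x)"
  have s: "s * s * Q x = 1" using Q by (simp add: s_def)
  have es: "e 1 = s *\<^sub>R v x" "e 2 = s *\<^sub>R u x" "e 3 = X" "e 4 = J x *v X"
    by (simp_all add: e_def s_def)
  let ?r = "\<lambda>a b c d. Rm x (e a) (e b) (e c) (e d)"
  have J12: "J x *v e 1 = e 2" and J34: "J x *v e 3 = e 4" and J4: "J x *v e 4 = - e 3"
    by (simp_all add: es J_v matrix_vector_mult_scaleR J_J[OF x])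
  have X': "J x *v X \<in> H x" "ip x (J x *v X) (J x *v X) = 1"
    using X by (simp_all add: H_J[OF x] J_isometry[OF x])
  note R_lin = linear_cmul[OF Rm_linear(1)[OF x]] linear_cmul[OF Rm_linear(2)[OF x]]
    linear_cmul[OF Rm_linear(3)[OF x]] linear_cmul[OF Rm_linear(4)[OF x]]
  note ips = H_ip[OF x X(1)] H_ip[OF x X'(1)] u_ip[OF x] X(2) X'(2)
  have R1: "Rm x (v x) (u x) (v x) d = \<psi>1 x * Q x * ip x (u x) d"
    "Rm x (v x) X (v x) d = \<beta> x * ip x X d"
    "Rm x (v x) (J x *v X) (v x) d = \<beta> x * ip x (J x *v X) d"
    "Rm x X (J x *v X) (v x) d = D \<phi> X x * ip x (J x *v X) d + 2 * \<mu> x * \<phi> x * ip x (u x) d" for d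
    unfolding Rm_def curv_v_u_v[OF x] curv_v_X_v[OF x X] curv_v_X_v[OF x X'] curv_X_JX_v[OF x X]
    by (simp_all add: ip_linear D_\<phi>_V[OF x] \<phi>JX)
  have "(\<psi>1 x)\<^sup>2 = 16 * (\<beta> x / Q x)\<^sup>2 + 2 * (s * D \<phi> X x)\<^sup>2"
  proof (rule weakly_einstein_components[where r = ?r])
    show "?r a b c d = - ?r b a c d" "?r a b c d = - ?r a b d c" for a b c d
      by (rule Rm_antisym[OF x])+
    show "?r a b c d = ?r c d a b" for a b c d by (rule Rm_pair_sym[OF x])
    show "?r a b 2 4 = ?r a b 1 3" for a b
      using Rm_J[OF x, of "e a" "e b" "e 1" "e 3"] by (simp only: J12 J34)
    show "?r a b 2 3 = - ?r a b 1 4" for a b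
      using Rm_J[OF x, of "e a" "e b" "e 1" "e 4"] linear_neg[OF Rm_linear(4)[OF x]]
      by (simp only: J12 J4)
    have 4: "s * s * Q x * t = t" for t using s by simp
    show "?r 1 2 1 2 = \<psi>1 x"
    proof -
      have "?r 1 2 1 2 = (s * s * Q x) * ((s * s * Q x) * \<psi>1 x)"
        by (simp add: es R_lin R1 ips ip_linear)
      then show ?thesis by (simp only: 4)
    qed
    show "?r 1 3 1 3 = \<beta> x / Q x" "?r 1 4 1 4 = \<beta> x / Q x"
      using Q by (simp_all add: es R_lin R1 ips ip_linear s_def)
    show "?r 1 2 1 3 = 0" "?r 1 2 1 4 = 0" "?r 1 3 1 4 = 0" "?r 3 4 1 3 = 0"
      using x by (simp_all add: es R_lin R1 ips ip_linear)
    show "?r 3 4 1 4 = s * D \<phi> X x"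
      by (simp add: es R_lin R1 ips ip_linear)
    show "?r 3 4 1 2 = 2 * (\<beta> x / Q x)"
    proof -
      have "?r 3 4 1 2 = (s * s * Q x) * (2 * \<mu> x * \<phi> x)"
        by (simp add: es R_lin R1 ips ip_linear)
      then show ?thesis by (simp only: 4) (simp add: \<mu>_def \<beta>_def)
    qed
    show "s * D \<phi> X x \<noteq> 0" using hh Q by (simp add: \<phi>X s_def)
    show "(\<Sum>k\<in>UNIV. \<Sum>p\<in>UNIV. \<Sum>q\<in>UNIV. ?r a k p q * ?r b k p q) = (if a = b then \<kappa> else 0)" for a b
      using weakly_einstein_frame[OF x e we, of "e a" "e b"] e by (simp add: orthonormal_def)
  qed
  moreover have "(s * D \<phi> X x)\<^sup>2 = ip x (h x) (h x) / Q x"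
    using hh Q by (simp add: \<phi>X s_def power_mult_distrib power_divide)
  ultimately show ?thesis
    using Q by (simp add: K_h[OF x] field_simps power2_eq_square)
qed

section \<open>The derivative along the gradient\<close>

lemma \<beta>_smooth: "smooth_on U \<beta>"
  unfolding \<beta>_def[abs_def] by (intro smooth_on_mult smooth_on_diff open_U \<phi>_smooth \<psi>_smooth)

lemma D_\<beta>: assumes x: "x \<in> U"
  shows "D \<beta> a x = D \<phi> a x * (\<psi> x - 2 * \<phi> x) + \<phi> x * \<psi>1 x * ip x a (v x)"
proof -
  have "D \<beta> a x = \<phi> x * (D \<psi> a x - D \<phi> a x) + D \<phi> a x * (\<psi> x - \<phi> x)"
    unfolding \<beta>_def[abs_def]
    by (simp only: D_mult[OF \<phi>_smooth smooth_on_diff[OF open_U \<psi>_smooth \<phi>_smooth] x]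
        D_diff[OF \<psi>_smooth \<phi>_smooth x])
  then show ?thesis by (simp add: D_\<psi>[OF x] algebra_simps)
qed

lemma K_smooth: "smooth_on U K"
  unfolding K_def[abs_def] power2_eq_square
  by (intro smooth_on_diff smooth_on_mult smooth_on_const open_U Q_smooth \<beta>_smooth smooth_ip
      smooth_grad \<phi>_smooth)

text \<open>Differentiating \<open>d\<phi>(v) = 2\<beta>\<close>, where \<open>\<beta>\<close> is a function of \<open>\<phi>\<close> and \<open>\<tau>\<close>, in directions
  of \<open>H\<close> shows that \<open>d\<phi>\<close> restricted to \<open>H\<close> satisfies a linear differential equation along the
  flow of \<open>v\<close>, and hence so does its squared norm. The symmetry of the Hessian of \<open>\<phi>\<close> replaces
  the flow in the computation.\<close>

lemma D_K_v: assumes x: "x \<in> U"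
  shows "D K (v x) x = (6 * \<psi> x - 10 * \<phi> x) * K x"
proof -
  let ?n = "grad \<phi>"
  have n: "smooth_on U ?n" by (rule smooth_grad[OF \<phi>_smooth])
  define nn where "nn = ip x (?n x) (?n x)"
  have nv: "ip x (?n x) (v x) = 2 * \<beta> x" "ip x (v x) (?n x) = 2 * \<beta> x"
    using D_\<phi>_V(2)[OF x] ip_sym[OF x] by (simp_all add: D_\<phi>[OF x])
  have nu: "ip x (?n x) (u x) = 0" using D_\<phi>_V(1)[OF x] by (simp add: D_\<phi>[OF x])
  have "D (\<lambda>y. ip y (?n y) (v y)) (?n x) x = D (\<lambda>y. 2 * \<beta> y) (?n x) x"
    by (rule D_cong[OF open_U x]) (metis D_\<phi> D_\<phi>_V(2))
  then have "ip x (cov ?n (?n x) x) (v x) + ip x (?n x) (S x (?n x)) = 2 * D \<beta> (?n x) x"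
    by (simp add: D_ip[OF x n v_smooth] D_mult[OF smooth_on_const \<beta>_smooth x])
  moreover have "ip x (cov ?n (v x) x) (?n x) = ip x (cov ?n (?n x) x) (v x)"
    using hessian_sym[OF \<phi>_smooth x, of "v x" "?n x"] ip_sym[OF x] by metis
  moreover have "ip x (?n x) (S x (?n x)) = \<phi> x * nn + \<mu> x * (4 * (\<beta> x)\<^sup>2)"
    unfolding S_eq[OF x, of "?n x"] by (simp add: ip_linear nv nu nn_def power2_eq_square)
  moreover have "D \<beta> (?n x) x = nn * (\<psi> x - 2 * \<phi> x) + 2 * \<phi> x * \<psi>1 x * \<beta> x"
    by (simp add: D_\<beta>[OF x] D_\<phi>[OF x] nv nn_def)
  ultimately have Hnn: "ip x (cov ?n (v x) x) (?n x)
      = 2 * (nn * (\<psi> x - 2 * \<phi> x) + 2 * \<phi> x * \<psi>1 x * \<beta> x) - (\<phi> x * nn + \<mu> x * (4 * (\<beta> x)\<^sup>2))"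
    by simp
  have "D (\<lambda>y. ip y (?n y) (?n y)) (v x) x = 2 * ip x (cov ?n (v x) x) (?n x)"
    by (simp add: D_ip[OF x n n] ip_sym[OF x, of "?n x"])
  then have "D K (v x) x = 2 * Q x * ip x (cov ?n (v x) x) (?n x) + 2 * \<psi> x * Q x * nn
      - 8 * \<beta> x * D \<beta> (v x) x"
    unfolding K_def[abs_def] power2_eq_square
    by (simp add: D_diff[OF smooth_on_mult[OF open_U Q_smooth smooth_ip[OF n n]]
          smooth_on_mult[OF open_U smooth_on_const smooth_on_mult[OF open_U \<beta>_smooth \<beta>_smooth]] x]
        D_mult[OF Q_smooth smooth_ip[OF n n] x]
        D_mult[OF smooth_on_const smooth_on_mult[OF open_U \<beta>_smooth \<beta>_smooth] x]
        D_mult[OF \<beta>_smooth \<beta>_smooth x] D_Q[OF x] u_ip[OF x] nn_def algebra_simps)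
  moreover have "D \<beta> (v x) x = 2 * \<beta> x * (\<psi> x - 2 * \<phi> x) + \<phi> x * \<psi>1 x * Q x"
    by (simp add: D_\<beta>[OF x] D_\<phi>_V[OF x] u_ip[OF x])
  moreover have "Q x * \<mu> x = \<psi> x - \<phi> x" using \<mu>_Q[OF x] by (simp add: mult.commute)
  moreover have "K x = Q x * nn - 4 * (\<beta> x)\<^sup>2" by (simp add: K_def nn_def)
  ultimately show ?thesis unfolding Hnn by algebra
qed

text \<open>The degree five polynomial in \<open>\<phi>\<close> obtained by differentiating the algebraic
  expression for \<open>K\<close> along \<open>v\<close> and comparing with \<open>D_K_v\<close>. Its coefficients are functions of
  \<open>\<tau>\<close> and its leading coefficient is a nonzero constant.\<close>

definition coeff_fun :: "nat \<Rightarrow> real ^ 4 \<Rightarrow> real" where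
  "coeff_fun k = (if k = 0 then (\<lambda>x. Q x * Q x * Q x * \<psi>1 x * \<psi>2 x - \<psi> x * Q x * Q x * \<psi>1 x * \<psi>1 x)
    else if k = 1 then (\<lambda>x. 5 * Q x * Q x * \<psi>1 x * \<psi>1 x)
    else if k = 2 then (\<lambda>x. 16 * \<psi> x * \<psi> x * \<psi> x - 16 * \<psi>1 x * Q x * \<psi> x)
    else if k = 3 then (\<lambda>x. 16 * \<psi>1 x * Q x - 48 * \<psi> x * \<psi> x)
    else if k = 4 then (\<lambda>x. 48 * \<psi> x)
    else (\<lambda>x. - 16))"

lemma dep_coeff: "dep (coeff_fun k)"
  unfolding coeff_fun_def
  by (simp split del: if_split split: if_split)
    (intro conjI impI dep_diff dep_mult dep_const dep_Q dep_\<psi> dep_prime)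

lemma polynomial_relation:
  assumes x: "x \<in> V" and V: "open V" "V \<subseteq> U"
    and eq: "\<And>y. y \<in> V \<Longrightarrow> K y = (Q y)\<^sup>2 * (\<psi>1 y)\<^sup>2 / 2 - 8 * (\<beta> y)\<^sup>2"
  shows "(\<Sum>k\<le>5. coeff_fun k x * \<phi> x ^ k) = 0"
proof -
  have U: "x \<in> U" using x V by blast
  note sm = smooth_on_mult[OF open_U]
  have s1: "smooth_on U \<psi>1" by (rule prime_smooth[OF \<psi>_smooth])
  have D1: "D \<psi>1 (v x) x = \<psi>2 x * Q x" using dep_D[OF dep_prime[OF dep_\<psi>] U] by (simp add: u_ip[OF U])
  have "D K (v x) x = D (\<lambda>y. (Q y * Q y) * (\<psi>1 y * \<psi>1 y) * (1/2) - 8 * (\<beta> y * \<beta> y)) (v x) x"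
    by (rule D_cong[OF V(1) x]) (simp add: eq power2_eq_square)
  also have "\<dots> = Q x * D Q (v x) x * (\<psi>1 x)\<^sup>2 + (Q x)\<^sup>2 * \<psi>1 x * D \<psi>1 (v x) x - 16 * \<beta> x * D \<beta> (v x) x"
    by (simp only: D_diff[OF sm[OF sm[OF sm[OF Q_smooth Q_smooth] sm[OF s1 s1]] smooth_on_const]
          sm[OF smooth_on_const sm[OF \<beta>_smooth \<beta>_smooth]] U]
        D_mult[OF sm[OF sm[OF Q_smooth Q_smooth] sm[OF s1 s1]] smooth_on_const U]
        D_mult[OF sm[OF Q_smooth Q_smooth] sm[OF s1 s1] U]
        D_mult[OF Q_smooth Q_smooth U] D_mult[OF s1 s1 U]
        D_mult[OF smooth_on_const sm[OF \<beta>_smooth \<beta>_smooth] U] D_mult[OF \<beta>_smooth \<beta>_smooth U]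
        D_const) (simp add: algebra_simps power2_eq_square)
  finally have DK: "D K (v x) x
    = Q x * D Q (v x) x * (\<psi>1 x)\<^sup>2 + (Q x)\<^sup>2 * \<psi>1 x * D \<psi>1 (v x) x - 16 * \<beta> x * D \<beta> (v x) x" .
  have "D \<beta> (v x) x = 2 * \<beta> x * (\<psi> x - 2 * \<phi> x) + \<phi> x * \<psi>1 x * Q x"
    by (simp add: D_\<beta>[OF U] D_\<phi>_V[OF U] u_ip[OF U])
  moreover have "D Q (v x) x = 2 * \<psi> x * Q x" by (simp add: D_Q[OF U] u_ip[OF U])
  ultimately have rel: "2 * \<psi> x * (Q x)\<^sup>2 * (\<psi>1 x)\<^sup>2 + (Q x)^3 * \<psi>1 x * \<psi>2 x
      - 16 * \<beta> x * (2 * \<beta> x * (\<psi> x - 2 * \<phi> x) + \<phi> x * \<psi>1 x * Q x)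
    = (6 * \<psi> x - 10 * \<phi> x) * ((Q x)\<^sup>2 * (\<psi>1 x)\<^sup>2 / 2 - 8 * (\<beta> x)\<^sup>2)"
    using DK D_K_v[OF U] eq[OF x] D1 by (simp add: power2_eq_square power3_eq_cube ac_simps)
  have "(\<Sum>k\<le>5. coeff_fun k x * \<phi> x ^ k) = coeff_fun 0 x + coeff_fun 1 x * \<phi> x + coeff_fun 2 x * \<phi> x ^ 2
     + coeff_fun 3 x * \<phi> x ^ 3 + coeff_fun 4 x * \<phi> x ^ 4 + coeff_fun 5 x * \<phi> x ^ 5"
    by (simp add: eval_nat_numeral)
  also have "\<dots> = 2 * \<psi> x * (Q x)\<^sup>2 * (\<psi>1 x)\<^sup>2 + (Q x)^3 * \<psi>1 x * \<psi>2 x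
      - 16 * \<beta> x * (2 * \<beta> x * (\<psi> x - 2 * \<phi> x) + \<phi> x * \<psi>1 x * Q x)
    - (6 * \<psi> x - 10 * \<phi> x) * ((Q x)\<^sup>2 * (\<psi>1 x)\<^sup>2 / 2 - 8 * (\<beta> x)\<^sup>2)"
    by (simp add: coeff_fun_def \<beta>_def) algebra
  finally show ?thesis using rel by simp
qed

text \<open>Where \<open>K \<noteq> 0\<close>, the field \<open>h\<close> is tangent to the level sets of \<open>\<tau>\<close>, so it annihilates the
  coefficients of the polynomial relation, while \<open>d\<phi>(h) = g(h,h) \<noteq> 0\<close>.\<close>

lemma weakly_einstein_imp_K_zero:
  assumes we: "\<And>x. x \<in> U \<Longrightarrow> \<exists>\<kappa>. \<forall>i j. contraction i j x = \<kappa> * G x $ i $ j" and x: "x \<in> U"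
  shows "K x = 0"
proof (rule ccontr)
  assume "K x \<noteq> 0"
  define V where "V = {x \<in> U. K x \<noteq> 0}"
  have V: "open V" "V \<subseteq> U" "x \<in> V"
    using open_nonzero_subset[OF open_U smooth_on_continuous[OF K_smooth]] x \<open>K x \<noteq> 0\<close>
    by (auto simp: V_def)
  have eq: "K y = (Q y)\<^sup>2 * (\<psi>1 y)\<^sup>2 / 2 - 8 * (\<beta> y)\<^sup>2" if "y \<in> V" for y
  proof -
    have y: "y \<in> U" "K y \<noteq> 0" using that by (auto simp: V_def)
    obtain \<kappa> where "\<forall>i j. contraction i j y = \<kappa> * G y $ i $ j" using we[OF y(1)] by blast
    then show ?thesis using K_algebraic[OF y(1) _ y(2)] by blast
  qed
  have "coeff_fun 5 x = 0"
  proof (rule leading_coefficient_zero[OF V(1), where f = \<phi> and X = h])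
    show "smooth_on V \<phi>" by (rule smooth_on_subset[OF \<phi>_smooth V(2)])
    show "smooth_on V (coeff_fun k)" for k
      using dep_coeff smooth_on_subset[OF _ V(2)] by (auto simp: dep_def)
    show "D \<phi> (h y) y \<noteq> 0" if "y \<in> V" for y
      using that V(2) D_\<phi>_h[OF _ h_H, of y] K_h[of y] by (auto simp: V_def)
    show "D (coeff_fun k) (h y) y = 0" if "y \<in> V" for k y
      using that V(2) dep_D[OF dep_coeff, of y k "h y"] H_ip[OF _ h_H, of y] by auto
    show "(\<Sum>k\<le>5. coeff_fun k y * \<phi> y ^ k) = 0" if "y \<in> V" for y
      using polynomial_relation[OF that V(1,2) eq] .
  qed (rule V)
  then show False by (simp add: coeff_fun_def)
qed

lemma weakly_einstein_imp_dep:
  assumes we: "\<And>x. x \<in> U \<Longrightarrow> \<exists>\<kappa>. \<forall>i j. contraction i j x = \<kappa> * G x $ i $ j"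
  shows "dep (trace_hessian \<tau>)"
proof -
  have "dep \<phi>"
    unfolding dep_def
  proof (intro conjI ballI allI impI \<phi>_smooth)
    fix x a assume x: "x \<in> U" and a: "D \<tau> a x = 0"
    have "ip x (h x) (h x) = 0"
      using weakly_einstein_imp_K_zero[OF we x] K_h[OF x] Q_nonzero[OF x] by simp
    then have "h x = 0" using ip_pos[OF x, of "h x"] by force
    then show "D \<phi> a x = 0"
      using a ip_sym[OF x, of a] by (simp add: h_def D_\<phi>[OF x] D_tau[OF x] ip_linear)
  qed
  then have "dep (\<lambda>x. 2 * \<psi> x + 2 * \<phi> x)" by (intro dep_add dep_mult dep_const dep_\<psi>)
  then show ?thesis by (simp add: \<phi>_def add_divide_distrib[symmetric])
qed

end

section \<open>Transfer from the manifold to a coordinate domain\<close>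

context smooth_manifold
begin

lemma chart_topspace: "c \<in> A \<Longrightarrow> topspace (subtopology M (fst c)) = fst c"
  using openin_subset[OF chart_domain, of c] by (simp add: Int_absorb1)

lemma chart_inj: "c \<in> A \<Longrightarrow> inj_on (snd c) (fst c)"
  using homeomorphic_imp_injective_map[OF chart_homeomorphic] chart_topspace by metis

lemma chart_inv_left: "c \<in> A \<Longrightarrow> p \<in> fst c \<Longrightarrow> chart_inv c (snd c p) = p"
  by (simp add: chart_inv_def chart_inj)

lemma chart_inv_right: "x \<in> snd c ` fst c \<Longrightarrow> snd c (chart_inv c x) = x"
  by (simp add: chart_inv_def f_inv_into_f)

lemma chart_inv_mem: "x \<in> snd c ` fst c \<Longrightarrow> chart_inv c x \<in> fst c"
  by (simp add: chart_inv_def inv_into_into)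

lemma open_chart_image:
  assumes c: "c \<in> A" and W: "openin M W" "W \<subseteq> fst c"
  shows "open (snd c ` W)"
proof -
  have "openin (subtopology M (fst c)) W"
    using W chart_domain[OF c] by (simp add: openin_open_subtopology)
  then have "openin (top_of_set (snd c ` fst c)) (snd c ` W)"
    using homeomorphic_imp_open_map[OF chart_homeomorphic[OF c]] by (simp add: open_map_def)
  then show ?thesis using chart_image[OF c] openin_open_trans by blast
qed

lemma continuous_map_chart_inv:
  assumes c: "c \<in> A" shows "continuous_map (top_of_set (snd c ` fst c)) M (chart_inv c)"
  unfolding continuous_map
proof (intro conjI allI impI)
  show "chart_inv c ` topspace (top_of_set (snd c ` fst c)) \<subseteq> topspace M"
    using chart_inv_left[OF c] openin_subset[OF chart_domain[OF c]] by auto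
  fix W assume W: "openin M W"
  have "{x \<in> topspace (top_of_set (snd c ` fst c)). chart_inv c x \<in> W} = snd c ` (fst c \<inter> W)"
    using chart_inv_left[OF c] by auto
  moreover have "open (snd c ` (fst c \<inter> W))"
    using W chart_domain[OF c] by (intro open_chart_image[OF c]) auto
  ultimately show "openin (top_of_set (snd c ` fst c))
      {x \<in> topspace (top_of_set (snd c ` fst c)). chart_inv c x \<in> W}"
    by (auto intro!: open_subset)
qed

lemma openin_chart_preimage:
  assumes c: "c \<in> A" and W: "open W"
  shows "openin M {p \<in> fst c. snd c p \<in> W}"
proof -
  have "openin (subtopology M (fst c)) {p \<in> topspace (subtopology M (fst c)). snd c p \<in> W \<inter> snd c ` fst c}"
  proof (rule openin_continuous_map_preimage)
    show "continuous_map (subtopology M (fst c)) (top_of_set (snd c ` fst c)) (snd c)"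
      by (rule homeomorphic_imp_continuous_map[OF chart_homeomorphic[OF c]])
    show "openin (top_of_set (snd c ` fst c)) (W \<inter> snd c ` fst c)"
      using W by (metis Int_commute openin_open_Int)
  qed
  moreover have "{p \<in> topspace (subtopology M (fst c)). snd c p \<in> W \<inter> snd c ` fst c}
      = {p \<in> fst c. snd c p \<in> W}"
    using chart_topspace[OF c] by auto
  ultimately show ?thesis using openin_trans_full chart_domain[OF c] by metis
qed

lemma pd_chart_inv:
  assumes "x \<in> snd c ` fst c"
  shows "pd c i f (chart_inv c x) = D (\<lambda>x. f (chart_inv c x)) (axis i 1) x"
  by (simp add: pd_def chart_inv_right[OF assms] o_def)

lemma transition_smooth:
  assumes "c \<in> A" "d \<in> A"
  shows "open (snd c ` (fst c \<inter> fst d))"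
    and "smooth_on (snd c ` (fst c \<inter> fst d)) (\<lambda>x. snd d (chart_inv c x))"
proof -
  show "open (snd c ` (fst c \<inter> fst d))"
    using chart_domain[OF assms(1)] chart_domain[OF assms(2)] assms
    by (intro open_chart_image openin_Int) auto
  show "smooth_on (snd c ` (fst c \<inter> fst d)) (\<lambda>x. snd d (chart_inv c x))"
    using charts_compatible[OF assms] by (simp add: o_def)
qed

text \<open>The Jacobian matrix is the derivative of the transition map.\<close>

lemma jacobian_eq:
  assumes c: "c \<in> A" and d: "d \<in> A" and p: "p \<in> fst c \<inter> fst d"
  shows "jacobian c d p *v a = D (\<lambda>x. snd d (chart_inv c x)) a (snd c p)"
proof -
  let ?V = "snd c ` (fst c \<inter> fst d)"
  note sm = transition_smooth(2)[OF c d]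
  have x: "snd c p \<in> ?V" using p by blast
  have "jacobian c d p $ k $ i = D (\<lambda>x. snd d (chart_inv c x)) (axis i 1) (snd c p) $ k" for k i
    using D_nth[OF sm x, of k "axis i 1"] by (simp add: jacobian_def pd_def o_def)
  then have "(jacobian c d p *v a) $ k = (D (\<lambda>x. snd d (chart_inv c x)) a (snd c p)) $ k" for k
    unfolding linear_eq_sum_axis[OF D_linear[OF sm x], of a]
    by (simp add: matrix_vector_mult_def mult.commute)
  then show ?thesis by (simp add: vec_eq_iff)
qed

end

context riemannian_manifold
begin

abbreviation dom where "dom c \<equiv> snd c ` fst c"
abbreviation gc where "gc c \<equiv> \<lambda>x. g c (chart_inv c x)"

lemma metric_chart_restrict:
  assumes c: "c \<in> A" and V: "open V" "V \<subseteq> dom c"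
  shows "metric_chart V (gc c)"
proof
  show "open V" by fact
  show "smooth_on V (gc c)"
    using metric_smooth[OF c] smooth_on_subset[OF _ V(2)] by (simp add: smooth_in_chart_def o_def)
  fix x assume x: "x \<in> V"
  have p: "chart_inv c x \<in> fst c" by (rule chart_inv_mem[OF subsetD[OF V(2) x]])
  show "transpose (gc c x) = gc c x" by (rule metric_symmetric[OF c p])
  show "a \<bullet> (gc c x *v a) > 0" if "a \<noteq> 0" for a by (rule metric_positive[OF c p that])
qed

lemma metric_chart: "c \<in> A \<Longrightarrow> metric_chart (dom c) (gc c)"
  by (rule metric_chart_restrict) (auto intro: chart_image)

context
  fixes c assumes c: "c \<in> A"
begin

interpretation metric_chart "dom c" "gc c" by (rule metric_chart[OF c])

lemma christoffel_eq: "x \<in> dom c \<Longrightarrow> christoffel g c k i j (chart_inv c x) = chr k i j x"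
  by (simp add: christoffel_def chr_def ginv_def pd_chart_inv)

lemma Gam_axis: "Gam (axis i 1) x $ k $ j = chr k i j x"
  by (simp add: Gam_def axis_def if_distrib[of "\<lambda>t. t * _"] cong: if_cong)

lemma riemann_eq:
  assumes x: "x \<in> dom c"
  shows "riemann g c i j k l (chart_inv c x) = Rm x (axis i 1) (axis j 1) (axis k 1) (axis l 1)"
proof -
  have "pd c i (christoffel g c l j k) (chart_inv c x) = D (Gam (axis j 1)) (axis i 1) x $ l $ k"
    for i j k l
  proof -
    have "pd c i (christoffel g c l j k) (chart_inv c x) = D (\<lambda>x. Gam (axis j 1) x $ l $ k) (axis i 1) x"
      unfolding pd_chart_inv[OF x]
      by (rule D_cong[OF open_U x]) (simp add: christoffel_eq Gam_axis)
    also have "\<dots> = D (Gam (axis j 1)) (axis i 1) x $ l $ k"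
      by (simp add: D_nth[OF smooth_on_nth[OF open_U smooth_Gam] x] D_nth[OF smooth_Gam x])
    finally show ?thesis .
  qed
  then have "riemann_up g c i j k l (chart_inv c x) = curv (axis i 1) (axis j 1) x $ l $ k" for i j k l
    by (simp add: riemann_up_def curv_def christoffel_eq[OF x] matrix_matrix_mult_def Gam_axis
        sum_subtractf)
  then show ?thesis
    by (simp add: riemann_def Rm_def ip_def inner_vec_def matrix_vector_mult_basis column_def)
qed

lemma contraction_eq:
  "x \<in> dom c \<Longrightarrow> curvature_contraction g c i j (chart_inv c x) = contraction i j x"
  by (simp add: curvature_contraction_def contraction_def riemann_eq ginv_def)

lemma gradient_eq:
  "x \<in> dom c \<Longrightarrow> gradient g f c (chart_inv c x) = grad (\<lambda>x. f (chart_inv c x)) x"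
  by (simp add: gradient_def grad_def ginv_def pd_chart_inv matrix_vector_mult_def)

lemma laplacian_eq:
  assumes f: "smooth_in_chart c f" and x: "x \<in> dom c"
  shows "laplacian g f c (chart_inv c x) = trace_hessian (\<lambda>x. f (chart_inv c x)) x"
proof -
  let ?f = "\<lambda>x. f (chart_inv c x)"
  have sm: "smooth_on (dom c) ?f" using f by (simp add: smooth_in_chart_def o_def)
  have "pd c i (pd c j f) (chart_inv c x)
      - (\<Sum>k\<in>UNIV. christoffel g c k i j (chart_inv c x) * pd c k f (chart_inv c x))
    = ip x (cov (grad ?f) (axis i 1) x) (axis j 1)" for i j
  proof -
    have "pd c i (pd c j f) (chart_inv c x) = D (D ?f (axis j 1)) (axis i 1) x"
      unfolding pd_chart_inv[OF x] by (rule D_cong[OF open_U x]) (rule pd_chart_inv)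
    moreover have "D ?f (Gam (axis i 1) x *v axis j 1) x = (\<Sum>k\<in>UNIV. chr k i j x * D ?f (axis k 1) x)"
      by (subst D_eq_sum_axis[OF sm x]) (simp add: matrix_vector_mult_basis column_def Gam_axis)
    ultimately show ?thesis
      using D_D_eq_hessian[OF sm x, of "axis j 1" "axis i 1"]
      by (simp add: christoffel_eq[OF x] pd_chart_inv[OF x])
  qed
  then show ?thesis by (simp add: laplacian_def trace_hessian_def ginv_def)
qed

end

text \<open>The gradient is a vector field: its components transform with the Jacobian matrix.\<close>

lemma gradient_transform:
  assumes c: "c \<in> A" and d: "d \<in> A" and p: "p \<in> fst c \<inter> fst d" and f: "smooth_in_chart d f"
  shows "jacobian c d p *v gradient g f c p = gradient g f d p"
proof -
  let ?P = "jacobian c d p"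
  let ?df = "\<lambda>c. (\<chi> i. pd c i f p)"
  have inv: "invertible (g c p)" "invertible (g d p)"
  proof -
    have "invertible (g e p)" if "e \<in> A" "p \<in> fst e" for e
      using metric_chart.G_invertible[OF metric_chart[OF that(1)], of "snd e p"] that
      by (simp add: chart_inv_left)
    then show "invertible (g c p)" "invertible (g d p)" using c d p by auto
  qed
  have gr: "g e p *v gradient g f e p = ?df e" if "invertible (g e p)" for e
  proof -
    have "gradient g f e p = matrix_inv (g e p) *v ?df e"
      by (simp add: gradient_def ginv_def matrix_vector_mult_def)
    then show ?thesis using matrix_inv_inverts[OF that] by (simp add: matrix_vector_mul_assoc)
  qed
  have chain: "?df c = transpose ?P *v ?df d"
  proof -
    let ?V = "snd c ` (fst c \<inter> fst d)" and ?t = "\<lambda>x. snd d (chart_inv c x)"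
      and ?f = "\<lambda>x. f (chart_inv d x)"
    note t = transition_smooth[OF c d]
    have x: "snd c p \<in> ?V" using p by blast
    have sf: "smooth_on (dom d) ?f" using f by (simp add: smooth_in_chart_def o_def)
    have y: "?t (snd c p) = snd d p" using chart_inv_left[OF c] p by simp
    have mem: "snd d p \<in> dom d" using p by blast
    have "D (\<lambda>x. f (chart_inv c x)) a (snd c p) = D ?f (D ?t a (snd c p)) (snd d p)" for a
    proof -
      have "D (\<lambda>x. f (chart_inv c x)) a (snd c p) = D (\<lambda>x. ?f (?t x)) a (snd c p)"
        using chart_inv_left[OF c] chart_inv_left[OF d] by (intro D_cong[OF t(1) x]) auto
      also have "\<dots> = D ?f (D ?t a (snd c p)) (snd d p)"
        by (rule D_eqI, rule has_derivative_compose[OF smooth_on_has_derivative[OF t(2) x]])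
          (simp add: y smooth_on_has_derivative[OF sf mem])
      finally show ?thesis .
    qed
    then have "pd c i f p = D ?f (?P *v axis i 1) (snd d p)" for i
      using jacobian_eq[OF c d p, of "axis i 1"] by (simp add: pd_def o_def)
    also have "D ?f (?P *v axis i 1) (snd d p) = (\<Sum>k\<in>UNIV. ?P $ k $ i * pd d k f p)" for i
      by (subst D_eq_sum_axis[OF sf mem]) (simp add: matrix_vector_mult_basis column_def pd_def o_def)
    finally show ?thesis by (simp add: vec_eq_iff transpose_def matrix_vector_mult_def)
  qed
  have gt: "g c p = transpose ?P ** g d p ** ?P" by (rule metric_tensor[OF c d p])
  have "det (g c p) \<noteq> 0" using inv invertible_det_nz by blast
  then have P: "invertible (transpose ?P)"
    unfolding gt invertible_det_nz by (auto simp: det_mul)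
  have "transpose ?P *v (g d p *v (?P *v gradient g f c p)) = transpose ?P *v ?df d"
    using gr[OF inv(1)] unfolding chain gt by (simp only: matrix_vector_mul_assoc matrix_mul_assoc)
  then have "g d p *v (?P *v gradient g f c p) = ?df d"
    using P by (metis invertible_def matrix_vector_mul_assoc matrix_vector_mul_lid)
  then have "g d p *v (?P *v gradient g f c p) = g d p *v gradient g f d p" using gr[OF inv(2)] by simp
  then show ?thesis
    using inv(2) by (metis invertible_def matrix_vector_mul_assoc matrix_vector_mul_lid)
qed

end

lemma D_has_vector_derivative:
  fixes f :: "real \<Rightarrow> 'b::real_normed_vector"
  assumes "f differentiable (at s)"
  shows "(f has_vector_derivative D f 1 s) (at s)"
proof -
  have f: "(f has_derivative frechet_derivative f (at s)) (at s)"
    using assms frechet_derivative_works by blast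
  have "frechet_derivative f (at s) = (\<lambda>h. h *\<^sub>R D f 1 s)"
  proof
    fix h
    show "D f h s = h *\<^sub>R D f 1 s"
      using linear_cmul[OF has_derivative_linear[OF f], of h 1]
      by (simp only: real_scaleR_def mult_1_right)
  qed
  then show ?thesis using f by (simp only: has_vector_derivative_def)
qed

lemma eq_divide_scaleR:
  fixes a b :: "'b::real_vector"
  assumes "r \<noteq> 0" "r *\<^sub>R a = s *\<^sub>R b" shows "a = (s / r) *\<^sub>R b"
proof -
  have "a = (1 / r) *\<^sub>R (r *\<^sub>R a)" using assms(1) by simp
  then show ?thesis unfolding assms(2) by simp
qed

context riemannian_manifold
begin

text \<open>The integral curve of the gradient starting at a point \<open>x\<^sub>0\<close> is a reparametrized geodesic, so
  \<open>\<nabla>\<^sub>v v\<close> is tangent to \<open>v\<close> along it for positive times, and at \<open>x\<^sub>0\<close> by continuity.\<close>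

lemma transnormal_gradient_direction:
  assumes c: "c \<in> A" and \<tau>: "smooth_function A \<tau>" and tn: "transnormal M A g \<tau>"
    and x0: "x0 \<in> dom c"
  defines "v \<equiv> metric_chart.grad (gc c) (\<lambda>x. \<tau> (chart_inv c x))"
  assumes nz: "v x0 \<noteq> 0"
  shows "\<exists>k. metric_chart.cov (gc c) v (v x0) x0 = k *\<^sub>R v x0"
proof -
  interpret metric_chart "dom c" "gc c" by (rule metric_chart[OF c])
  have sm: "smooth_on (dom c) (\<lambda>x. \<tau> (chart_inv c x))"
    using \<tau> c by (simp add: smooth_function_def smooth_in_chart_def o_def)
  have v: "smooth_on (dom c) v" unfolding v_def by (rule smooth_grad[OF sm])
  obtain e y where e: "e > 0" and y: "continuous_on {0..e} y" "y 0 = x0"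
    "\<And>t. t \<in> {0..e} \<Longrightarrow> y t \<in> dom c"
    "\<And>t. 0 < t \<Longrightarrow> t < e \<Longrightarrow> (y has_vector_derivative v (y t)) (at t)"
    using integral_curve_exists[OF open_U v x0] by blast
  define I where "I = {0<..<e}"
  define \<gamma> where "\<gamma> t = chart_inv c (y t)" for t
  have yI: "y t \<in> dom c" if "t \<in> I" for t using y(3) that by (auto simp: I_def)
  have \<gamma>c: "\<gamma> t \<in> fst c" "snd c (\<gamma> t) = y t" if "t \<in> I" for t
    using chart_inv_mem[OF yI[OF that]] chart_inv_right[OF yI[OF that]] by (auto simp: \<gamma>_def)
  have "integral_curve M A (gradient g \<tau>) I \<gamma>"
    unfolding integral_curve_def
  proof (intro conjI ballI impI)
    have "continuous_on I y" using y(1) by (rule continuous_on_subset) (auto simp: I_def)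
    then have "continuous_map (top_of_set I) (top_of_set (dom c)) y"
      using yI by (auto simp: continuous_map_in_subtopology)
    then have "continuous_map (top_of_set I) M (chart_inv c \<circ> y)"
      by (rule continuous_map_compose[OF _ continuous_map_chart_inv[OF c]])
    then show "continuous_map (top_of_set I) M \<gamma>"
      by (simp only: \<gamma>_def[abs_def] o_def)
    fix t d assume t: "t \<in> I" and d: "d \<in> A" and td: "\<gamma> t \<in> fst d"
    note tr = transition_smooth[OF c d]
    have p: "\<gamma> t \<in> fst c \<inter> fst d" using \<gamma>c[OF t] td by blast
    then have "y t \<in> snd c ` (fst c \<inter> fst d)" using \<gamma>c[OF t] by force
    from smooth_on_has_derivative[OF tr(2) this]
    have "((\<lambda>t. snd d (chart_inv c (y t))) has_vector_derivative
        D (\<lambda>x. snd d (chart_inv c x)) (v (y t)) (y t)) (at t)"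
      by (rule has_vector_derivative_chain[rotated]) (use y(4) t in \<open>simp add: I_def\<close>)
    also have "D (\<lambda>x. snd d (chart_inv c x)) (v (y t)) (y t) = jacobian c d (\<gamma> t) *v v (y t)"
      using jacobian_eq[OF c d p] \<gamma>c[OF t] by simp
    also have "v (y t) = gradient g \<tau> c (\<gamma> t)"
      unfolding v_def \<gamma>_def by (rule gradient_eq[OF c yI[OF t], symmetric])
    also have "jacobian c d (\<gamma> t) *v gradient g \<tau> c (\<gamma> t) = gradient g \<tau> d (\<gamma> t)"
      using gradient_transform[OF c d p] \<tau> d by (simp add: smooth_function_def)
    finally show "(snd d \<circ> \<gamma> has_vector_derivative gradient g \<tau> d (\<gamma> t)) (at t)"
      by (simp add: o_def \<gamma>_def)
  qed
  moreover have "open I" "is_interval I" by (auto simp: I_def is_interval_oo)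
  ultimately have "reparametrized_geodesic M A g I \<gamma>" using tn by (simp add: transnormal_def)
  then obtain I' \<sigma> where I': "open I'" and bij: "bij_betw \<sigma> I' I" and \<sigma>: "smooth_on I' \<sigma>"
    and \<sigma>': "\<And>s. s \<in> I' \<Longrightarrow> deriv \<sigma> s \<noteq> 0" and geo: "geodesic M A g I' (\<gamma> \<circ> \<sigma>)"
    unfolding reparametrized_geodesic_def by blast
  have parallel: "\<exists>k. cov v (v (y t)) (y t) = k *\<^sub>R v (y t)" if t: "t \<in> I" for t
  proof -
    obtain s where s: "s \<in> I'" "\<sigma> s = t" using bij t by (auto simp: bij_betw_def)
    have \<sigma>I: "\<sigma> s \<in> I" if "s \<in> I'" for s using bij that by (auto simp: bij_betw_def)
    have \<sigma>v: "(\<sigma> has_vector_derivative D \<sigma> 1 s) (at s)" if "s \<in> I'" for s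
      by (rule D_has_vector_derivative[OF smooth_on_imp_differentiable[OF \<sigma> that]])
    have y\<sigma>: "((\<lambda>s. y (\<sigma> s)) has_vector_derivative D \<sigma> 1 s *\<^sub>R v (y (\<sigma> s))) (at s)"
      if "s \<in> I'" for s
      using vector_diff_chain_at[OF \<sigma>v[OF that], of y] y(4) \<sigma>I[OF that] by (simp add: I_def o_def)
    have vel: "velocity c (\<gamma> \<circ> \<sigma>) s = D \<sigma> 1 s *\<^sub>R v (y (\<sigma> s))" if "s \<in> I'" for s
    proof -
      have "((snd c \<circ> (\<gamma> \<circ> \<sigma>)) has_vector_derivative D \<sigma> 1 s *\<^sub>R v (y (\<sigma> s))) (at s)"
        by (rule has_vector_derivative_transform_within_open[OF y\<sigma>[OF that] I' that])
          (simp add: \<gamma>c(2)[OF \<sigma>I])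
      then show ?thesis unfolding velocity_def by (rule vector_derivative_at)
    qed
    define k k' where "k = D \<sigma> 1 s" and "k' = D (D \<sigma> 1) 1 s"
    define w where "w = v (y t)"
    have k: "k \<noteq> 0"
      using \<sigma>'[OF s(1)] DERIV_imp_deriv[of \<sigma> k s] \<sigma>v[OF s(1)]
      by (simp add: has_real_derivative_iff_has_vector_derivative k_def)
    have dv: "((\<lambda>s. v (y (\<sigma> s))) has_vector_derivative D v (k *\<^sub>R w) (y t)) (at s)"
    proof -
      have "(v has_derivative frechet_derivative v (at (y t))) (at (y (\<sigma> s)))"
        using smooth_on_has_derivative[OF v yI[OF t]] s by simp
      then show ?thesis
        using has_vector_derivative_chain[OF y\<sigma>[OF s(1)]] s by (simp add: k_def w_def)
    qed
    have "((\<lambda>s. D \<sigma> 1 s *\<^sub>R v (y (\<sigma> s))) has_vector_derivative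
        k *\<^sub>R D v (k *\<^sub>R w) (y t) + k' *\<^sub>R w) (at s)"
    proof -
      have "(D \<sigma> 1 has_vector_derivative k') (at s)"
        unfolding k'_def
        by (rule D_has_vector_derivative[OF
              smooth_on_imp_differentiable[OF smooth_on_frechet_derivative[OF \<sigma>] s(1)]])
      then have "(D \<sigma> 1 has_real_derivative k') (at s)"
        by (simp add: has_real_derivative_iff_has_vector_derivative)
      from has_vector_derivative_scaleR[OF this dv] show ?thesis
        using s by (simp add: k_def w_def)
    qed
    then have acc: "(velocity c (\<gamma> \<circ> \<sigma>) has_vector_derivative
        k *\<^sub>R D v (k *\<^sub>R w) (y t) + k' *\<^sub>R w) (at s)"
      by (rule has_vector_derivative_transform_within_open[OF _ I' s(1)]) (simp add: vel)
    have g: "\<gamma> (\<sigma> s) = chart_inv c (y t)" "\<gamma> (\<sigma> s) \<in> fst c"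
      using s \<gamma>c[OF t] by (auto simp: \<gamma>_def)
    have "(velocity c (\<gamma> \<circ> \<sigma>) has_vector_derivative (\<chi> l. - (\<Sum>i\<in>UNIV. \<Sum>j\<in>UNIV.
        christoffel g c l i j (\<gamma> (\<sigma> s)) * velocity c (\<gamma> \<circ> \<sigma>) s $ i * velocity c (\<gamma> \<circ> \<sigma>) s $ j))) (at s)"
      using geo s(1) c g(2) unfolding geodesic_def by (auto simp: o_def)
    then have "k *\<^sub>R D v (k *\<^sub>R w) (y t) + k' *\<^sub>R w = (\<chi> l. - (\<Sum>i\<in>UNIV. \<Sum>j\<in>UNIV.
        christoffel g c l i j (\<gamma> (\<sigma> s)) * velocity c (\<gamma> \<circ> \<sigma>) s $ i * velocity c (\<gamma> \<circ> \<sigma>) s $ j))"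
      using vector_derivative_unique_at[OF acc] by blast
    also have "\<dots> = - (Gam (k *\<^sub>R w) (y t) *v (k *\<^sub>R w))"
    proof -
      have "(Gam (k *\<^sub>R w) (y t) *v (k *\<^sub>R w)) $ l = (\<Sum>i\<in>UNIV. \<Sum>j\<in>UNIV.
          chr l i j (y t) * (k * w $ i) * (k * w $ j))" for l
        by (subst sum.swap)
          (simp add: matrix_vector_mult_def Gam_def sum_distrib_left sum_distrib_right ac_simps)
      then show ?thesis
        using vel[OF s(1)] s
        by (simp add: vec_eq_iff \<gamma>_def christoffel_eq[OF c yI[OF t]] k_def w_def)
    qed
    \<comment> \<open>The geodesic equation for \<open>\<sigma>' v\<close>: \<open>\<sigma>'\<^sup>2 \<nabla>\<^sub>v v + \<sigma>'' v = 0\<close>.\<close>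
    finally have kk: "(k * k) *\<^sub>R cov v w (y t) = - k' *\<^sub>R w"
      using linear_cmul[OF D_linear[OF v yI[OF t]], of k w]
      by (simp add: cov_def Gam_linear matrix_vector_mult_scaleR scaleR_matrix_vector_assoc[symmetric]
          w_def[symmetric] scaleR_add_right eq_neg_iff_add_eq_0 algebra_simps)
    have "cov v w (y t) = (- k' / (k * k)) *\<^sub>R w"
      by (rule eq_divide_scaleR[OF _ kk]) (use k in simp)
    then show ?thesis unfolding w_def by blast
  qed
  \<comment> \<open>The part of \<open>\<nabla>\<^sub>v v\<close> orthogonal to \<open>v\<close>, multiplied by \<open>Q\<close>; it extends continuously to time \<open>0\<close>.\<close>
  define F where "F x = ip x (v x) (v x) *\<^sub>R cov v (v x) x - ip x (cov v (v x) x) (v x) *\<^sub>R v x" for x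
  have "smooth_on (dom c) F"
    unfolding F_def by (intro smooth_on_diff smooth_on_scaleR smooth_ip smooth_cov_field v open_U)
  then have "continuous_on (dom c) F" by (rule smooth_on_continuous)
  then have "continuous_on {0..e} (\<lambda>t. F (y t))"
    by (rule continuous_on_compose2[OF _ y(1)]) (use y(3) in blast)
  then have cont: "continuous_on (closure {0<..<e}) (\<lambda>t. F (y t))" using e by simp
  have F0: "F (y t) = 0" if t: "t \<in> {0<..<e}" for t
  proof -
    obtain k where "cov v (v (y t)) (y t) = k *\<^sub>R v (y t)"
      using parallel[of t] t by (auto simp: I_def)
    then show ?thesis by (simp add: F_def ip_linear)
  qed
  have "F (y 0) = 0"
    by (rule continuous_constant_on_closure[OF cont F0]) (use e in auto)
  then have "ip x0 (v x0) (v x0) *\<^sub>R cov v (v x0) x0 = ip x0 (cov v (v x0) x0) (v x0) *\<^sub>R v x0"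
    by (simp add: F_def y(2))
  moreover have "ip x0 (v x0) (v x0) \<noteq> 0" using ip_pos[OF x0 nz] by simp
  ultimately have "cov v (v x0) x0 = (ip x0 (cov v (v x0) x0) (v x0) / ip x0 (v x0) (v x0)) *\<^sub>R v x0"
    by (intro eq_divide_scaleR)
  then show ?thesis by blast
qed

end

context kaehler_manifold
begin

abbreviation Jc where "Jc c \<equiv> \<lambda>x. J c (chart_inv c x)"

lemma kaehler_chart_restrict:
  assumes c: "c \<in> A" and V: "open V" "V \<subseteq> dom c"
  shows "kaehler_chart V (gc c) (Jc c)"
proof -
  interpret metric_chart V "gc c" by (rule metric_chart_restrict[OF assms])
  note mem = subsetD[OF V(2)]
  have smJ: "smooth_on V (Jc c)"
    using J_smooth[OF c] smooth_on_subset[OF _ V(2)] by (simp add: smooth_in_chart_def o_def)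
  show ?thesis
  proof
    show "smooth_on V (Jc c)" by (rule smJ)
    fix x assume x: "x \<in> V"
    then have p: "chart_inv c x \<in> fst c" using chart_inv_mem[OF mem] by blast
    show "Jc c x *v (Jc c x *v a) = - a" for a
      unfolding matrix_vector_mul_assoc J_squared[OF c p]
      by (simp add: bounded_bilinear.minus_left[OF bounded_bilinear_matrix_vector_mult])
    show "ip x (Jc c x *v a) (Jc c x *v b) = ip x a b" for a b
    proof -
      have "(Jc c x *v a) \<bullet> w = a \<bullet> (transpose (Jc c x) *v w)" for w
        by (metis dot_lmul_matrix inner_commute transpose_matrix_vector)
      then show ?thesis
        using J_isometric[OF c p] by (simp only: ip_def matrix_vector_mul_assoc matrix_mul_assoc)
    qed
    show "D (Jc c) a x *v b + Gam a x *v (Jc c x *v b) = Jc c x *v (Gam a x *v b)" for a b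
    proof -
      have ax: "D (Jc c) (axis k 1) x + Gam (axis k 1) x ** Jc c x - Jc c x ** Gam (axis k 1) x = 0" for k
      proof -
        have "(D (Jc c) (axis k 1) x + Gam (axis k 1) x ** Jc c x - Jc c x ** Gam (axis k 1) x) $ i $ j = 0"
          for i j
        proof -
          have "D (Jc c) (axis k 1) x $ i $ j = pd c k (\<lambda>q. J c q $ i $ j) (chart_inv c x)"
            by (simp add: pd_chart_inv[OF mem[OF x]] D_nth[OF smooth_on_nth[OF open_U smJ] x] D_nth[OF smJ x])
          moreover have "nabla_J g J c k i j (chart_inv c x) = 0" by (rule J_parallel[OF c p])
          ultimately show ?thesis
            by (simp add: nabla_J_def matrix_matrix_mult_def Gam_axis[OF c] christoffel_eq[OF c mem[OF x]]
                mult.commute)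
        qed
        then show ?thesis by (simp add: vec_eq_iff)
      qed
      let ?L = "\<lambda>a. D (Jc c) a x + Gam a x ** Jc c x - Jc c x ** Gam a x"
      have "linear ?L"
        by (intro linearI)
          (simp_all add: linear_add[OF D_linear[OF smJ x]] linear_cmul[OF D_linear[OF smJ x]] Gam_linear
            bounded_bilinear.add_left[OF bounded_bilinear_matrix_matrix_mult]
            bounded_bilinear.add_right[OF bounded_bilinear_matrix_matrix_mult]
            bounded_bilinear.scaleR_left[OF bounded_bilinear_matrix_matrix_mult]
            bounded_bilinear.scaleR_right[OF bounded_bilinear_matrix_matrix_mult] scaleR_diff_right scaleR_add_right)
      from linear_eq_sum_axis[OF this, of a] have "?L a = 0" by (simp add: ax)
      then have "?L a *v b = 0" by simp
      then show ?thesis by (simp add: algebra_simps matrix_vector_mul_assoc)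
    qed
  qed
qed

text \<open>Replacing partial by covariant derivatives in \<open>L\<^sub>v J = 0\<close>, which is possible because \<open>\<nabla>\<close> is
  torsion-free, and using \<open>\<nabla>J = 0\<close>, one is left with the commutation of \<open>\<nabla>v\<close> and \<open>J\<close>.\<close>

lemma holomorphic_gradient:
  assumes c: "c \<in> A" and V: "open V" "V \<subseteq> dom c" and x: "x \<in> V"
    and \<tau>: "smooth_function A \<tau>" and hol: "holomorphic_vector_field A J (gradient g \<tau>)"
  defines "v \<equiv> metric_chart.grad (gc c) (\<lambda>x. \<tau> (chart_inv c x))"
  shows "metric_chart.cov (gc c) v (Jc c x *v b) x = Jc c x *v metric_chart.cov (gc c) v b x"
proof -
  interpret kaehler_chart V "gc c" "Jc c" by (rule kaehler_chart_restrict[OF c V])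
  note mem = subsetD[OF V(2)]
  have "smooth_on (dom c) (\<lambda>x. \<tau> (chart_inv c x))"
    using \<tau> c by (simp add: smooth_function_def smooth_in_chart_def o_def)
  then have sm: "smooth_on V (\<lambda>x. \<tau> (chart_inv c x))" using V(2) by (rule smooth_on_subset)
  have v: "smooth_on V v" unfolding v_def by (rule smooth_grad[OF sm])
  have Jx: "smooth_on V (Jc c)" by (rule J_smooth)
  have p: "chart_inv c x \<in> fst c" by (rule chart_inv_mem[OF mem[OF x]])
  have gv: "gradient g \<tau> c (chart_inv c y) = v y" if "y \<in> V" for y
    unfolding v_def by (rule gradient_eq[OF c mem[OF that]])
  have ax: "D (Jc c) (v x) x *v axis j 1 - D v (Jc c x *v axis j 1) x + Jc c x *v D v (axis j 1) x = 0" for j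
  proof -
    have "(D (Jc c) (v x) x *v axis j 1 - D v (Jc c x *v axis j 1) x + Jc c x *v D v (axis j 1) x) $ i
      = lie_J J (gradient g \<tau>) c i j (chart_inv c x)" for i
    proof -
      have 1: "pd c k (\<lambda>q. gradient g \<tau> c q $ i) (chart_inv c x) = D v (axis k 1) x $ i" for k i
        unfolding pd_chart_inv[OF mem[OF x]] D_nth[OF v x, symmetric]
        by (rule D_cong[OF V(1) x]) (simp add: gv)
      have 2: "pd c k (\<lambda>q. J c q $ i $ j) (chart_inv c x) = D (Jc c) (axis k 1) x $ i $ j" for k
        by (simp add: pd_chart_inv[OF mem[OF x]] D_nth[OF smooth_on_nth[OF open_U Jx] x] D_nth[OF Jx x])
      have 3: "(D (Jc c) (v x) x *v axis j 1) $ i = (\<Sum>k\<in>UNIV. v x $ k * D (Jc c) (axis k 1) x $ i $ j)"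
        unfolding linear_eq_sum_axis[OF D_linear[OF Jx x], of "v x"]
        by (simp add: matrix_vector_mult_basis column_def)
      have 4: "D v (Jc c x *v axis j 1) x $ i = (\<Sum>k\<in>UNIV. Jc c x $ k $ j * D v (axis k 1) x $ i)"
        unfolding linear_eq_sum_axis[OF D_linear[OF v x], of "Jc c x *v axis j 1"]
        by (simp add: matrix_vector_mult_basis column_def)
      show ?thesis
        by (simp add: lie_J_def 1 2 3 4 gv[OF x] matrix_vector_mult_def[of _ "D v _ x"]
            sum.distrib sum_subtractf)
    qed
    then show ?thesis using hol c p by (simp add: holomorphic_vector_field_def vec_eq_iff)
  qed
  let ?L = "\<lambda>b. D (Jc c) (v x) x *v b - D v (Jc c x *v b) x + Jc c x *v D v b x"
  have "linear ?L"
    by (intro linearI)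
      (simp_all add: linear_add[OF D_linear[OF v x]] linear_cmul[OF D_linear[OF v x]]
        matrix_vector_right_distrib matrix_vector_mult_scaleR scaleR_diff_right scaleR_add_right)
  from linear_eq_sum_axis[OF this, of b] have "?L b = 0" by (simp add: ax)
  then have Db: "D v (Jc c x *v b) x = D (Jc c) (v x) x *v b + Jc c x *v D v b x"
    by (simp add: algebra_simps)
  have "D (Jc c) (v x) x *v b + Gam (Jc c x *v b) x *v v x = Jc c x *v (Gam b x *v v x)"
    using kaehler_chart.J_parallel[OF kaehler_chart_restrict[OF c V] x, of "v x" b]
    unfolding Gam_sym[OF x, of "v x"] by simp
  then show ?thesis unfolding cov_def Db by (simp add: matrix_vector_right_distrib algebra_simps)
qed

end

theorem theorem1p3:
  fixes M :: "'a topology"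
    and A :: "('a, 4) chart set"
    and g J :: "('a, 4) tensor2"
    and \<tau> :: "'a \<Rightarrow> real"
  assumes "kaehler_manifold M A g J"
    and "weakly_einstein A g"
    and "smooth_function A \<tau>"
    and "transnormal M A g \<tau>"
    and "holomorphic_vector_field A J (gradient g \<tau>)"
  shows "isoparametric M A g \<tau>"
  unfolding isoparametric_def
proof (intro ballI impI)
  interpret kaehler_manifold M A g J by fact
  fix c p assume c: "c \<in> A" and p: "p \<in> fst c" and nz: "gradient g \<tau> c p \<noteq> 0"
  let ?T = "\<lambda>x. \<tau> (chart_inv c x)" and ?v = "metric_chart.grad (gc c) (\<lambda>x. \<tau> (chart_inv c x))"
  have sm0: "smooth_on (dom c) ?T"
    using assms(3) c by (simp add: smooth_function_def smooth_in_chart_def o_def)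
  define V where "V = {x \<in> dom c. ?v x \<noteq> 0}"
  have V: "open V" "V \<subseteq> dom c"
    unfolding V_def
    using open_nonzero_subset[OF chart_image[OF c]
        smooth_on_continuous[OF metric_chart.smooth_grad[OF metric_chart[OF c] sm0]]] by auto
  note mem = subsetD[OF V(2)]
  define x0 where "x0 = snd c p"
  have x0: "x0 \<in> V" "chart_inv c x0 = p"
    using p nz gradient_eq[OF c, of "snd c p" \<tau>] chart_inv_left[OF c p] by (auto simp: V_def x0_def)
  have sm: "smooth_on V ?T" by (rule smooth_on_subset[OF sm0 V(2)])
  interpret kaehler_chart V "gc c" "Jc c" by (rule kaehler_chart_restrict[OF c V])
  interpret holomorphic_transnormal_chart V "gc c" "Jc c" ?T
  proof
    show "smooth_on V ?T" by fact
    fix x assume x: "x \<in> V"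
    show nz: "?v x \<noteq> 0" using x by (simp add: V_def)
    show "cov ?v (Jc c x *v b) x = Jc c x *v cov ?v b x" for b
      by (rule holomorphic_gradient[OF c V x assms(3,5)])
    show "\<exists>k. cov ?v (?v x) x = k *\<^sub>R ?v x"
      by (rule transnormal_gradient_direction[OF c assms(3,4) mem[OF x] nz])
  qed
  have "\<exists>\<kappa>. \<forall>i j. contraction i j x = \<kappa> * gc c x $ i $ j" if x: "x \<in> V" for x
  proof -
    obtain f where "\<forall>i j. curvature_contraction g c i j (chart_inv c x) = f (chart_inv c x) * gc c x $ i $ j"
      using assms(2) c chart_inv_mem[OF mem[OF x]] unfolding weakly_einstein_def by blast
    then show ?thesis using contraction_eq[OF c mem[OF x]] by auto
  qed
  then have dep: "dep (trace_hessian ?T)" "dep Q"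
    using weakly_einstein_imp_dep dep_Q by blast+
  have fact: "\<exists>W h. open W \<and> x0 \<in> W \<and> W \<subseteq> V \<and> (\<forall>x\<in>W. f x = h (?T x))" if "dep f" for f
  proof -
    have "D ?T (?v x0) x0 \<noteq> 0" using Q_pos[OF x0(1)] by (simp add: D_tau[OF x0(1)] Q_def)
    then show ?thesis
      using factors_through_near[OF V(1) x0(1) sm, of "?v x0" f] that smooth_on_imp_differentiable
      unfolding dep_def by metis
  qed
  obtain W1 a where W1: "open W1" "x0 \<in> W1" "W1 \<subseteq> V" "\<forall>x\<in>W1. Q x = a (?T x)"
    using fact[OF dep(2)] by blast
  obtain W2 b where W2: "open W2" "x0 \<in> W2" "W2 \<subseteq> V" "\<forall>x\<in>W2. trace_hessian ?T x = b (?T x)"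
    using fact[OF dep(1)] by blast
  define W where "W = {q \<in> fst c. snd c q \<in> W1 \<inter> W2}"
  have "openin M W"
    unfolding W_def using W1 W2 by (intro openin_chart_preimage[OF c]) auto
  moreover have "p \<in> W" "W \<subseteq> fst c" using p W1 W2 by (auto simp: W_def x0_def)
  moreover have "gradient_square g \<tau> c q = a (\<tau> q) \<and> laplacian g \<tau> c q = b (\<tau> q)" if "q \<in> W" for q
  proof -
    have q: "q \<in> fst c" "snd c q \<in> W1" "snd c q \<in> W2" using that by (auto simp: W_def)
    have x: "snd c q \<in> dom c" "chart_inv c (snd c q) = q" using q chart_inv_left[OF c] by auto
    have "gradient_square g \<tau> c q = Q (snd c q)"
      using gradient_eq[OF c x(1), of \<tau>] by (simp add: gradient_square_def Q_def ip_def x(2))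
    moreover have "laplacian g \<tau> c q = trace_hessian ?T (snd c q)"
      using laplacian_eq[OF c _ x(1), of \<tau>] assms(3) c x(2) by (simp add: smooth_function_def)
    ultimately show ?thesis using q W1 W2 x(2) by simp
  qed
  ultimately show "\<exists>W a b. openin M W \<and> p \<in> W \<and> W \<subseteq> fst c \<and>
      (\<forall>q\<in>W. gradient_square g \<tau> c q = a (\<tau> q) \<and> laplacian g \<tau> c q = b (\<tau> q))"
    by blast
qed

end
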